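(* Suppose $(\mathcal U,\mathcal L)$ is a $\mathrm{FinSet}$-pair on spaces $(V_n)$, with embeddings $\varphi_{N,n}$ in $\mathcal U$ and $\psi_{N,n}$ in $\mathcal L$; let $(\Omega_n\subseteq V_n)$ be $\mathrm{FinSet}$-compatible, fix a degree $d$, and set $$K_n=\{p\in\mathbb R[V_n]_{\le d}^{\mathfrak S_n}:\ p|_{\Omega_n}\ge0\}.$$ Let $\varprojlim_{\mathcal U}K_n=\bigcap_n\pi_n^{-1}(K_n)\subseteq\varprojlim_{\mathcal U}\mathbb R[V_n]^{\mathfrak S_n}_{\le d}$ and $\varinjlim_{\mathcal L}K_n=\bigcup_n\varsigma_n(K_n)\subseteq\varinjlim_{\mathcal L}\mathbb R[V_n]^{\mathfrak S_n}_{\le d}$. Then: (1) (Density) The isomorphism $\varinjlim_{\mathcal L}\mathbb R[V_n]_{\le d}^{\mathfrak S_n}\to\varprojlim_{\mathcal U}\mathbb R[V_n]_{\le d}^{\mathfrak S_n}$, $(\mathrm{sym}_n^{\mathcal L}q_k)_n\mapsto(\mathbb E\,q_k\circ L_{k,n})_n$, maps $\varinjlim_{\mathcal L}K_n$ into a dense subset of $\varprojlim_{\mathcal U}K_n$. (2) (Monotonicity) $\pi_n^{-1}(K_n)\supseteq\pi_N^{-1}(K_N)$ if $n\preceq_{\mathcal U}N$, and $\varsigma_n(K_n)\subseteq\varsigma_N(K_N)$ if $n\preceq_{\mathcal L}N$. (3) (Geometry) The cones $\varprojlim_{\mathcal U}K_n$ and $\varinjlim_{\mathcal L}K_n$ are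 convex, and the former is closed. Moreover, both of these cones are pointed if all the cones $K_n$ are pointed, and both have nonempty interior if all the cones $K_n$ have nonempty interior.
   Context: Conventions. Dimension indices $n,m,k,N,M$ are positive integers; $[n]=\{1,\dots,n\}$; $n\mid N$ is divisibility; $\mathfrak S_n$ is the symmetric group on $[n]$. Vector spaces are finite-dimensional real inner product spaces and $A^\star$ is the adjoint of $A$. $\mathbb R^n$ has its standard basis and inner product, and $\mathfrak S_n$ acts by $(\sigma x)_i=x_{\sigma^{-1}(i)}$. $\mathbb R[V]_{\le d}$ is the space of polynomials on $V$ of degree at most $d$. A cone $K$ is pointed if $K\cap(-K)=\{0\}$. Closure, density and interior in finite-dimensional spaces refer to the usual topology. Standard constructions. A standard construction $\mathcal F$ is built inductively from the identity construction using finitely many of the following operations, each producing spaces $\mathcal F(\mathbb R^n)$ and, for each linear $A:\mathbb R^n\to\mathbb R^m$, a linear map $\mathcal F(A):\mathcal F(\mathbb R^n)\to\mathcal F(\mathbb R^m)$: the product $\mathcal F_1\times\mathcal F_2$ (with $\mathcal F_1(A)\times\mathcal F_2(A)$); the tensor product $\mathcal F_1\otimes\mathcal F_2$ (with $\mathcal F_1(A)\otimes\mathcal F_2(A)$); the symmetric power $\mathrm{Sym}^k\mathcal F_1$, viewed as symmetric tensors (with $\mathcal F_1(A)^{\otimes k}$ restricted to symmetric tensors); and homogeneous degree-$k$ polynomials $\mathbb R[\mathcal F_1]_k$ over $\mathcal F_1(\mathbb R^n)$ (with $p\mapsto p\circ\mathcal F_1(A)^\star$); $\mathbb R[\mathcal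 F_1]_0=\mathbb R$ is trivial, and $\mathbb R[\mathcal F_1]_{\le k}=\mathbb R[\mathcal F_1]_0\times\cdots\times\mathbb R[\mathcal F_1]_k$. Bases and inner products. If $(e_\alpha)_{\alpha\in\mathcal A}$, $(e_\beta)_{\beta\in\mathcal B}$ are the orthogonal bases of $W,U$: $W\times U$ has basis $(e_\alpha,0),(0,e_\beta)$ and the sum inner product; $W\otimes U$ has basis $e_\alpha\otimes e_\beta$ and the product inner product; $\mathrm{Sym}^kW$ has basis the orbit sums $E_{[\alpha_1,\dots,\alpha_k]}=\sum e_{\alpha_1'}\otimes\cdots\otimes e_{\alpha_k'}$ over distinct rearrangements $(\alpha_i')$ of $(\alpha_i)$, and the inner product making $E_{[\alpha_1,\dots,\alpha_k]}/\sqrt{\prod_i\langle e_{\alpha_i},e_{\alpha_i}\rangle}$ orthonormal; $\mathbb R[W]_k$ has basis the monomials $m_\mu(x)=\prod_\alpha\langle x,e_\alpha\rangle^{\mu_\alpha}$, $|\mu|=k$, and the Bombieri inner product making $m_\mu\big/\sqrt{\tfrac{\mu!}{k!}\prod_\alpha\langle e_\alpha,e_\alpha\rangle^{\mu_\alpha}}$ orthonormal. Sequences. $\mathcal Z$ consists of $(\mathbb R^n)$ with zero-padding embeddings $\zeta_{N,n}(x)=(x,0_{N-n})$ for $n\le N$; $\mathcal D$ consists of $(\mathbb R^n)$ with duplication embeddings $\delta_{N,n}(x)=x\otimes\mathbf 1_{N/n}=(x_1,\dots,x_1,\dots,x_n,\dots,x_n)$ (each entry repeated $N/n$ times) for $n\mid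 N$. $\mathcal F(\mathcal Z)$ (index order $\le$) and $\mathcal F(\mathcal D)$ (index order divisibility) are the spaces $V_n=\mathcal F(\mathbb R^n)$ with $\mathfrak S_n$-action $\mathcal F(\sigma)$ and embeddings $\mathcal F(\zeta_{N,n})$, resp. $\mathcal F(\delta_{N,n})$. A $\mathrm{FinSet}$-pair is a pair $(\mathcal U,\mathcal L)$ equal to $(\mathcal F(\mathcal Z),\mathcal F(\mathcal D))$ or $(\mathcal F(\mathcal D),\mathcal F(\mathcal Z))$ for some standard construction $\mathcal F$; $\preceq_{\mathcal U},\preceq_{\mathcal L}$ are the respective index orders. Sets $(\Omega_n\subseteq V_n)$ are $\mathrm{FinSet}$-compatible if each $\Omega_n$ is $\mathfrak S_n$-invariant, $\varphi_{N,n}\Omega_n\subseteq\Omega_N$ for $n\preceq_{\mathcal U}N$, and $\psi_{N,n}^\star\Omega_N\subseteq\Omega_n$ for $n\preceq_{\mathcal L}N$. De Finetti maps. For $f:[m]\to[n]$ let $\rho(f):\mathbb R^n\to\mathbb R^m$, $(\rho(f)x)_i=x_{f(i)}$, and also write $\rho(f)$ for $\mathcal F(\rho(f)):V_n\to V_m$. Let $F_{m,n}:[n]\to[m]$ be uniformly random. The random linear map $L_{m,n}:V_n\to V_m$ is $\rho(F_{n,m})$ if $(\mathcal U,\mathcal L)=(\mathcal F(\mathcal D),\mathcal F(\mathcal Z))$, and $\rho(F_{m,n})^\star$ if $(\mathcal U,\mathcal L)=(\mathcal F(\mathcal Z),\mathcal F(\mathcal D))$. Free polynomials. $\varprojlim_{\mathcal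 U}\mathbb R[V_n]_{\le d}^{\mathfrak S_n}$ is the (finite-dimensional) space of sequences $(p_n)$ with $p_n\in\mathbb R[V_n]_{\le d}^{\mathfrak S_n}$ and $p_N\circ\varphi_{N,n}=p_n$ for $n\preceq_{\mathcal U}N$; $\pi_k$ sends $(p_n)\mapsto p_k$. For $q\in\mathbb R[V_k]_{\le d}$ and $k\preceq_{\mathcal L}n$, $\mathrm{sym}_n^{\mathcal L}q(x)=\frac1{n!}\sum_{\sigma\in\mathfrak S_n}q(\psi_{n,k}^\star\sigma x)$. $\varinjlim_{\mathcal L}\mathbb R[V_n]_{\le d}^{\mathfrak S_n}$ is the (finite-dimensional) direct limit of the spaces $\mathbb R[V_n]_{\le d}^{\mathfrak S_n}$ under the maps $\mathrm{sym}_N^{\mathcal L}$, $n\preceq_{\mathcal L}N$; $\varsigma_k$ sends $q_k$ to its class, written $(\mathrm{sym}_n^{\mathcal L}q_k)_{n\succeq_{\mathcal L}k}$. *)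

theory Defs
  imports
    "HOL-Analysis.Analysis"
    "HOL-Probability.Probability_Mass_Function"
    "HOL-Combinatorics.Permutations"
    "HOL-Library.Multiset"
    "HOL-Library.FuncSet"
    "HOL-Algebra.Module"
begin

section \<open>Standard constructions\<close>

datatype construction =
    Ident
  | Times construction construction
  | Tensor construction construction
  | SymPower nat construction
  | HomPoly nat construction

text \<open>
  The spaces obtained from the different constructions have to live in one type.  Each of them comes
  with a distinguished orthogonal basis, whose members are named by labels; an element of
  such a space is its family of coordinates with respect to that basis.  The label
  \<open>LSym M\<close> names the orbit sum $E_M$, and \<open>LMono M\<close> the monomial $m_M$, where the multiset
  \<open>M\<close> lists the indices with multiplicity.
\<close>

datatype label =
    LCoord nat
  | LLeft label
  | LRight label
  | LTens label label
  | LSym "label multiset"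
  | LMono "label multiset"

type_synonym vec = "label \<Rightarrow> real"

primrec labels :: "construction \<Rightarrow> nat \<Rightarrow> label set" where
  "labels Ident n = LCoord ` {1..n}"
| "labels (Times F G) n = LLeft ` labels F n \<union> LRight ` labels G n"
| "labels (Tensor F G) n = (\<lambda>(a, b). LTens a b) ` (labels F n \<times> labels G n)"
| "labels (SymPower k F) n = LSym ` {M. set_mset M \<subseteq> labels F n \<and> size M = k}"
| "labels (HomPoly k F) n = LMono ` {M. set_mset M \<subseteq> labels F n \<and> size M = k}"

definition space_of :: "construction \<Rightarrow> nat \<Rightarrow> vec set" where
  "space_of F n = {x. \<forall>a. a \<notin> labels F n \<longrightarrow> x a = 0}"

definition basis_vec :: "label \<Rightarrow> vec" where
  "basis_vec a = (\<lambda>b. if b = a then 1 else 0)"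

text \<open>
  The squared norm of the basis element with the given label.  For orbit sums we follow the
  convention that $E_M / \sqrt{\prod_i \langle e_{\alpha_i}, e_{\alpha_i} \rangle}$ is a unit vector,
  so that this is not the norm of $E_M$ in the tensor power: there is no factor counting the
  rearrangements.
\<close>

primrec sqnorm :: "label \<Rightarrow> real" where
  "sqnorm (LCoord i) = 1"
| "sqnorm (LLeft a) = sqnorm a"
| "sqnorm (LRight a) = sqnorm a"
| "sqnorm (LTens a b) = sqnorm a * sqnorm b"
| "sqnorm (LSym M) = prod_mset (image_mset sqnorm M)"
| "sqnorm (LMono M) =
     (\<Prod>a\<in>set_mset M. fact (count M a)) / fact (size M) * prod_mset (image_mset sqnorm M)"

definition inner_of :: "construction \<Rightarrow> nat \<Rightarrow> vec \<Rightarrow> vec \<Rightarrow> real" where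
  "inner_of F n x y = (\<Sum>a\<in>labels F n. sqnorm a * x a * y a)"

text \<open>Adjoint of a linear map \<open>T\<close> from \<open>space_of F n\<close> to \<open>space_of F m\<close>.\<close>

definition adj :: "construction \<Rightarrow> nat \<Rightarrow> nat \<Rightarrow> (vec \<Rightarrow> vec) \<Rightarrow> vec \<Rightarrow> vec" where
  "adj F n m T y =
     (THE x. x \<in> space_of F n \<and> (\<forall>z\<in>space_of F n. inner_of F n x z = inner_of F m y (T z)))"

text \<open>The value at \<open>x\<close> of the homogeneous polynomial over \<open>space_of F n\<close> with coordinates \<open>p\<close>.\<close>

definition hom_eval :: "nat \<Rightarrow> construction \<Rightarrow> nat \<Rightarrow> vec \<Rightarrow> vec \<Rightarrow> real" where
  "hom_eval k F n p x =
     (\<Sum>M\<in>{M. set_mset M \<subseteq> labels F n \<and> size M = k}.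
        p (LMono M) * (\<Prod>a\<in>#M. inner_of F n x (basis_vec a)))"

text \<open>
  Vectors of $\mathbb R^n$ are functions on \<open>nat\<close>, supported on \<open>{1..n}\<close>, when they are arguments of
  a linear map \<open>A\<close> from $\mathbb R^n$ to $\mathbb R^m$; \<open>fmap F n m A\<close> is the linear map
  that \<open>F\<close> assigns to \<open>A\<close>.  An element \<open>x\<close> of a symmetric power is, as a symmetric tensor,
  the array \<open>bs \<mapsto> x (LSym (mset bs))\<close> indexed by lists \<open>bs\<close> of \<open>k\<close> labels.
\<close>

primrec fmap ::
  "construction \<Rightarrow> nat \<Rightarrow> nat \<Rightarrow> ((nat \<Rightarrow> real) \<Rightarrow> nat \<Rightarrow> real) \<Rightarrow> vec \<Rightarrow> vec" where
  "fmap Ident n m A x =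
     (\<lambda>l. case l of
            LCoord i \<Rightarrow>
              if i \<in> {1..m} then A (\<lambda>j. if j \<in> {1..n} then x (LCoord j) else 0) i else 0
          | _ \<Rightarrow> 0)"
| "fmap (Times F G) n m A x =
     (\<lambda>l. case l of
            LLeft a \<Rightarrow> fmap F n m A (\<lambda>b. x (LLeft b)) a
          | LRight a \<Rightarrow> fmap G n m A (\<lambda>b. x (LRight b)) a
          | _ \<Rightarrow> 0)"
| "fmap (Tensor F G) n m A x =
     (\<lambda>l. case l of
            LTens c d \<Rightarrow>
              (\<Sum>a\<in>labels F n. \<Sum>b\<in>labels G n.
                 x (LTens a b) * fmap F n m A (basis_vec a) c * fmap G n m A (basis_vec b) d)
          | _ \<Rightarrow> 0)"
| "fmap (SymPower k F) n m A x =
     (THE y. y \<in> space_of (SymPower k F) m \<and>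
        (\<forall>bs. set bs \<subseteq> labels F m \<and> length bs = k \<longrightarrow>
           y (LSym (mset bs)) =
             (\<Sum>as\<in>{as. set as \<subseteq> labels F n \<and> length as = k}.
                x (LSym (mset as)) * (\<Prod>i<k. fmap F n m A (basis_vec (as ! i)) (bs ! i)))))"
| "fmap (HomPoly k F) n m A p =
     (THE q. q \<in> space_of (HomPoly k F) m \<and>
        (\<forall>y\<in>space_of F m. hom_eval k F m q y = hom_eval k F n p (adj F n m (fmap F n m A) y)))"


section \<open>Consistent sequences and FinSet-pairs\<close>

definition zero_pad :: "nat \<Rightarrow> (nat \<Rightarrow> real) \<Rightarrow> nat \<Rightarrow> real" where
  "zero_pad n x = (\<lambda>i. if i \<in> {1..n} then x i else 0)"

definition duplicate :: "nat \<Rightarrow> nat \<Rightarrow> (nat \<Rightarrow> real) \<Rightarrow> nat \<Rightarrow> real" where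
  "duplicate N n x = (\<lambda>i. if i \<in> {1..N} then x ((i - 1) div (N div n) + 1) else 0)"

definition permute_vec :: "nat \<Rightarrow> (nat \<Rightarrow> nat) \<Rightarrow> (nat \<Rightarrow> real) \<Rightarrow> nat \<Rightarrow> real" where
  "permute_vec n \<sigma> x = (\<lambda>i. if i \<in> {1..n} then x (inv_into UNIV \<sigma> i) else 0)"

definition pull_back :: "nat \<Rightarrow> (nat \<Rightarrow> nat) \<Rightarrow> (nat \<Rightarrow> real) \<Rightarrow> nat \<Rightarrow> real" where
  "pull_back m f x = (\<lambda>i. if i \<in> {1..m} then x (f i) else 0)"

definition act :: "construction \<Rightarrow> nat \<Rightarrow> (nat \<Rightarrow> nat) \<Rightarrow> vec \<Rightarrow> vec" where
  "act F n \<sigma> = fmap F n n (permute_vec n \<sigma>)"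

datatype base_seq = ZeroPadding | Duplication

fun index_le :: "base_seq \<Rightarrow> nat \<Rightarrow> nat \<Rightarrow> bool" where
  "index_le ZeroPadding n N \<longleftrightarrow> 1 \<le> n \<and> n \<le> N"
| "index_le Duplication n N \<longleftrightarrow> 1 \<le> n \<and> 1 \<le> N \<and> n dvd N"

fun embed :: "base_seq \<Rightarrow> construction \<Rightarrow> nat \<Rightarrow> nat \<Rightarrow> vec \<Rightarrow> vec" where
  "embed ZeroPadding F N n = fmap F n N (zero_pad n)"
| "embed Duplication F N n = fmap F n N (duplicate N n)"

definition embed_adj :: "base_seq \<Rightarrow> construction \<Rightarrow> nat \<Rightarrow> nat \<Rightarrow> vec \<Rightarrow> vec" where
  "embed_adj S F N n = adj F n N (embed S F N n)"

text \<open>The pair \<open>(F(U), F(L))\<close> is a FinSet-pair.\<close>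

definition finset_pair :: "base_seq \<Rightarrow> base_seq \<Rightarrow> bool" where
  "finset_pair U L \<longleftrightarrow>
     (U = ZeroPadding \<and> L = Duplication) \<or> (U = Duplication \<and> L = ZeroPadding)"

definition finset_compatible ::
  "construction \<Rightarrow> base_seq \<Rightarrow> base_seq \<Rightarrow> (nat \<Rightarrow> vec set) \<Rightarrow> bool" where
  "finset_compatible F U L \<Omega> \<longleftrightarrow>
     (\<forall>n\<ge>1. \<Omega> n \<subseteq> space_of F n) \<and>
     (\<forall>n\<ge>1. \<forall>\<sigma>. \<sigma> permutes {1..n} \<longrightarrow> act F n \<sigma> ` \<Omega> n \<subseteq> \<Omega> n) \<and>
     (\<forall>n N. index_le U n N \<longrightarrow> embed U F N n ` \<Omega> n \<subseteq> \<Omega> N) \<and>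
     (\<forall>n N. index_le L n N \<longrightarrow> embed_adj L F N n ` \<Omega> N \<subseteq> \<Omega> n)"


section \<open>De Finetti maps\<close>

definition random_map :: "nat \<Rightarrow> nat \<Rightarrow> (nat \<Rightarrow> nat) pmf" where
  "random_map m n = pmf_of_set ({1..n} \<rightarrow>\<^sub>E {1..m})"

text \<open>
  The law of the random linear map $L_{m,n}$ from \<open>space_of F n\<close> to \<open>space_of F m\<close>, for the pair
  whose first component is built from \<open>U\<close> and whose second one is built from the other sequence.
\<close>

fun de_finetti_map :: "base_seq \<Rightarrow> construction \<Rightarrow> nat \<Rightarrow> nat \<Rightarrow> (vec \<Rightarrow> vec) pmf" where
  "de_finetti_map Duplication F m n =
     map_pmf (\<lambda>f. fmap F n m (pull_back m f)) (random_map n m)"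
| "de_finetti_map ZeroPadding F m n =
     map_pmf (\<lambda>f. adj F m n (fmap F m n (pull_back n f))) (random_map m n)"


section \<open>Finite-dimensional real vector spaces\<close>

text \<open>
  The limits below are given by explicit carriers, so we use the records of HOL-Algebra with
  real scalars.  The ring multiplication and unit of these records play no role.

  The open sets of \<open>usual_topology M\<close> are those whose preimage under every linear map
  $c \mapsto \sum_{i<r} c_i v_i$ from $\mathbb R^r$ to \<open>M\<close> is open.  For a
  finite-dimensional \<open>M\<close> this is the topology transported from $\mathbb R^{\dim M}$ by any
  linear isomorphism.  Openness is in the product topology on \<open>nat \<Rightarrow> real\<close>, where only
  the first \<open>r\<close> coordinates matter.
\<close>

type_synonym 'b real_space = "(real, 'b) module"

definition real_space ::
  "'b set \<Rightarrow> 'b \<Rightarrow> ('b \<Rightarrow> 'b \<Rightarrow> 'b) \<Rightarrow> (real \<Rightarrow> 'b \<Rightarrow> 'b) \<Rightarrow> 'b real_space" where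
  "real_space C z pl sc =
     \<lparr>carrier = C, mult = undefined, one = undefined, zero = z, add = pl, smult = sc\<rparr>"

definition usual_topology :: "'b real_space \<Rightarrow> 'b topology" where
  "usual_topology M = topology (\<lambda>S. S \<subseteq> carrier M \<and>
     (\<forall>r v. v \<in> {..<r::nat} \<rightarrow> carrier M \<longrightarrow>
        open {c :: nat \<Rightarrow> real. finsum M (\<lambda>i. c i \<odot>\<^bsub>M\<^esub> v i) {..<r} \<in> S}))"

lemma openin_usual_topology:
  "openin (usual_topology M) S \<longleftrightarrow> S \<subseteq> carrier M \<and>
     (\<forall>r v. v \<in> {..<r::nat} \<rightarrow> carrier M \<longrightarrow>
        open {c :: nat \<Rightarrow> real. finsum M (\<lambda>i. c i \<odot>\<^bsub>M\<^esub> v i) {..<r} \<in> S})"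
proof -
  let ?pre = "\<lambda>(r::nat) v S. {c :: nat \<Rightarrow> real. finsum M (\<lambda>i. c i \<odot>\<^bsub>M\<^esub> v i) {..<r::nat} \<in> S}"
  let ?P = "\<lambda>S. S \<subseteq> carrier M \<and>
     (\<forall>r v. v \<in> {..<r} \<rightarrow> carrier M \<longrightarrow> open (?pre r v S))"
  have "istopology ?P"
    unfolding istopology_def
  proof (intro conjI allI impI)
    fix S T assume ST: "?P S" "?P T"
    then show "S \<inter> T \<subseteq> carrier M" by blast
    fix r :: nat and v assume v: "v \<in> {..<r} \<rightarrow> carrier M"
    have "?pre r v (S \<inter> T) = ?pre r v S \<inter> ?pre r v T" by blast
    then show "open (?pre r v (S \<inter> T))" using ST v by (simp add: open_Int)
  next
    fix \<K> assume K: "\<forall>S\<in>\<K>. ?P S"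
    then show "\<Union>\<K> \<subseteq> carrier M" by blast
    fix r :: nat and v assume v: "v \<in> {..<r} \<rightarrow> carrier M"
    have "?pre r v (\<Union>\<K>) = (\<Union>S\<in>\<K>. ?pre r v S)" by blast
    then show "open (?pre r v (\<Union>\<K>))" using K v by auto
  qed
  then show ?thesis
    unfolding usual_topology_def by (simp only: topology_inverse')
qed

definition linear_iso :: "'a real_space \<Rightarrow> 'b real_space \<Rightarrow> ('a \<Rightarrow> 'b) \<Rightarrow> bool" where
  "linear_iso M N \<Phi> \<longleftrightarrow>
     bij_betw \<Phi> (carrier M) (carrier N) \<and>
     (\<forall>x\<in>carrier M. \<forall>y\<in>carrier M. \<Phi> (x \<oplus>\<^bsub>M\<^esub> y) = \<Phi> x \<oplus>\<^bsub>N\<^esub> \<Phi> y) \<and>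
     (\<forall>t. \<forall>x\<in>carrier M. \<Phi> (t \<odot>\<^bsub>M\<^esub> x) = t \<odot>\<^bsub>N\<^esub> \<Phi> x)"

definition cone_in :: "'b real_space \<Rightarrow> 'b set \<Rightarrow> bool" where
  "cone_in M K \<longleftrightarrow> K \<subseteq> carrier M \<and> (\<forall>x\<in>K. \<forall>t\<ge>0. t \<odot>\<^bsub>M\<^esub> x \<in> K)"

definition convex_in :: "'b real_space \<Rightarrow> 'b set \<Rightarrow> bool" where
  "convex_in M K \<longleftrightarrow>
     (\<forall>x\<in>K. \<forall>y\<in>K. \<forall>s\<ge>0. \<forall>t\<ge>0. s + t = 1 \<longrightarrow> (s \<odot>\<^bsub>M\<^esub> x) \<oplus>\<^bsub>M\<^esub> (t \<odot>\<^bsub>M\<^esub> y) \<in> K)"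

definition pointed_in :: "'b real_space \<Rightarrow> 'b set \<Rightarrow> bool" where
  "pointed_in M K \<longleftrightarrow> K \<inter> (a_inv M ` K) = {\<zero>\<^bsub>M\<^esub>}"

definition has_interior_in :: "'b real_space \<Rightarrow> 'b set \<Rightarrow> bool" where
  "has_interior_in M K \<longleftrightarrow> usual_topology M interior_of K \<noteq> {}"


section \<open>Invariant polynomials and their limits\<close>

text \<open>
  Polynomials on \<open>space_of F n\<close> are represented by functions on the whole type \<open>vec\<close> that are
  polynomial in the coordinates from \<open>labels F n\<close> and ignore all the other coordinates.  Such
  a function is determined by its restriction to \<open>space_of F n\<close>.
\<close>

type_synonym polyfun = "vec \<Rightarrow> real"

definition polys :: "construction \<Rightarrow> nat \<Rightarrow> nat \<Rightarrow> polyfun set" where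
  "polys F n d =
     {q. \<exists>c :: label multiset \<Rightarrow> real.
           q = (\<lambda>x. \<Sum>M\<in>{M. set_mset M \<subseteq> labels F n \<and> size M \<le> d}. c M * (\<Prod>a\<in>#M. x a))}"

definition inv_polys :: "construction \<Rightarrow> nat \<Rightarrow> nat \<Rightarrow> polyfun set" where
  "inv_polys F n d =
     {q \<in> polys F n d. \<forall>\<sigma>. \<sigma> permutes {1..n} \<longrightarrow> (\<forall>x\<in>space_of F n. q (act F n \<sigma> x) = q x)}"

definition inv_poly_space :: "construction \<Rightarrow> nat \<Rightarrow> nat \<Rightarrow> polyfun real_space" where
  "inv_poly_space F n d =
     real_space (inv_polys F n d) (\<lambda>x. 0) (\<lambda>p q x. p x + q x) (\<lambda>t p x. t * p x)"

text \<open>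
  Sequences are indexed by the positive integers; their value at the unused index \<open>0\<close> is
  fixed to be the zero function.
\<close>

definition inverse_limit :: "base_seq \<Rightarrow> construction \<Rightarrow> nat \<Rightarrow> (nat \<Rightarrow> polyfun) set" where
  "inverse_limit U F d =
     {p. p 0 = (\<lambda>x. 0) \<and> (\<forall>n\<ge>1. p n \<in> inv_polys F n d) \<and>
         (\<forall>n N. index_le U n N \<longrightarrow> (\<forall>x\<in>space_of F n. p N (embed U F N n x) = p n x))}"

definition inverse_limit_space ::
  "base_seq \<Rightarrow> construction \<Rightarrow> nat \<Rightarrow> (nat \<Rightarrow> polyfun) real_space" where
  "inverse_limit_space U F d =
     real_space (inverse_limit U F d) (\<lambda>n x. 0) (\<lambda>p q n x. p n x + q n x) (\<lambda>t p n x. t * p n x)"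

definition sym_map :: "base_seq \<Rightarrow> construction \<Rightarrow> nat \<Rightarrow> nat \<Rightarrow> polyfun \<Rightarrow> polyfun" where
  "sym_map L F n k q =
     (\<lambda>x. (1 / fact n) * (\<Sum>\<sigma>\<in>{\<sigma>. \<sigma> permutes {1..n}}. q (embed_adj L F n k (act F n \<sigma> x))))"

definition dlim_rel ::
  "base_seq \<Rightarrow> construction \<Rightarrow> nat \<Rightarrow> ((nat \<times> polyfun) \<times> (nat \<times> polyfun)) set" where
  "dlim_rel L F d =
     {((n, q), (m, r)). q \<in> inv_polys F n d \<and> r \<in> inv_polys F m d \<and>
        (\<exists>N. index_le L n N \<and> index_le L m N \<and> sym_map L F N n q = sym_map L F N m r)}"

definition direct_limit :: "base_seq \<Rightarrow> construction \<Rightarrow> nat \<Rightarrow> (nat \<times> polyfun) set set" where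
  "direct_limit L F d = (SIGMA n:{1..}. inv_polys F n d) // dlim_rel L F d"

definition dlim_inj ::
  "base_seq \<Rightarrow> construction \<Rightarrow> nat \<Rightarrow> nat \<Rightarrow> polyfun \<Rightarrow> (nat \<times> polyfun) set" where
  "dlim_inj L F d k q = dlim_rel L F d `` {(k, q)}"

definition dlim_add ::
  "base_seq \<Rightarrow> construction \<Rightarrow> nat \<Rightarrow> (nat \<times> polyfun) set \<Rightarrow> (nat \<times> polyfun) set \<Rightarrow>
     (nat \<times> polyfun) set" where
  "dlim_add L F d X Y =
     (\<Union>(n, q)\<in>X. \<Union>(m, r)\<in>Y. \<Union>N\<in>{N. index_le L n N \<and> index_le L m N}.
        dlim_inj L F d N (\<lambda>x. sym_map L F N n q x + sym_map L F N m r x))"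

definition dlim_scale ::
  "base_seq \<Rightarrow> construction \<Rightarrow> nat \<Rightarrow> real \<Rightarrow> (nat \<times> polyfun) set \<Rightarrow> (nat \<times> polyfun) set" where
  "dlim_scale L F d t X = (\<Union>(n, q)\<in>X. dlim_inj L F d n (\<lambda>x. t * q x))"

definition direct_limit_space ::
  "base_seq \<Rightarrow> construction \<Rightarrow> nat \<Rightarrow> (nat \<times> polyfun) set real_space" where
  "direct_limit_space L F d =
     real_space (direct_limit L F d) (dlim_inj L F d 1 (\<lambda>x. 0)) (dlim_add L F d) (dlim_scale L F d)"

text \<open>The sequence $(\mathbb E\, q \circ L_{k,n})_n$.\<close>

definition de_finetti_seq ::
  "base_seq \<Rightarrow> construction \<Rightarrow> nat \<Rightarrow> polyfun \<Rightarrow> nat \<Rightarrow> polyfun" where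
  "de_finetti_seq U F k q =
     (\<lambda>n. if n = 0 then (\<lambda>x. 0)
          else (\<lambda>x. measure_pmf.expectation (de_finetti_map U F k n) (\<lambda>T. q (T x))))"


section \<open>The cones of nonnegative polynomials\<close>

definition pos_cone ::
  "construction \<Rightarrow> nat \<Rightarrow> (nat \<Rightarrow> vec set) \<Rightarrow> nat \<Rightarrow> polyfun set" where
  "pos_cone F d \<Omega> n = {p \<in> inv_polys F n d. \<forall>x\<in>\<Omega> n. p x \<ge> 0}"

definition outer_cone ::
  "base_seq \<Rightarrow> construction \<Rightarrow> nat \<Rightarrow> (nat \<Rightarrow> vec set) \<Rightarrow> nat \<Rightarrow> (nat \<Rightarrow> polyfun) set" where
  "outer_cone U F d \<Omega> n = {p \<in> inverse_limit U F d. p n \<in> pos_cone F d \<Omega> n}"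

definition inner_cone ::
  "base_seq \<Rightarrow> construction \<Rightarrow> nat \<Rightarrow> (nat \<Rightarrow> vec set) \<Rightarrow> nat \<Rightarrow> (nat \<times> polyfun) set set" where
  "inner_cone L F d \<Omega> n = dlim_inj L F d n ` pos_cone F d \<Omega> n"

definition inverse_limit_cone ::
  "base_seq \<Rightarrow> construction \<Rightarrow> nat \<Rightarrow> (nat \<Rightarrow> vec set) \<Rightarrow> (nat \<Rightarrow> polyfun) set" where
  "inverse_limit_cone U F d \<Omega> = (\<Inter>n\<in>{1..}. outer_cone U F d \<Omega> n)"

definition direct_limit_cone ::
  "base_seq \<Rightarrow> construction \<Rightarrow> nat \<Rightarrow> (nat \<Rightarrow> vec set) \<Rightarrow> (nat \<times> polyfun) set set" where
  "direct_limit_cone L F d \<Omega> = (\<Union>n\<in>{1..}. inner_cone L F d \<Omega> n)"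

end

(*
The construction assigns to [n] a finite set of labels on which maps of finite sets act, and in
suitably rescaled coordinates the map of a pull-back is x(b) |-> x(f b), while its adjoint is the
push-forward.  Hence polynomials of degree at most d are functions on multisets of labels, and
substituting such maps becomes pushing forward (duplication first) or pulling back (zero padding
first) coefficients; both are contractions, for the sum and for the maximum norm respectively.

The key estimate: for an invariant polynomial p on the k-th space, restricting along the embedding
of the n-th space and then applying the de Finetti map back to level k changes p by at most
C/n times its norm, with C independent of k and n.  For each monomial this compares the identity
with a random self-map of [k] that is injective on the boundedly many points involved, up to
probability O(1/n), and an invariant function does not see an injective map.  Therefore, for large
n, an element of the inverse limit is controlled by its n-th component and the de Finetti map is
close to the identity at level n, hence bijective from level n to the inverse limit.  All of the
theorem follows: two elements agree in the direct limit iff they have the same de Finetti image,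
the de Finetti images of the components of a point of the limit cone converge to this point, and
interior points are transported from level n.
*)

theory Submission
  imports Defs "HOL-Computational_Algebra.Primes" "HOL-Combinatorics.Multiset_Permutations"
begin

section \<open>Labels and weights\<close>

text \<open>The obstacle is uniformity in the level: the number of monomials grows with k, so errors
  are measured in norms for which every substitution is a contraction. Without the scales
  \<open>wt\<close>, \<open>dwt\<close> and \<open>mono_scale\<close>, symmetric powers and
  polynomial spaces would bring in multinomial factors that depend on how a map merges labels.

  For duplication the round trip from level k to level n and back is
  \<open>f \<circ> block k n\<close>, which always merges the points of one block. Since the
  polynomial and the sign pattern that computes the sum norm of the error are both invariant, a
  uniformly random permutation may be put in front. Two distinct points then share a block with
  probability at most 1/n, and otherwise collide with probability 1/k.

  Divisibility is not a total order, so levels are compared through products, which lie above both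
  factors in either order. Positivity of de Finetti images rests on a factorisation: every map
  between [k] and [n] is, on the level of spaces, an embedding into level k * n, a permutation, and
  the adjoint of an embedding of the other sequence.\<close>

primrec lmap :: "(nat \<Rightarrow> nat) \<Rightarrow> label \<Rightarrow> label" where
  "lmap f (LCoord i) = LCoord (f i)"
| "lmap f (LLeft a) = LLeft (lmap f a)"
| "lmap f (LRight a) = LRight (lmap f a)"
| "lmap f (LTens a b) = LTens (lmap f a) (lmap f b)"
| "lmap f (LSym M) = LSym (image_mset (lmap f) M)"
| "lmap f (LMono M) = LMono (image_mset (lmap f) M)"

primrec lsupp :: "label \<Rightarrow> nat set" where
  "lsupp (LCoord i) = {i}"
| "lsupp (LLeft a) = lsupp a"
| "lsupp (LRight a) = lsupp a"
| "lsupp (LTens a b) = lsupp a \<union> lsupp b"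
| "lsupp (LSym M) = \<Union>(set_mset (image_mset lsupp M))"
| "lsupp (LMono M) = \<Union>(set_mset (image_mset lsupp M))"

definition mfact :: "'a multiset \<Rightarrow> real" where
  "mfact M = (\<Prod>a\<in>set_mset M. fact (count M a))"

text \<open>Rescaling the coordinate of label \<open>b\<close> by \<open>wt b\<close> turns the map induced by a pull-back along
  \<open>f\<close> into \<open>x b \<mapsto> x (lmap f b)\<close>; the factorials absorb the multinomial coefficients that arise
  when powers of sums of variables are expanded.  For the adjoint the scale is \<open>dwt\<close>.\<close>

primrec wt :: "label \<Rightarrow> real" where
  "wt (LCoord i) = 1"
| "wt (LLeft a) = wt a"
| "wt (LRight a) = wt a"
| "wt (LTens a b) = wt a * wt b"
| "wt (LSym M) = prod_mset (image_mset wt M)"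
| "wt (LMono M) = mfact M * prod_mset (image_mset wt M)"

text \<open>The term \<open>sqnorm a * x a * y a\<close> of the inner product equals
  \<open>(wt a * x a) * (dwt a * y a)\<close>: if one argument is rescaled by \<open>wt\<close>,
  rescaling the other by \<open>dwt\<close> leaves a plain dot product, for which the adjoint of a
  pull-back is a sum over fibres.\<close>

definition dwt :: "label \<Rightarrow> real" where
  "dwt a = sqnorm a / wt a"

lemma prod_mset_pos: "(\<And>a. a \<in># M \<Longrightarrow> 0 < f a) \<Longrightarrow> 0 < (\<Prod>a\<in>#M. f a :: real)"
  by (induction M) auto

lemma mfact_pos [simp]: "0 < mfact M"
  unfolding mfact_def by (intro prod_pos) simp

lemma wt_pos [simp]: "0 < wt a"
  by (induction a) (auto intro!: mult_pos_pos prod_mset_pos)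

lemma sqnorm_pos [simp]: "0 < sqnorm a"
  by (induction a) (auto intro!: mult_pos_pos divide_pos_pos prod_mset_pos prod_pos)

lemma wt_neq_0 [simp]: "wt a \<noteq> 0"
  using wt_pos[of a] by linarith

lemma sqnorm_neq_0 [simp]: "sqnorm a \<noteq> 0"
  using sqnorm_pos[of a] by linarith

lemma mfact_neq_0 [simp]: "mfact a \<noteq> 0"
  using mfact_pos[of a] by linarith

lemma dwt_pos [simp]: "0 < dwt a"
  by (simp add: dwt_def)

lemma dwt_neq_0 [simp]: "dwt a \<noteq> 0"
  using dwt_pos[of a] by linarith

lemma lmap_cong: "(\<And>i. i \<in> lsupp a \<Longrightarrow> f i = g i) \<Longrightarrow> lmap f a = lmap g a"
  by (induction a) (auto intro!: image_mset_cong)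

lemma lmap_lmap: "lmap f (lmap g a) = lmap (f \<circ> g) a"
  by (induction a) (auto simp: multiset.map_comp intro!: image_mset_cong)

lemma lmap_ident: "lmap (\<lambda>i. i) a = a"
proof (induction a)
  case (LSym M)
  then have "image_mset (lmap (\<lambda>i. i)) M = image_mset (\<lambda>a. a) M"
    by (intro image_mset_cong)
  then show ?case by simp
next
  case (LMono M)
  then have "image_mset (lmap (\<lambda>i. i)) M = image_mset (\<lambda>a. a) M"
    by (intro image_mset_cong)
  then show ?case by simp
qed auto

lemma lmap_idI: "(\<And>i. i \<in> lsupp a \<Longrightarrow> f i = i) \<Longrightarrow> lmap f a = a"
  by (metis lmap_cong lmap_ident)

lemma finite_lsupp: "finite (lsupp a)"
  by (induction a) auto

lemma mfact_image_inj:
  assumes "inj_on f (set_mset M)"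
  shows "mfact (image_mset f M) = mfact M"
proof -
  have "count (image_mset f M) (f a) = count M a" if "a \<in># M" for a
  proof -
    have "f -` {f a} \<inter> set_mset M = {a}"
      using that assms by (auto simp: inj_on_def)
    then show ?thesis by (simp add: count_image_mset)
  qed
  then show ?thesis
    unfolding mfact_def by (simp add: prod.reindex[OF assms])
qed

lemma prod_mset_cong:
  "(\<And>a. a \<in># M \<Longrightarrow> f a = g a) \<Longrightarrow> (\<Prod>a\<in>#M. f a) = (\<Prod>a\<in>#M. g a :: 'a :: comm_monoid_mult)"
  by (auto intro!: arg_cong[where f = prod_mset] image_mset_cong)

lemma inj_lmap: "inj f \<Longrightarrow> inj (lmap f)"
  by (rule inj_on_inverseI[of _ "lmap (inv_into UNIV f)"]) (simp add: lmap_lmap lmap_idI)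

text \<open>Only the factor \<open>mfact\<close> of \<open>LMono\<close> can change under
  relabelling, and only if labels are merged. Hence permutations act on unscaled coordinates by mere
  relabelling.\<close>

lemma wt_lmap_inj: "inj f \<Longrightarrow> wt (lmap f a) = wt a"
proof (induction a)
  case (LSym M)
  then show ?case by (auto simp: multiset.map_comp o_def intro!: prod_mset_cong)
next
  case (LMono M)
  have "mfact (image_mset (lmap f) M) = mfact M"
    using inj_lmap[OF LMono(2)] by (intro mfact_image_inj) (metis inj_on_subset subset_UNIV)
  with LMono show ?case by (auto simp: multiset.map_comp o_def intro!: prod_mset_cong)
qed auto

lemma sqnorm_LMono:
  "sqnorm (LMono M) = mfact M / fact (size M) * prod_mset (image_mset sqnorm M)"
  by (simp add: mfact_def)

lemma sqnorm_lmap_inj: "inj f \<Longrightarrow> sqnorm (lmap f a) = sqnorm a"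
proof (induction a)
  case (LSym M)
  then show ?case by (auto simp: multiset.map_comp o_def intro!: prod_mset_cong)
next
  case (LMono M)
  have "mfact (image_mset (lmap f) M) = mfact M"
    using inj_lmap[OF LMono(2)] by (intro mfact_image_inj) (metis inj_on_subset subset_UNIV)
  with LMono show ?case
    by (auto simp: multiset.map_comp o_def sqnorm_LMono simp del: sqnorm.simps(6)
        intro!: prod_mset_cong)
qed auto

lemma dwt_lmap_inj: "inj f \<Longrightarrow> dwt (lmap f a) = dwt a"
  by (simp add: dwt_def wt_lmap_inj sqnorm_lmap_inj)

section \<open>Label sets: finiteness, functoriality and size of supports\<close>

lemma finite_multisets_subset: "finite A \<Longrightarrow> finite {M. set_mset M \<subseteq> A \<and> size M = k}"
  using finite_multisets_of_size[of A k] by (simp add: multisets_of_size_def)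

lemma finite_labels: "finite (labels F n)"
  by (induction F) (auto intro: finite_multisets_subset)

lemma lsupp_labels: "a \<in> labels F n \<Longrightarrow> lsupp a \<subseteq> {1..n}"
proof (induction F arbitrary: a)
  case (SymPower k F)
  then obtain M where "a = LSym M" "set_mset M \<subseteq> labels F n" by auto
  then show ?case using SymPower(1) by simp blast
next
  case (HomPoly k F)
  then obtain M where "a = LMono M" "set_mset M \<subseteq> labels F n" by auto
  then show ?case using HomPoly(1) by simp blast
qed (auto simp del: atLeastAtMost_iff; blast)+

lemma lmap_labels:
  "a \<in> labels F m \<Longrightarrow> f ` lsupp a \<subseteq> {1..n} \<Longrightarrow> lmap f a \<in> labels F n"
proof (induction F arbitrary: a)
  case (Tensor F G)
  then show ?case by fastforce
next
  case (SymPower k F)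
  then obtain M where M: "a = LSym M" "set_mset M \<subseteq> labels F m" "size M = k" by auto
  have "lmap f b \<in> labels F n" if "b \<in># M" for b
    using that M SymPower(1)[of b] SymPower(3) by fastforce
  with M show ?case by (auto intro!: imageI)
next
  case (HomPoly k F)
  then obtain M where M: "a = LMono M" "set_mset M \<subseteq> labels F m" "size M = k" by auto
  have "lmap f b \<in> labels F n" if "b \<in># M" for b
    using that M HomPoly(1)[of b] HomPoly(3) by fastforce
  with M show ?case by (auto intro!: imageI)
qed auto

lemma labels_mono: "a \<in> labels F m \<Longrightarrow> lsupp a \<subseteq> {1..n} \<Longrightarrow> a \<in> labels F n"
  using lmap_labels[of a F m "\<lambda>i. i" n] by (simp add: lmap_ident)

lemma labels_le: "m \<le> n \<Longrightarrow> labels F m \<subseteq> labels F n"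
proof
  fix a assume a: "m \<le> n" "a \<in> labels F m"
  then have "lsupp a \<subseteq> {1..n}" using lsupp_labels[OF a(2)] by auto
  with a(2) show "a \<in> labels F n" by (rule labels_mono)
qed

text \<open>Bounds the number of points of [n] that one label involves, independently of n; for
  \<open>Times\<close> the sum is a crude bound.\<close>

primrec cdeg :: "construction \<Rightarrow> nat" where
  "cdeg Ident = 1"
| "cdeg (Times F G) = cdeg F + cdeg G"
| "cdeg (Tensor F G) = cdeg F + cdeg G"
| "cdeg (SymPower k F) = k * cdeg F"
| "cdeg (HomPoly k F) = k * cdeg F"

lemma card_UN_mset_le:
  "(\<And>a. a \<in># M \<Longrightarrow> card (g a) \<le> D) \<Longrightarrow> (\<And>a. finite (g a)) \<Longrightarrow>
    card (\<Union>a\<in>set_mset M. g a) \<le> size M * D"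
proof (induction M)
  case (add x M)
  have "card (\<Union>a\<in>set_mset (add_mset x M). g a) \<le> card (g x) + card (\<Union>a\<in>set_mset M. g a)"
    by (simp add: card_Un_le)
  with add show ?case by fastforce
qed auto

lemma card_lsupp_le: "a \<in> labels F n \<Longrightarrow> card (lsupp a) \<le> cdeg F"
proof (induction F arbitrary: a)
  case (Times F G)
  then show ?case by (auto intro: trans_le_add1 trans_le_add2)
next
  case (Tensor F G)
  then show ?case by (auto intro!: order_trans[OF card_Un_le] add_mono)
next
  case (SymPower k F)
  then obtain M where "a = LSym M" "set_mset M \<subseteq> labels F n" "size M = k" by auto
  then show ?case
    using card_UN_mset_le[of M lsupp "cdeg F"] SymPower(1) finite_lsupp by auto
next
  case (HomPoly k F)
  then obtain M where "a = LMono M" "set_mset M \<subseteq> labels F n" "size M = k" by auto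
  then show ?case
    using card_UN_mset_le[of M lsupp "cdeg F"] HomPoly(1) finite_lsupp by auto
qed auto

text \<open>The variables are given the values p^s for distinct primes p. By unique factorisation
  the monomials have distinct values \<open>v M\<close> at s = 1, and \<open>v M ^ s\<close> in
  general, so all power sums of these nodes weighted by \<open>c\<close> vanish.\<close>

lemma monomials_independent:
  fixes c :: "'a multiset \<Rightarrow> real"
  assumes "finite A" "finite S" "\<And>M. M \<in> S \<Longrightarrow> set_mset M \<subseteq> A"
    and zero: "\<And>x :: 'a \<Rightarrow> real. (\<And>a. a \<notin> A \<Longrightarrow> x a = 0) \<Longrightarrow> (\<Sum>M\<in>S. c M * (\<Prod>a\<in>#M. x a)) = 0"
    and "M \<in> S"
  shows "c M = 0"
proof -
  obtain p :: "'a \<Rightarrow> nat" where p: "inj_on p A" "\<And>a. a \<in> A \<Longrightarrow> prime (p a)"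
  proof -
    obtain B :: "nat set" where "B \<subseteq> {q. prime q}" "finite B" "card B = card A"
      using infinite_arbitrarily_large[OF primes_infinite] by blast
    then obtain p where "bij_betw p A B"
      using assms(1) finite_same_card_bij by metis
    then show ?thesis
      using \<open>B \<subseteq> _\<close> that[of p] by (auto simp: bij_betw_def)
  qed
  define v where "v M = prod_mset (image_mset p M)" for M
  have inj: "inj_on v S"
  proof (rule inj_onI)
    fix M N assume MN: "M \<in> S" "N \<in> S" "v M = v N"
    have "prime_factorization (v K) = image_mset p K" if "K \<in> S" for K
      unfolding v_def using assms(3)[OF that] p(2)
      by (intro prime_factorization_prod_mset_primes) auto
    then have "image_mset p M = image_mset p N" using MN by metis
    then have "image_mset (the_inv_into A p) (image_mset p M) =
        image_mset (the_inv_into A p) (image_mset p N)" by simp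
    moreover have "image_mset (the_inv_into A p) (image_mset p K) = K" if "K \<in> S" for K
    proof -
      have "image_mset (the_inv_into A p) (image_mset p K) = image_mset (\<lambda>a. a) K"
        unfolding multiset.map_comp using assms(3)[OF that]
        by (intro image_mset_cong) (auto simp: the_inv_into_f_f[OF p(1)])
      then show ?thesis by simp
    qed
    ultimately show "M = N" using MN by metis
  qed
  have pw: "(\<Sum>M\<in>S. c M * real (v M) ^ s) = 0" for s
  proof -
    have "(\<Prod>a\<in>#M. if a \<in> A then real (p a) ^ s else 0) = real (v M) ^ s" if "M \<in> S" for M
    proof -
      have "(\<Prod>a\<in>#M. if a \<in> A then real (p a) ^ s else 0) = (\<Prod>a\<in>#M. real (p a) ^ s)"
        using assms(3)[OF that] by (intro prod_mset_cong) auto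
      also have "\<dots> = real (v M) ^ s"
        unfolding v_def by (induction M) (auto simp: power_mult_distrib)
      finally show ?thesis .
    qed
    with zero[of "\<lambda>a. if a \<in> A then real (p a) ^ s else 0"] show ?thesis by (simp cong: sum.cong)
  qed
  have pol: "(\<Sum>M\<in>S. c M * poly Q (real (v M))) = 0" for Q :: "real poly"
  proof -
    have "(\<Sum>M\<in>S. c M * poly Q (real (v M))) =
        (\<Sum>M\<in>S. \<Sum>i\<le>degree Q. coeff Q i * (c M * real (v M) ^ i))"
      by (simp add: poly_altdef sum_distrib_left mult_ac)
    also have "\<dots> = (\<Sum>i\<le>degree Q. coeff Q i * (\<Sum>M\<in>S. c M * real (v M) ^ i))"
      by (subst sum.swap) (simp add: sum_distrib_left)
    finally show ?thesis by (simp add: pw)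
  qed
  \<comment> \<open>Up to scale the Lagrange polynomial of the node of \<open>M\<close>: it vanishes
    at all other nodes, so only the term of \<open>M\<close> survives.\<close>
  define Q :: "real poly" where "Q = (\<Prod>N\<in>S - {M}. [:- real (v N), 1:])"
  have "poly Q (real (v N)) = 0" if "N \<in> S - {M}" for N
    using that assms(2) unfolding Q_def poly_prod by (intro prod_zero) auto
  then have "(\<Sum>N\<in>S. c N * poly Q (real (v N))) = c M * poly Q (real (v M))"
    using assms(2) \<open>M \<in> S\<close> by (subst sum.remove[of _ M]) auto
  moreover have "poly Q (real (v M)) \<noteq> 0"
    using assms(2) inj \<open>M \<in> S\<close> unfolding Q_def poly_prod by (auto simp: inj_on_def)
  ultimately show ?thesis using pol by auto
qed

section \<open>The maps between spaces in coordinates\<close>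

lemma prod_list_sum_fiber:
  fixes Y :: "'b \<Rightarrow> real"
  assumes "finite B"
  shows "(\<Prod>a\<leftarrow>as. \<Sum>b\<in>{b \<in> B. g b = a}. Y b) =
    (\<Sum>bs\<in>{bs. set bs \<subseteq> B \<and> map g bs = as}. \<Prod>b\<leftarrow>bs. Y b)"
proof (induction as)
  case Nil
  have "{bs. set bs \<subseteq> B \<and> map g bs = []} = {[]}" by auto
  then show ?case by simp
next
  case (Cons a as)
  let ?R = "{bs. set bs \<subseteq> B \<and> map g bs = as}"
  have eq: "{bs. set bs \<subseteq> B \<and> map g bs = a # as} =
      (\<lambda>(b, bs). b # bs) ` ({b \<in> B. g b = a} \<times> ?R)"
    by (auto simp: map_eq_Cons_conv image_iff)
  have "(\<Sum>bs\<in>{bs. set bs \<subseteq> B \<and> map g bs = a # as}. \<Prod>b\<leftarrow>bs. Y b) =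
      (\<Sum>(b, bs)\<in>{b \<in> B. g b = a} \<times> ?R. Y b * (\<Prod>b\<leftarrow>bs. Y b))"
    unfolding eq by (subst sum.reindex) (auto simp: inj_on_def split_beta)
  also have "\<dots> = (\<Sum>b\<in>{b \<in> B. g b = a}. Y b) * (\<Sum>bs\<in>?R. \<Prod>b\<leftarrow>bs. Y b)"
    by (simp add: sum_product sum.cartesian_product)
  finally show ?case using Cons by simp
qed

lemma prod_list_mset:
  fixes h :: "'a \<Rightarrow> 'b :: comm_monoid_mult"
  assumes "mset as = M"
  shows "(\<Prod>a\<leftarrow>as. h a) = (\<Prod>a\<in>#M. h a)"
  unfolding assms[symmetric] mset_map[symmetric] prod_mset_prod_list by simp

lemma card_permutations_mfact: "real (card (permutations_of_multiset M)) = fact (size M) / mfact M"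
proof -
  have "real (fact (size M) div (\<Prod>x\<in>set_mset M. fact (count M x))) =
      real (fact (size M)) / real (\<Prod>x\<in>set_mset M. fact (count M x))"
    by (intro real_of_nat_div card_permutations_of_multiset)
  then show ?thesis by (simp add: card_permutations_of_multiset mfact_def)
qed

text \<open>Summing over all arrangements of \<open>M\<close> replaces multinomial coefficients by the numbers of
  arrangements of the two multisets.\<close>

lemma prod_mset_sum_fiber:
  fixes Y :: "'b \<Rightarrow> real"
  assumes "finite B"
  shows "(\<Prod>a\<in>#M. \<Sum>b\<in>{b \<in> B. g b = a}. Y b) =
    (\<Sum>N\<in>{N. set_mset N \<subseteq> B \<and> image_mset g N = M}. mfact M / mfact N * (\<Prod>b\<in>#N. Y b))"
proof -
  let ?P = "\<Prod>a\<in>#M. \<Sum>b\<in>{b \<in> B. g b = a}. Y b"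
  let ?NN = "{N. set_mset N \<subseteq> B \<and> image_mset g N = M}"
  let ?L = "{bs. set bs \<subseteq> B \<and> image_mset g (mset bs) = M}"
  have finNN: "finite ?NN"
    by (rule finite_subset[OF _ finite_multisets_subset[OF assms, of "size M"]]) auto
  have "finite {bs. set bs \<subseteq> B \<and> length bs = size M}"
    using assms by (rule finite_lists_length_eq)
  then have finL: "finite ?L" by (rule finite_subset[rotated]) auto
  have "real (card (permutations_of_multiset M)) * ?P = (\<Sum>as\<in>permutations_of_multiset M. ?P)"
    by simp
  also have "\<dots> = (\<Sum>as\<in>permutations_of_multiset M. \<Sum>bs\<in>{bs. set bs \<subseteq> B \<and> map g bs = as}. \<Prod>b\<leftarrow>bs. Y b)"
  proof (rule sum.cong[OF refl])
    fix as assume "as \<in> permutations_of_multiset M"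
    then have "mset as = M" by (simp add: permutations_of_multiset_def)
    then have "?P = (\<Prod>a\<leftarrow>as. \<Sum>b\<in>{b \<in> B. g b = a}. Y b)"
      by (simp only: prod_list_mset)
    then show "?P = (\<Sum>bs\<in>{bs. set bs \<subseteq> B \<and> map g bs = as}. \<Prod>b\<leftarrow>bs. Y b)"
      by (simp only: prod_list_sum_fiber[OF assms])
  qed
  also have "\<dots> = (\<Sum>as\<in>permutations_of_multiset M. \<Sum>bs\<in>{bs \<in> ?L. map g bs = as}. \<Prod>b\<leftarrow>bs. Y b)"
    by (intro sum.cong refl) (auto simp: permutations_of_multiset_def)
  also have "\<dots> = (\<Sum>bs\<in>?L. \<Prod>b\<leftarrow>bs. Y b)"
  proof (rule sum.group[OF finL])
    show "map g ` ?L \<subseteq> permutations_of_multiset M" by (auto simp: permutations_of_multiset_def)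
  qed simp
  also have "\<dots> = (\<Sum>N\<in>?NN. \<Sum>bs\<in>{bs \<in> ?L. mset bs = N}. \<Prod>b\<leftarrow>bs. Y b)"
    using finL finNN by (intro sum.group[symmetric]) auto
  also have "\<dots> = (\<Sum>N\<in>?NN. \<Sum>bs\<in>permutations_of_multiset N. \<Prod>b\<in>#N. Y b)"
  proof (intro sum.cong)
    fix N assume N: "N \<in> ?NN"
    then show "{bs \<in> ?L. mset bs = N} = permutations_of_multiset N"
      by (auto simp: permutations_of_multiset_def)
    fix bs assume "bs \<in> permutations_of_multiset N"
    then have "mset bs = N" by (simp add: permutations_of_multiset_def)
    then show "(\<Prod>b\<leftarrow>bs. Y b) = (\<Prod>b\<in>#N. Y b)"
      by (rule prod_list_mset)
  qed simp
  also have "\<dots> = (\<Sum>N\<in>?NN. fact (size M) / mfact N * (\<Prod>b\<in>#N. Y b))"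
  proof (rule sum.cong[OF refl])
    fix N assume "N \<in> ?NN"
    then have "size N = size M" by auto
    then show "(\<Sum>bs\<in>permutations_of_multiset N. \<Prod>b\<in>#N. Y b) =
        fact (size M) / mfact N * (\<Prod>b\<in>#N. Y b)"
      by (simp add: card_permutations_mfact)
  qed
  finally have "fact (size M) / mfact M * ?P =
      (\<Sum>N\<in>?NN. fact (size M) / mfact N * (\<Prod>b\<in>#N. Y b))"
    by (simp add: card_permutations_mfact)
  then have "?P = mfact M / fact (size M) * (\<Sum>N\<in>?NN. fact (size M) / mfact N * (\<Prod>b\<in>#N. Y b))"
    by (simp add: field_simps)
  then show ?thesis by (simp add: sum_distrib_left)
qed

text \<open>\<open>S\<close> is the set of output positions that are not set to zero. This covers
  pull-backs (\<open>S\<close> the whole range) as well as zero padding (\<open>f\<close> the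
  identity, \<open>S = {1..n}\<close>), so that one induction over constructions serves
  both.\<close>

definition ppull :: "nat set \<Rightarrow> (nat \<Rightarrow> nat) \<Rightarrow> (nat \<Rightarrow> real) \<Rightarrow> nat \<Rightarrow> real" where
  "ppull S f x = (\<lambda>i. if i \<in> S then x (f i) else 0)"

text \<open>A coordinate of the image involves every point of the support of its label, so a single
  point outside \<open>S\<close> makes it vanish.\<close>

definition pull :: "construction \<Rightarrow> nat set \<Rightarrow> (nat \<Rightarrow> nat) \<Rightarrow> nat \<Rightarrow> vec \<Rightarrow> vec" where
  "pull F S f m x =
     (\<lambda>b. if b \<in> labels F m \<and> lsupp b \<subseteq> S then wt (lmap f b) / wt b * x (lmap f b) else 0)"

definition push :: "construction \<Rightarrow> nat set \<Rightarrow> (nat \<Rightarrow> nat) \<Rightarrow> nat \<Rightarrow> nat \<Rightarrow> vec \<Rightarrow> vec" where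
  "push F S f n m y =
     (\<lambda>a. if a \<in> labels F n
        then (\<Sum>b\<in>{b \<in> {b \<in> labels F m. lsupp b \<subseteq> S}. lmap f b = a}. dwt b * y b) / dwt a else 0)"

lemma basis_vec_in_space: "a \<in> labels F n \<Longrightarrow> basis_vec a \<in> space_of F n"
  by (auto simp: basis_vec_def space_of_def)

lemma inner_of_basis_vec: "a \<in> labels F n \<Longrightarrow> inner_of F n x (basis_vec a) = sqnorm a * x a"
  unfolding inner_of_def basis_vec_def
  by (subst sum.remove[OF finite_labels]) (auto intro!: sum.neutral)

text \<open>Grouping the terms of the inner product by the fibres of \<open>lmap f\<close> moves
  \<open>f\<close> to the other side. Testing against basis vectors gives uniqueness, which resolves
  the \<open>THE\<close> of \<open>adj\<close>.\<close>

lemma adj_pull: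
  assumes f: "f ` (S \<inter> {1..m}) \<subseteq> {1..n}" and T: "\<And>z. T z = pull F S f m z"
  shows "adj F n m T y = push F S f n m y"
  unfolding adj_def
proof (rule the_equality)
  let ?B = "{b \<in> labels F m. lsupp b \<subseteq> S}"
  have fB: "lmap f b \<in> labels F n" if "b \<in> ?B" for b
    using that lsupp_labels[of b F m] f by (intro lmap_labels[of b F m]) auto
  have "inner_of F n (push F S f n m y) z = inner_of F m y (T z)" for z
  proof -
    have "inner_of F n (push F S f n m y) z =
        (\<Sum>a\<in>labels F n. \<Sum>b\<in>{b \<in> ?B. lmap f b = a}. wt (lmap f b) * z (lmap f b) * dwt b * y b)"
      unfolding inner_of_def push_def dwt_def
      by (rule sum.cong) (auto simp: sum_distrib_left field_simps intro!: sum.cong)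
    also have "\<dots> = (\<Sum>b\<in>?B. wt (lmap f b) * z (lmap f b) * dwt b * y b)"
      using fB finite_labels by (intro sum.group) auto
    also have "\<dots> = (\<Sum>b\<in>labels F m. if lsupp b \<subseteq> S then wt (lmap f b) * z (lmap f b) * dwt b * y b else 0)"
      using finite_labels by (simp add: sum.inter_filter)
    also have "\<dots> = inner_of F m y (T z)"
      unfolding inner_of_def T pull_def dwt_def by (intro sum.cong) auto
    finally show ?thesis .
  qed
  then show *: "push F S f n m y \<in> space_of F n \<and>
      (\<forall>z\<in>space_of F n. inner_of F n (push F S f n m y) z = inner_of F m y (T z))"
    by (auto simp: space_of_def push_def)
  fix x assume x: "x \<in> space_of F n \<and> (\<forall>z\<in>space_of F n. inner_of F n x z = inner_of F m y (T z))"
  show "x = push F S f n m y"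
  proof
    fix a
    show "x a = push F S f n m y a"
    proof (cases "a \<in> labels F n")
      case True
      then have "inner_of F n x (basis_vec a) = inner_of F n (push F S f n m y) (basis_vec a)"
        using x * basis_vec_in_space by metis
      then show ?thesis by (simp add: inner_of_basis_vec[OF True])
    next
      case False
      with x * show ?thesis by (simp add: space_of_def)
    qed
  qed
qed

lemma pull_basis_vec:
  "pull F S f m (basis_vec a) c =
     (if a = lmap f c then (if c \<in> labels F m \<and> lsupp c \<subseteq> S then wt a / wt c else 0) else 0)"
  by (auto simp: pull_def basis_vec_def)

lemma prod_mset_mset_nth: "length bs = k \<Longrightarrow> (\<Prod>b\<in>#mset bs. h b) = (\<Prod>i<k. h (bs ! i))"
  for h :: "'a \<Rightarrow> 'b :: comm_monoid_mult"
  using prod_list_mset[of bs "mset bs" h] by (simp add: prod.list_conv_set_nth atLeast0LessThan)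

text \<open>Every \<open>N\<close> lies over exactly one \<open>M\<close>, its image, which has the
  same size. \<open>Q\<close> is a parameter because both a fixed size and a bounded size
  occur.\<close>

lemma sum_multiset_fibers:
  fixes h :: "'a multiset \<Rightarrow> 'b multiset \<Rightarrow> real"
  assumes "g ` B \<subseteq> A"
    and fin: "finite {M :: 'a multiset. set_mset M \<subseteq> A \<and> Q (size M)}"
      "finite {M :: 'b multiset. set_mset M \<subseteq> B \<and> Q (size M)}"
  shows "(\<Sum>M\<in>{M. set_mset M \<subseteq> A \<and> Q (size M)}. \<Sum>N\<in>{N. set_mset N \<subseteq> B \<and> image_mset g N = M}. h M N) =
    (\<Sum>N\<in>{N. set_mset N \<subseteq> B \<and> Q (size N)}. h (image_mset g N) N)"
proof -
  have "(\<Sum>M\<in>{M. set_mset M \<subseteq> A \<and> Q (size M)}. \<Sum>N\<in>{N. set_mset N \<subseteq> B \<and> image_mset g N = M}. h M N) =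
     (\<Sum>M\<in>{M. set_mset M \<subseteq> A \<and> Q (size M)}.
        \<Sum>N\<in>{N \<in> {N. set_mset N \<subseteq> B \<and> Q (size N)}. image_mset g N = M}. h (image_mset g N) N)"
    by (intro sum.cong refl) auto
  also have "\<dots> = (\<Sum>N\<in>{N. set_mset N \<subseteq> B \<and> Q (size N)}. h (image_mset g N) N)"
    using fin assms(1) by (intro sum.group) (auto simp: subset_iff image_subset_iff)
  finally show ?thesis .
qed

lemma prod_mset_mult: "(\<Prod>a\<in>#M. f a * g a) = (\<Prod>a\<in>#M. f a) * (\<Prod>a\<in>#M. g a :: real)"
  by (induction M) auto

lemma prod_mset_divide: "(\<Prod>a\<in>#M. f a / g a) = (\<Prod>a\<in>#M. f a) / (\<Prod>a\<in>#M. g a :: real)"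
  by (induction M) auto

text \<open>Independence of monomials in the form that resolves the \<open>THE\<close> in the
  polynomial clause of \<open>fmap\<close>.\<close>

lemma hom_eval_inject:
  assumes "q \<in> space_of (HomPoly k F) m" "q' \<in> space_of (HomPoly k F) m"
    and "\<And>y. y \<in> space_of F m \<Longrightarrow> hom_eval k F m q y = hom_eval k F m q' y"
  shows "q = q'"
proof
  fix l
  let ?S = "{M. set_mset M \<subseteq> labels F m \<and> size M = k}"
  show "q l = q' l"
  proof (cases "l \<in> labels (HomPoly k F) m")
    case True
    then obtain M where M: "l = LMono M" "M \<in> ?S" by auto
    have "q (LMono M) - q' (LMono M) = 0"
    proof (rule monomials_independent[where A = "labels F m" and S = ?S
          and c = "\<lambda>M. q (LMono M) - q' (LMono M)"])
      fix x :: vec assume x: "\<And>a. a \<notin> labels F m \<Longrightarrow> x a = 0"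
      \<comment> \<open>The division cancels the factor produced by \<open>inner_of\<close> against
        a basis vector, so \<open>hom_eval\<close> becomes a plain combination of monomials in
        \<open>x\<close>.\<close>
      define y where "y a = x a / sqnorm a" for a
      have y: "y \<in> space_of F m" using x by (simp add: y_def space_of_def)
      have "hom_eval k F m p y = (\<Sum>M\<in>?S. p (LMono M) * (\<Prod>a\<in>#M. x a))" for p
        unfolding hom_eval_def
      proof (intro sum.cong refl arg_cong2[where f = "(*)"] prod_mset_cong)
        fix M a assume "M \<in> ?S" "a \<in># M"
        then have "a \<in> labels F m" by auto
        then show "inner_of F m y (basis_vec a) = x a"
          by (simp add: inner_of_basis_vec y_def)
      qed
      with assms(3)[OF y]
      show "(\<Sum>M\<in>?S. (q (LMono M) - q' (LMono M)) * (\<Prod>a\<in>#M. x a)) = 0"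
        by (simp add: left_diff_distrib sum_subtractf)
    qed (use M in \<open>auto intro: finite_labels finite_multisets_subset\<close>)
    then show ?thesis using M by simp
  next
    case False
    then show ?thesis using assms(1,2) by (simp add: space_of_def)
  qed
qed

text \<open>The factor \<open>mfact\<close> in the weight of \<open>LMono\<close> is made for this:
  expanding powers of fibre sums yields \<open>mfact M / mfact N\<close>, exactly the part of the
  weight ratio that the labels inside the monomials do not account for.\<close>

lemma hom_eval_push:
  assumes f: "f ` (S \<inter> {1..m}) \<subseteq> {1..n}"
  shows "hom_eval k F n p (push F S f n m y) = hom_eval k F m (pull (HomPoly k F) S f m p) y"
proof -
  let ?B = "{b \<in> labels F m. lsupp b \<subseteq> S}"
  let ?Sn = "{M. set_mset M \<subseteq> labels F n \<and> size M = k}"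
  let ?Sm = "{M. set_mset M \<subseteq> labels F m \<and> size M = k}"
  let ?Z = "\<lambda>b. dwt b * y b"
  have fB: "lmap f ` ?B \<subseteq> labels F n"
  proof (rule image_subsetI)
    fix b assume "b \<in> ?B"
    with lsupp_labels[of b F m] f show "lmap f b \<in> labels F n"
      by (intro lmap_labels[of b F m]) auto
  qed
  have finB: "finite ?B" using finite_labels by auto
  have "(\<Prod>a\<in>#M. inner_of F n (push F S f n m y) (basis_vec a)) =
      (\<Prod>a\<in>#M. wt a) * (\<Sum>N\<in>{N. set_mset N \<subseteq> ?B \<and> image_mset (lmap f) N = M}.
        mfact M / mfact N * (\<Prod>b\<in>#N. ?Z b))" if "M \<in> ?Sn" for M
  proof -
    have "(\<Prod>a\<in>#M. inner_of F n (push F S f n m y) (basis_vec a)) =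
        (\<Prod>a\<in>#M. wt a * (\<Sum>b\<in>{b \<in> ?B. lmap f b = a}. ?Z b))"
    proof (rule prod_mset_cong)
      fix a assume "a \<in># M"
      then have "a \<in> labels F n" using that by auto
      then show "inner_of F n (push F S f n m y) (basis_vec a) =
          wt a * (\<Sum>b\<in>{b \<in> ?B. lmap f b = a}. ?Z b)"
        by (simp add: inner_of_basis_vec push_def dwt_def)
    qed
    then show ?thesis by (simp only: prod_mset_mult prod_mset_sum_fiber[OF finB])
  qed
  then have "hom_eval k F n p (push F S f n m y) =
      (\<Sum>M\<in>?Sn. \<Sum>N\<in>{N. set_mset N \<subseteq> ?B \<and> image_mset (lmap f) N = M}.
        p (LMono M) * (\<Prod>a\<in>#M. wt a) * (mfact M / mfact N * (\<Prod>b\<in>#N. ?Z b)))"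
    unfolding hom_eval_def by (simp add: sum_distrib_left mult_ac)
  also have "\<dots> = (\<Sum>N\<in>{N. set_mset N \<subseteq> ?B \<and> size N = k}.
        p (LMono (image_mset (lmap f) N)) * (\<Prod>a\<in>#image_mset (lmap f) N. wt a) *
          (mfact (image_mset (lmap f) N) / mfact N * (\<Prod>b\<in>#N. ?Z b)))"
    by (rule sum_multiset_fibers[where Q = "\<lambda>j. j = k"])
      (use finite_labels finB fB in \<open>auto intro: finite_multisets_subset\<close>)
  also have "\<dots> = (\<Sum>N\<in>{N. set_mset N \<subseteq> ?B \<and> size N = k}.
        pull (HomPoly k F) S f m p (LMono N) * (\<Prod>a\<in>#N. inner_of F m y (basis_vec a)))"
  proof (rule sum.cong[OF refl])
    fix N assume "N \<in> {N. set_mset N \<subseteq> ?B \<and> size N = k}"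
    then have N: "set_mset N \<subseteq> labels F m" "\<And>b. b \<in># N \<Longrightarrow> lsupp b \<subseteq> S" "size N = k" by auto
    have "(\<Prod>a\<in>#N. inner_of F m y (basis_vec a)) = (\<Prod>b\<in>#N. wt b * ?Z b)"
      using N by (intro prod_mset_cong) (auto simp: inner_of_basis_vec dwt_def)
    then show "p (LMono (image_mset (lmap f) N)) * (\<Prod>a\<in>#image_mset (lmap f) N. wt a) *
          (mfact (image_mset (lmap f) N) / mfact N * (\<Prod>b\<in>#N. ?Z b)) =
        pull (HomPoly k F) S f m p (LMono N) * (\<Prod>a\<in>#N. inner_of F m y (basis_vec a))"
      using N prod_mset_pos[of N wt]
      by (auto simp: pull_def prod_mset_mult UN_subset_iff)
  qed
  \<comment> \<open>The added multisets contain a label whose support leaves \<open>S\<close>, and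
    there \<open>pull\<close> vanishes.\<close>
  also have "\<dots> = (\<Sum>N\<in>?Sm.
        pull (HomPoly k F) S f m p (LMono N) * (\<Prod>a\<in>#N. inner_of F m y (basis_vec a)))"
    by (rule sum.mono_neutral_left)
      (auto simp: pull_def intro: finite_multisets_subset finite_labels)
  finally show ?thesis by (simp add: hom_eval_def)
qed

lemma pull_in_space: "pull F S f m x \<in> space_of F m"
  by (simp add: pull_def space_of_def)

text \<open>Induction over the construction. In the polynomial case the adjoint inside
  \<open>fmap\<close> belongs to the smaller construction, where the induction hypothesis and
  \<open>adj_pull\<close> turn it into \<open>push\<close>.\<close>

theorem fmap_ppull:
  assumes f: "f ` (S \<inter> {1..m}) \<subseteq> {1..n}"
  shows "fmap F n m (ppull S f) x = pull F S f m x"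
proof (induction F arbitrary: x)
  case Ident
  show ?case
  proof
    fix l
    show "fmap Ident n m (ppull S f) x l = pull Ident S f m x l"
      using f by (cases l) (auto simp: pull_def ppull_def image_subset_iff)
  qed
next
  case (Times F G)
  show ?case
  proof
    fix l
    show "fmap (Times F G) n m (ppull S f) x l = pull (Times F G) S f m x l"
      by (cases l) (auto simp: Times pull_def)
  qed
next
  case (Tensor F G)
  have lab: "lmap f c \<in> labels H n" if "c \<in> labels H m" "lsupp c \<subseteq> S" for c H
    using that lsupp_labels[of c H m] f by (intro lmap_labels[of c H m]) auto
  show ?case
  proof
    fix l
    show "fmap (Tensor F G) n m (ppull S f) x l = pull (Tensor F G) S f m x l"
    proof (cases l)
      case (LTens c d)
      let ?ok = "c \<in> labels F m \<and> lsupp c \<subseteq> S \<and> d \<in> labels G m \<and> lsupp d \<subseteq> S"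
      show ?thesis
      proof (cases ?ok)
        case True
        then have "fmap (Tensor F G) n m (ppull S f) x l =
          (\<Sum>a\<in>labels F n. if a = lmap f c then
             (\<Sum>b\<in>labels G n. if b = lmap f d then x (LTens a b) * (wt a / wt c) * (wt b / wt d) else 0)
           else 0)"
          unfolding LTens by (auto simp: Tensor pull_basis_vec intro!: sum.cong)
        also have "\<dots> = pull (Tensor F G) S f m x l"
          using True lab[of c F] lab[of d G]
          by (auto simp: sum.delta finite_labels LTens pull_def)
        finally show ?thesis .
      next
        case False
        then have "fmap (Tensor F G) n m (ppull S f) x l = 0"
          unfolding LTens fmap.simps label.case Tensor pull_basis_vec
          by (intro sum.neutral ballI) auto
        with False show ?thesis by (auto simp: LTens pull_def)
      qed
    qed (auto simp: pull_def)
  qed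
next
  case (SymPower k F)
  have lab: "lmap f c \<in> labels F n" if "c \<in> labels F m" "lsupp c \<subseteq> S" for c
    using that lsupp_labels[of c F m] f by (intro lmap_labels[of c F m]) auto
  have "pull (SymPower k F) S f m x (LSym (mset bs)) =
      (\<Sum>as\<in>{as. set as \<subseteq> labels F n \<and> length as = k}.
        x (LSym (mset as)) * (\<Prod>i<k. fmap F n m (ppull S f) (basis_vec (as ! i)) (bs ! i)))"
    (is "_ = (\<Sum>as\<in>?A. ?t as)")
    if bs: "set bs \<subseteq> labels F m" "length bs = k" for bs
  proof -
    let ?as = "map (lmap f) bs"
    \<comment> \<open>The image of a basis vector has a nonzero coordinate \<open>c\<close> only if
      its label is \<open>lmap f c\<close>, so at most one list contributes.\<close>
    have zero: "?t as = 0" if as: "length as = k" "as \<noteq> ?as" for as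
    proof -
      obtain i where "i < k" "as ! i \<noteq> lmap f (bs ! i)"
        using as bs by (metis length_map nth_equalityI nth_map)
      then have "(\<Prod>i<k. fmap F n m (ppull S f) (basis_vec (as ! i)) (bs ! i)) = 0"
        by (intro prod_zero) (auto simp: SymPower pull_basis_vec)
      then show ?thesis by simp
    qed
    show ?thesis
    proof (cases "\<forall>b\<in>set bs. lsupp b \<subseteq> S")
      case True
      then have "?as \<in> ?A" using bs lab by auto
      moreover have "finite ?A" by (intro finite_lists_length_eq finite_labels)
      moreover have "(\<Sum>as\<in>?A - {?as}. ?t as) = 0"
        using zero by (intro sum.neutral) blast
      ultimately have "(\<Sum>as\<in>?A. ?t as) = ?t ?as"
        by (simp only: sum.remove[of ?A ?as] add_0_right)
      also have "\<dots> = x (LSym (mset ?as)) * (\<Prod>i<k. wt (lmap f (bs ! i)) / wt (bs ! i))"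
      proof (intro arg_cong2[where f = "(*)"] prod.cong refl)
        fix i assume "i \<in> {..<k}"
        then have "bs ! i \<in> set bs" using bs by simp
        then show "fmap F n m (ppull S f) (basis_vec (?as ! i)) (bs ! i) =
            wt (lmap f (bs ! i)) / wt (bs ! i)"
          using True bs \<open>i \<in> {..<k}\<close> by (auto simp: SymPower pull_basis_vec)
      qed
      also have "\<dots> = pull (SymPower k F) S f m x (LSym (mset bs))"
        using True bs prod_mset_mset_nth[OF bs(2), of "\<lambda>b. wt (lmap f b) / wt b"]
        by (auto simp: pull_def prod_mset_divide multiset.map_comp o_def UN_subset_iff)
      finally show ?thesis by simp
    next
      case False
      then obtain i where "i < k" "\<not> lsupp (bs ! i) \<subseteq> S"
        using bs by (metis in_set_conv_nth)
      then have "?t as = 0" for as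
        by (auto simp: SymPower pull_basis_vec intro!: prod_zero)
      then have "(\<Sum>as\<in>?A. ?t as) = 0" by (intro sum.neutral) blast
      moreover have "pull (SymPower k F) S f m x (LSym (mset bs)) = 0"
        using False by (auto simp: pull_def)
      ultimately show ?thesis by argo
    qed
  qed
  note entries = this
  show ?case unfolding fmap.simps
  proof (rule the_equality)
    fix y assume y: "y \<in> space_of (SymPower k F) m \<and> (\<forall>bs. set bs \<subseteq> labels F m \<and> length bs = k \<longrightarrow>
      y (LSym (mset bs)) = (\<Sum>as\<in>{as. set as \<subseteq> labels F n \<and> length as = k}.
        x (LSym (mset as)) * (\<Prod>i<k. fmap F n m (ppull S f) (basis_vec (as ! i)) (bs ! i))))"
    show "y = pull (SymPower k F) S f m x"
    proof
      fix l
      show "y l = pull (SymPower k F) S f m x l"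
      proof (cases "l \<in> labels (SymPower k F) m")
        case True
        then obtain M where M: "l = LSym M" "set_mset M \<subseteq> labels F m" "size M = k" by auto
        obtain bs where "mset bs = M" using ex_mset by blast
        with M y entries[of bs] show ?thesis by auto
      next
        case False
        with y pull_in_space[of "SymPower k F" S f m x] show ?thesis by (simp add: space_of_def)
      qed
    qed
  qed (use entries pull_in_space in blast)
next
  case (HomPoly k F)
  have adj: "adj F n m (fmap F n m (ppull S f)) y = push F S f n m y" for y
    using adj_pull[OF f HomPoly] .
  show ?case unfolding fmap.simps adj
  proof (rule the_equality)
    show "pull (HomPoly k F) S f m x \<in> space_of (HomPoly k F) m \<and>
      (\<forall>y\<in>space_of F m. hom_eval k F m (pull (HomPoly k F) S f m x) y =
        hom_eval k F n x (push F S f n m y))"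
      using pull_in_space hom_eval_push[OF f] by simp
    fix q assume "q \<in> space_of (HomPoly k F) m \<and>
      (\<forall>y\<in>space_of F m. hom_eval k F m q y = hom_eval k F n x (push F S f n m y))"
    then show "q = pull (HomPoly k F) S f m x"
      using pull_in_space hom_eval_push[OF f] by (intro hom_eval_inject[of _ k F m]) auto
  qed
qed

section \<open>De Finetti maps\<close>

declare One_nat_def [simp del] \<comment> \<open>keeps the intervals \<open>{1..n}\<close> as they are\<close>

text \<open>This and \<open>vpush\<close> are \<open>pull\<close> and \<open>push\<close> for
  \<open>S = {1..m}\<close>; labels of level m have their support there, so the support condition
  disappears.\<close>

definition vpull :: "construction \<Rightarrow> nat \<Rightarrow> (nat \<Rightarrow> nat) \<Rightarrow> vec \<Rightarrow> vec" where
  "vpull F m f x = (\<lambda>b. if b \<in> labels F m then wt (lmap f b) / wt b * x (lmap f b) else 0)"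

definition vpush :: "construction \<Rightarrow> nat \<Rightarrow> nat \<Rightarrow> (nat \<Rightarrow> nat) \<Rightarrow> vec \<Rightarrow> vec" where
  "vpush F m n f y =
     (\<lambda>a. if a \<in> labels F n then (\<Sum>b\<in>{b \<in> labels F m. lmap f b = a}. dwt b * y b) / dwt a else 0)"

lemma pull_eq_vpull: "pull F {1..m} f m = vpull F m f"
  using lsupp_labels unfolding pull_def vpull_def by fastforce

lemma push_eq_vpush: "push F {1..m} f n m = vpush F m n f"
proof -
  have "{b \<in> labels F m. lsupp b \<subseteq> {1..m}} = labels F m"
    using lsupp_labels by blast
  then show ?thesis unfolding push_def vpush_def by (simp only: Collect_mem_eq)
qed

lemma lmap_labels_image: "f ` {1..m} \<subseteq> {1..n} \<Longrightarrow> b \<in> labels F m \<Longrightarrow> lmap f b \<in> labels F n"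
  using lsupp_labels[of b F m] by (intro lmap_labels) auto

lemma fmap_pull_back:
  "f ` {1..m} \<subseteq> {1..n} \<Longrightarrow> fmap F n m (pull_back m f) = vpull F m f"
proof -
  assume f: "f ` {1..m} \<subseteq> {1..n}"
  have eq: "pull_back m f = ppull {1..m} f" by (simp add: fun_eq_iff pull_back_def ppull_def)
  show ?thesis
    unfolding eq using fmap_ppull[of f "{1..m}" m n F] f by (auto simp: pull_eq_vpull)
qed

lemma adj_vpull: "f ` {1..m} \<subseteq> {1..n} \<Longrightarrow> adj F n m (vpull F m f) = vpush F m n f"
  using adj_pull[of f "{1..m}" m n "vpull F m f" F]
  by (auto simp: pull_eq_vpull push_eq_vpush fun_eq_iff)

text \<open>Positions and blocks are both counted from 1, hence the two shifts. Duplication is the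
  pull-back along this map.\<close>

definition block :: "nat \<Rightarrow> nat \<Rightarrow> nat \<Rightarrow> nat" where
  "block N n i = (i - 1) div (N div n) + 1"

lemma block_fiber:
  assumes "1 \<le> n" "1 \<le> N" "n dvd N" "j \<in> {1..n}"
  shows "{i \<in> {1..N}. block N n i = j} = {(j - 1) * (N div n) + 1..j * (N div n)}"
proof -
  obtain t where t: "N = n * t" using assms(3) by blast
  have t0: "N div n = t" "0 < t" using t assms by (cases t; auto)+
  obtain j' where j': "j = Suc j'" using assms(4) by (cases j) auto
  have le: "Suc j' * t \<le> n * t" using assms(4) j' by (intro mult_le_mono1) simp
  have "((i - 1) div t = j') \<longleftrightarrow> j' * t \<le> i - 1 \<and> i - 1 < Suc j' * t" for i
    using t0(2) less_eq_div_iff_mult_less_eq[of t j' "i - 1"] div_less_iff_less_mult[of t "i - 1" "Suc j'"]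
    by auto
  then have b: "block N n i = j \<longleftrightarrow> j' * t \<le> i - 1 \<and> i - 1 < Suc j' * t" for i
    by (simp add: block_def j' t0)
  have *: "{i \<in> {1..N}. a \<le> i - 1 \<and> i - 1 < b} = {a + 1..b}" if "b \<le> N" for a b :: nat
    using that by auto
  show ?thesis
    unfolding b using *[of "Suc j' * t" "j' * t"] le t t0 j' by (simp del: mult_Suc)
qed

lemma block_range:
  assumes "1 \<le> n" "1 \<le> N" "n dvd N"
  shows "block N n ` {1..N} \<subseteq> {1..n}"
proof -
  obtain t where t: "N = n * t" using assms(3) by blast
  have t0: "N div n = t" "0 < t" using t assms by (cases t; auto)+
  have "(i - 1) div t < n" if "i \<in> {1..N}" for i
    using that t t0 by (auto simp: div_less_iff_less_mult)
  then show ?thesis by (fastforce simp: block_def t0)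
qed

lemma card_block_fiber:
  assumes "1 \<le> n" "1 \<le> N" "n dvd N" "j \<in> {1..n}"
  shows "card {i \<in> {1..N}. block N n i = j} = N div n"
proof -
  obtain j' where "j = Suc j'" using assms(4) by (cases j) auto
  then show ?thesis unfolding block_fiber[OF assms] by simp
qed

section \<open>Embeddings, their adjoints and permutations as pull-backs or push-forwards\<close>

lemma embed_Duplication:
  "index_le Duplication n N \<Longrightarrow> embed Duplication F N n = vpull F N (block N n)"
proof -
  assume "index_le Duplication n N"
  moreover have "duplicate N n = pull_back N (block N n)"
    by (simp add: fun_eq_iff duplicate_def pull_back_def block_def)
  ultimately show ?thesis using fmap_pull_back[OF block_range, of n N F] by simp
qed

lemma embed_adj_Duplication:
  "index_le Duplication n N \<Longrightarrow> embed_adj Duplication F N n = vpush F N n (block N n)"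
  unfolding embed_adj_def using block_range[of n N]
  by (subst embed_Duplication) (simp_all add: adj_vpull)

lemma embed_ZeroPadding_pull:
  assumes "index_le ZeroPadding n N"
  shows "embed ZeroPadding F N n = pull F {1..n} (\<lambda>i. i) N"
proof -
  have eq: "zero_pad n = ppull {1..n} (\<lambda>i. i)" by (simp add: fun_eq_iff zero_pad_def ppull_def)
  have "fmap F n N (ppull {1..n} (\<lambda>i. i)) x = pull F {1..n} (\<lambda>i. i) N x" for x
    by (rule fmap_ppull) auto
  then show ?thesis by (auto simp: eq)
qed

lemma labels_lsupp_iff: "n \<le> N \<Longrightarrow> b \<in> labels F N \<and> lsupp b \<subseteq> {1..n} \<longleftrightarrow> b \<in> labels F n"
  using labels_mono lsupp_labels labels_le by blast

text \<open>Zero padding is the full push-forward along the inclusion, as each fibre is a single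
  label or empty. This makes it the mirror image of duplication, which is a full pull-back.\<close>

lemma embed_ZeroPadding:
  assumes "index_le ZeroPadding n N"
  shows "embed ZeroPadding F N n = vpush F n N (\<lambda>i. i)"
proof (intro ext)
  fix x a
  have nN: "n \<le> N" using assms by simp
  show "embed ZeroPadding F N n x a = vpush F n N (\<lambda>i. i) x a"
  proof (cases "a \<in> labels F n")
    case True
    then have "{b \<in> labels F n. b = a} = {a}" by auto
    then show ?thesis
      using labels_lsupp_iff[OF nN, of a F] True
      unfolding embed_ZeroPadding_pull[OF assms] by (auto simp: pull_def vpush_def lmap_ident)
  next
    case False
    then have "vpush F n N (\<lambda>i. i) x a = 0"
      by (auto simp: vpush_def lmap_ident intro!: sum.neutral)
    moreover have "pull F {1..n} (\<lambda>i. i) N x a = 0"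
      using labels_lsupp_iff[OF nN, of a F] False by (auto simp: pull_def)
    ultimately show ?thesis unfolding embed_ZeroPadding_pull[OF assms] by simp
  qed
qed

lemma embed_adj_ZeroPadding:
  assumes "index_le ZeroPadding n N"
  shows "embed_adj ZeroPadding F N n = vpull F n (\<lambda>i. i)"
proof (intro ext)
  fix y a
  have nN: "n \<le> N" using assms by simp
  have "embed_adj ZeroPadding F N n y = push F {1..n} (\<lambda>i. i) n N y"
    unfolding embed_adj_def embed_ZeroPadding_pull[OF assms] by (rule adj_pull) auto
  moreover have "{b \<in> {b \<in> labels F N. lsupp b \<subseteq> {1..n}}. b = a} = {a}" if "a \<in> labels F n"
    using that labels_lsupp_iff[OF nN, of a F] by auto
  ultimately show "embed_adj ZeroPadding F N n y a = vpull F n (\<lambda>i. i) y a"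
    by (simp add: push_def vpull_def lmap_ident)
qed

lemma act_eq_vpull: "\<sigma> permutes {1..n} \<Longrightarrow> act F n \<sigma> = vpull F n (inv_into UNIV \<sigma>)"
proof -
  assume s: "\<sigma> permutes {1..n}"
  have "permute_vec n \<sigma> = pull_back n (inv_into UNIV \<sigma>)"
    by (simp add: fun_eq_iff permute_vec_def pull_back_def)
  then show ?thesis
    using fmap_pull_back[of "inv_into UNIV \<sigma>" n n F] permutes_image[OF permutes_inv[OF s]]
    by (simp add: act_def)
qed

lemma act_apply:
  assumes "\<sigma> permutes {1..n}"
  shows "act F n \<sigma> x a = (if a \<in> labels F n then x (lmap (inv_into UNIV \<sigma>) a) else 0)"
  using permutes_inj[OF permutes_inv[OF assms]]
  by (simp add: act_eq_vpull[OF assms] vpull_def wt_lmap_inj)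

text \<open>For a bijection, pushing forward is pulling back along the inverse, and
  \<open>dwt\<close> does not change. Together with \<open>act_eq_vpull\<close> this lets
  permutations be composed with maps of either kind.\<close>

lemma act_eq_vpush:
  assumes s: "\<sigma> permutes {1..n}"
  shows "act F n \<sigma> = vpush F n n \<sigma>"
proof (intro ext)
  fix x a
  let ?i = "inv_into UNIV \<sigma>"
  have "{b \<in> labels F n. lmap \<sigma> b = a} = {lmap ?i a}" if "a \<in> labels F n"
  proof -
    have "lmap ?i (lmap \<sigma> b) = b" "lmap \<sigma> (lmap ?i b) = b" for b
      using permutes_inverses[OF s] by (auto simp: lmap_lmap intro: lmap_idI)
    moreover have "lmap ?i a \<in> labels F n"
      using that permutes_image[OF permutes_inv[OF s]] by (intro lmap_labels_image[of _ n]) auto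
    ultimately show ?thesis by auto
  qed
  then show "act F n \<sigma> x a = vpush F n n \<sigma> x a"
    using permutes_inj[OF permutes_inv[OF s]]
    by (simp add: act_apply[OF s] vpush_def dwt_lmap_inj)
qed

lemma vpull_vpull:
  "f ` {1..k} \<subseteq> {1..n} \<Longrightarrow> vpull F k f (vpull F n g x) = vpull F k (g \<circ> f) x"
  unfolding vpull_def using lmap_labels_image[of f k n] by (auto simp: fun_eq_iff lmap_lmap)

lemma vpush_vpush:
  assumes "g ` {1..m} \<subseteq> {1..n}"
  shows "vpush F n k f (vpush F m n g x) = vpush F m k (f \<circ> g) x"
proof (intro ext)
  fix a
  have "(\<Sum>b\<in>{b \<in> labels F n. lmap f b = a}. dwt b * vpush F m n g x b) =
      (\<Sum>b\<in>{b \<in> labels F n. lmap f b = a}.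
        \<Sum>c\<in>{c \<in> {c \<in> labels F m. lmap f (lmap g c) = a}. lmap g c = b}. dwt c * x c)"
    unfolding vpush_def by (intro sum.cong) (auto intro!: sum.cong)
  also have "\<dots> = (\<Sum>c\<in>{c \<in> labels F m. lmap f (lmap g c) = a}. dwt c * x c)"
    using finite_labels lmap_labels_image[OF assms] by (intro sum.group) auto
  finally show "vpush F n k f (vpush F m n g x) a = vpush F m k (f \<circ> g) x a"
    by (simp add: vpush_def[of F n k] vpush_def[of F m k] lmap_lmap)
qed

lemma lmap_cong_labels:
  "b \<in> labels F m \<Longrightarrow> (\<And>i. i \<in> {1..m} \<Longrightarrow> f i = g i) \<Longrightarrow> lmap f b = lmap g b"
  using lsupp_labels[of b F m] by (intro lmap_cong) auto

lemma vpull_cong: "(\<And>i. i \<in> {1..m} \<Longrightarrow> f i = g i) \<Longrightarrow> vpull F m f = vpull F m g"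
  unfolding vpull_def using lmap_cong_labels[of _ F m f g] by (auto simp: fun_eq_iff)

lemma vpush_cong:
  assumes "\<And>i. i \<in> {1..m} \<Longrightarrow> f i = g i"
  shows "vpush F m n f = vpush F m n g"
proof -
  have "{b \<in> labels F m. lmap f b = a} = {b \<in> labels F m. lmap g b = a}" for a
    using lmap_cong_labels[of _ F m f g] assms by auto
  then show ?thesis unfolding vpush_def by presburger
qed

text \<open>The two kinds of pairs are treated alike: a map \<open>f\<close> induces \<open>dmap U F k n f\<close> from
  \<open>space_of F n\<close> to \<open>space_of F k\<close>, where \<open>f\<close> goes from \<open>{1..k}\<close> to \<open>{1..n}\<close> if \<open>U\<close> is
  \<open>Duplication\<close> and backwards otherwise.\<close>

fun dmap :: "base_seq \<Rightarrow> construction \<Rightarrow> nat \<Rightarrow> nat \<Rightarrow> (nat \<Rightarrow> nat) \<Rightarrow> vec \<Rightarrow> vec" where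
  "dmap Duplication F k n f = vpull F k f"
| "dmap ZeroPadding F k n f = vpush F n k f"

fun src :: "base_seq \<Rightarrow> nat \<Rightarrow> nat \<Rightarrow> nat" where
  "src Duplication k n = k"
| "src ZeroPadding k n = n"

fun tgt :: "base_seq \<Rightarrow> nat \<Rightarrow> nat \<Rightarrow> nat" where
  "tgt Duplication k n = n"
| "tgt ZeroPadding k n = k"

definition homs :: "base_seq \<Rightarrow> nat \<Rightarrow> nat \<Rightarrow> (nat \<Rightarrow> nat) set" where
  "homs U k n = ({1..src U k n} \<rightarrow> {1..tgt U k n})"

definition ehoms :: "base_seq \<Rightarrow> nat \<Rightarrow> nat \<Rightarrow> (nat \<Rightarrow> nat) set" where
  "ehoms U k n = ({1..src U k n} \<rightarrow>\<^sub>E {1..tgt U k n})"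

text \<open>Pull-backs reverse the order of composition; with these clauses \<open>dmap U\<close> is
  functorial.\<close>

fun hcomp :: "base_seq \<Rightarrow> (nat \<Rightarrow> nat) \<Rightarrow> (nat \<Rightarrow> nat) \<Rightarrow> nat \<Rightarrow> nat" where
  "hcomp Duplication f g = g \<circ> f"
| "hcomp ZeroPadding f g = f \<circ> g"

fun other :: "base_seq \<Rightarrow> base_seq" where
  "other Duplication = ZeroPadding"
| "other ZeroPadding = Duplication"

text \<open>\<open>emap U\<close> underlies the embeddings of the first sequence, and
  \<open>emap (other U)\<close> the adjoints of the embeddings of the second. One of the two is the
  block map, the other an inclusion.\<close>

fun emap :: "base_seq \<Rightarrow> nat \<Rightarrow> nat \<Rightarrow> nat \<Rightarrow> nat" where
  "emap Duplication N n = block N n"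
| "emap ZeroPadding N n = (\<lambda>i. i)"

fun pmap :: "base_seq \<Rightarrow> (nat \<Rightarrow> nat) \<Rightarrow> nat \<Rightarrow> nat" where
  "pmap Duplication \<sigma> = inv_into UNIV \<sigma>"
| "pmap ZeroPadding \<sigma> = \<sigma>"

lemma finset_pair_iff: "finset_pair U L \<longleftrightarrow> L = other U"
  by (cases U; cases L) (auto simp: finset_pair_def)

lemma dmap_dmap:
  "f \<in> homs U k n \<Longrightarrow> g \<in> homs U n m \<Longrightarrow>
    dmap U F k n f (dmap U F n m g x) = dmap U F k m (hcomp U f g) x"
  by (cases U) (auto simp: homs_def vpull_vpull vpush_vpush Pi_def image_subset_iff)

lemma hcomp_homs: "f \<in> homs U k n \<Longrightarrow> g \<in> homs U n m \<Longrightarrow> hcomp U f g \<in> homs U k m"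
  by (cases U) (auto simp: homs_def Pi_def)

lemma dmap_cong:
  "(\<And>i. i \<in> {1..src U k n} \<Longrightarrow> f i = g i) \<Longrightarrow> dmap U F k n f = dmap U F k n g"
  by (cases U) (auto intro: vpull_cong vpush_cong)

lemma dmap_restrict: "dmap U F k n (restrict f {1..src U k n}) = dmap U F k n f"
  by (rule dmap_cong) simp

lemma emap_homs: "index_le U n N \<Longrightarrow> emap U N n \<in> homs U N n"
  using block_range[of n N] by (cases U) (auto simp: homs_def Pi_def image_subset_iff)

lemma emap_other_homs: "index_le (other U) n N \<Longrightarrow> emap (other U) N n \<in> homs U n N"
  using block_range[of n N] by (cases U) (auto simp: homs_def Pi_def image_subset_iff)

lemma embed_eq_dmap: "index_le U n N \<Longrightarrow> embed U F N n = dmap U F N n (emap U N n)"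
  by (cases U) (simp_all add: embed_Duplication embed_ZeroPadding del: index_le.simps embed.simps)

text \<open>Taking adjoints exchanges pull-backs and push-forwards, so the adjoints for the second
  sequence are of the same kind as the embeddings of the first and can be composed with
  them.\<close>

lemma embed_adj_eq_dmap:
  "index_le (other U) n N \<Longrightarrow> embed_adj (other U) F N n = dmap U F n N (emap (other U) N n)"
  by (cases U) (simp_all add: embed_adj_Duplication embed_adj_ZeroPadding del: index_le.simps)

lemma act_eq_dmap: "\<sigma> permutes {1..n} \<Longrightarrow> act F n \<sigma> = dmap U F n n (pmap U \<sigma>)"
  by (cases U) (simp_all only: dmap.simps pmap.simps act_eq_vpull, simp add: act_eq_vpush flip: act_eq_vpull)

lemma pmap_permutes: "\<sigma> permutes A \<Longrightarrow> pmap U \<sigma> permutes A"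
  by (cases U) (auto intro: permutes_inv)

lemma permutes_homs: "\<sigma> permutes {1..n} \<Longrightarrow> \<sigma> \<in> homs U n n"
  by (cases U) (auto simp: homs_def permutes_in_image simp del: atLeastAtMost_iff)

lemma pmap_homs: "\<sigma> permutes {1..n} \<Longrightarrow> pmap U \<sigma> \<in> homs U n n"
  by (intro permutes_homs pmap_permutes)

lemma pmap_comp:
  "\<sigma> permutes A \<Longrightarrow> \<tau> permutes A \<Longrightarrow> hcomp U (pmap U \<sigma>) (pmap U \<tau>) = pmap U (\<sigma> \<circ> \<tau>)"
  by (cases U) (auto simp: permutes_inv_o o_inv_distrib permutes_bij)

lemma act_act:
  assumes "\<sigma> permutes {1..n}" "\<tau> permutes {1..n}"
  shows "act F n \<sigma> (act F n \<tau> x) = act F n (\<sigma> \<circ> \<tau>) x"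
  using assms pmap_homs[of _ n ZeroPadding]
  by (simp add: act_eq_dmap[of _ n F ZeroPadding] dmap_dmap pmap_comp permutes_compose
      del: dmap.simps)

lemma ehoms_subset_homs: "f \<in> ehoms U k n \<Longrightarrow> f \<in> homs U k n"
  by (auto simp: ehoms_def homs_def)

lemma finite_ehoms: "finite (ehoms U k n)"
  unfolding ehoms_def by (intro finite_PiE) auto

lemma ehoms_nonempty: "1 \<le> k \<Longrightarrow> 1 \<le> n \<Longrightarrow> ehoms U k n \<noteq> {}"
  by (cases U) (auto simp: ehoms_def PiE_eq_empty_iff)

lemma card_ehoms_pos: "1 \<le> k \<Longrightarrow> 1 \<le> n \<Longrightarrow> 0 < card (ehoms U k n)"
  by (simp add: card_gt_0_iff finite_ehoms ehoms_nonempty)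

lemma de_finetti_seq_eq:
  assumes "1 \<le> k" "1 \<le> n"
  shows "de_finetti_seq U F k q n x =
    (\<Sum>f\<in>ehoms U k n. q (dmap U F k n f x)) / card (ehoms U k n)"
proof (cases U)
  case ZeroPadding
  have fin: "finite ({1..n} \<rightarrow>\<^sub>E {1..k})" by (intro finite_PiE) auto
  have ne: "({1..n} \<rightarrow>\<^sub>E {1..k}) \<noteq> {}" using assms by (auto simp: PiE_eq_empty_iff)
  have "measure_pmf.expectation (de_finetti_map ZeroPadding F k n) (\<lambda>T. q (T x)) =
      (\<Sum>f\<in>{1..n} \<rightarrow>\<^sub>E {1..k}. q (adj F k n (fmap F k n (pull_back n f)) x)) / card ({1..n} \<rightarrow>\<^sub>E {1..k})"
    using fin ne by (simp add: random_map_def integral_pmf_of_set)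
  also have "(\<Sum>f\<in>{1..n} \<rightarrow>\<^sub>E {1..k}. q (adj F k n (fmap F k n (pull_back n f)) x)) =
      (\<Sum>f\<in>{1..n} \<rightarrow>\<^sub>E {1..k}. q (vpush F n k f x))"
  proof (rule sum.cong[OF refl])
    fix f assume "f \<in> {1..n} \<rightarrow>\<^sub>E {1..k}"
    then have f: "f ` {1..n} \<subseteq> {1..k}" by auto
    show "q (adj F k n (fmap F k n (pull_back n f)) x) = q (vpush F n k f x)"
      by (simp only: fmap_pull_back[OF f] adj_vpull[OF f])
  qed
  finally show ?thesis using assms by (simp add: ZeroPadding ehoms_def de_finetti_seq_def)
next
  case Duplication
  have fin: "finite ({1..k} \<rightarrow>\<^sub>E {1..n})" by (intro finite_PiE) auto
  have ne: "({1..k} \<rightarrow>\<^sub>E {1..n}) \<noteq> {}" using assms by (auto simp: PiE_eq_empty_iff)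
  have "measure_pmf.expectation (de_finetti_map Duplication F k n) (\<lambda>T. q (T x)) =
      (\<Sum>f\<in>{1..k} \<rightarrow>\<^sub>E {1..n}. q (fmap F n k (pull_back k f) x)) / card ({1..k} \<rightarrow>\<^sub>E {1..n})"
    using fin ne by (simp add: random_map_def integral_pmf_of_set)
  also have "(\<Sum>f\<in>{1..k} \<rightarrow>\<^sub>E {1..n}. q (fmap F n k (pull_back k f) x)) =
      (\<Sum>f\<in>{1..k} \<rightarrow>\<^sub>E {1..n}. q (vpull F k f x))"
  proof (rule sum.cong[OF refl])
    fix f assume "f \<in> {1..k} \<rightarrow>\<^sub>E {1..n}"
    then have f: "f ` {1..k} \<subseteq> {1..n}" by auto
    show "q (fmap F n k (pull_back k f) x) = q (vpull F k f x)"
      by (simp only: fmap_pull_back[OF f])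
  qed
  finally show ?thesis using assms by (simp add: Duplication ehoms_def de_finetti_seq_def)
qed

section \<open>Averages over uniformly random maps\<close>

lemma average_fibers:
  fixes Q :: "'b \<Rightarrow> real"
  assumes "finite S" "finite S'" "\<pi> ` S \<subseteq> S'" "0 < t"
    and t: "\<And>s'. s' \<in> S' \<Longrightarrow> card {s \<in> S. \<pi> s = s'} = t"
  shows "(\<Sum>s\<in>S. Q (\<pi> s)) / card S = (\<Sum>s'\<in>S'. Q s') / card S'"
proof -
  have *: "(\<Sum>s\<in>S. h (\<pi> s)) = t * (\<Sum>s'\<in>S'. h s')" for h :: "'b \<Rightarrow> real"
  proof -
    have "(\<Sum>s\<in>S. h (\<pi> s)) = (\<Sum>s'\<in>S'. \<Sum>s\<in>{s \<in> S. \<pi> s = s'}. h (\<pi> s))"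
      using assms(1-3) by (intro sum.group[symmetric]) auto
    also have "\<dots> = (\<Sum>s'\<in>S'. t * h s')" by (intro sum.cong) (auto simp: t)
    finally show ?thesis by (simp add: sum_distrib_left)
  qed
  from *[of Q] *[of "\<lambda>_. 1"] \<open>0 < t\<close> show ?thesis by simp
qed

text \<open>The fibre over \<open>f'\<close> is a product of fibres of \<open>g\<close>, one for
  each point of \<open>A\<close>, so all fibres have \<open>t ^ card A\<close> elements and the
  composite is again uniformly random.\<close>

lemma average_postcompose:
  fixes Q :: "(nat \<Rightarrow> nat) \<Rightarrow> real"
  assumes "finite A" "finite B" "finite B'" "g ` B \<subseteq> B'" "0 < t"
    and t: "\<And>b'. b' \<in> B' \<Longrightarrow> card {b \<in> B. g b = b'} = t"
  shows "(\<Sum>f\<in>A \<rightarrow>\<^sub>E B. Q (restrict (g \<circ> f) A)) / card (A \<rightarrow>\<^sub>E B) =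
    (\<Sum>f\<in>A \<rightarrow>\<^sub>E B'. Q f) / card (A \<rightarrow>\<^sub>E B')"
proof (rule average_fibers[where t = "t ^ card A"])
  show "(\<lambda>f. restrict (g \<circ> f) A) ` (A \<rightarrow>\<^sub>E B) \<subseteq> A \<rightarrow>\<^sub>E B'" using assms(4) by fastforce
  fix f' assume f': "f' \<in> A \<rightarrow>\<^sub>E B'"
  have "{f \<in> A \<rightarrow>\<^sub>E B. restrict (g \<circ> f) A = f'} = (\<Pi>\<^sub>E a\<in>A. {b \<in> B. g b = f' a})"
    using f' by (auto simp: fun_eq_iff PiE_def Pi_def extensional_def restrict_def)
  then show "card {f \<in> A \<rightarrow>\<^sub>E B. restrict (g \<circ> f) A = f'} = t ^ card A"
    using \<open>finite A\<close> t[OF PiE_mem[OF f']] by (simp add: card_PiE)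
qed (use assms in \<open>auto intro: finite_PiE\<close>)

text \<open>A random map restricted along an injection stays uniformly random: the values at the
  remaining points of \<open>A'\<close> are free.\<close>

lemma average_precompose:
  fixes Q :: "(nat \<Rightarrow> nat) \<Rightarrow> real"
  assumes "finite A'" "finite B" "B \<noteq> {}" "inj_on e A" "e ` A \<subseteq> A'"
  shows "(\<Sum>f\<in>A' \<rightarrow>\<^sub>E B. Q (restrict (f \<circ> e) A)) / card (A' \<rightarrow>\<^sub>E B) =
    (\<Sum>f\<in>A \<rightarrow>\<^sub>E B. Q f) / card (A \<rightarrow>\<^sub>E B)"
proof (rule average_fibers[where t = "card B ^ card (A' - e ` A)"])
  have "finite A" using assms finite_subset finite_imageD by metis
  then show "finite (A \<rightarrow>\<^sub>E B)" using assms by (auto intro: finite_PiE)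
  show "(\<lambda>f. restrict (f \<circ> e) A) ` (A' \<rightarrow>\<^sub>E B) \<subseteq> A \<rightarrow>\<^sub>E B" using assms(5) by fastforce
  fix f' assume f': "f' \<in> A \<rightarrow>\<^sub>E B"
  let ?X = "\<lambda>j. if j \<in> e ` A then {f' (the_inv_into A e j)} else B"
  have "{f \<in> A' \<rightarrow>\<^sub>E B. restrict (f \<circ> e) A = f'} = PiE A' ?X"
  proof (intro equalityI subsetI)
    fix f assume f: "f \<in> {f \<in> A' \<rightarrow>\<^sub>E B. restrict (f \<circ> e) A = f'}"
    then have "f (e a) = f' a" if "a \<in> A" for a using that by (auto simp: fun_eq_iff split: if_splits)
    then show "f \<in> PiE A' ?X" using f assms(4) by (auto simp: PiE_iff the_inv_into_f_f)
  next
    fix f assume f: "f \<in> PiE A' ?X"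
    then have fe: "f (e a) = f' a" if "a \<in> A" for a
      using that assms(4,5) by (auto simp: PiE_iff the_inv_into_f_f dest!: bspec[of _ _ "e a"])
    have "f j \<in> B" if "j \<in> A'" for j
      using f f' that fe by (cases "j \<in> e ` A") (auto simp: PiE_iff)
    with f fe f' show "f \<in> {f \<in> A' \<rightarrow>\<^sub>E B. restrict (f \<circ> e) A = f'}"
      by (auto simp: fun_eq_iff PiE_iff extensional_def)
  qed
  then have "card {f \<in> A' \<rightarrow>\<^sub>E B. restrict (f \<circ> e) A = f'} =
      (\<Prod>j\<in>A'. if j \<in> e ` A then 1 else card B)"
    using assms(1) by (auto simp: card_PiE intro!: prod.cong)
  also have "\<dots> = (\<Prod>j\<in>A' - e ` A. if j \<in> e ` A then 1 else card B)"
    using assms by (intro prod.mono_neutral_right) auto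
  finally show "card {f \<in> A' \<rightarrow>\<^sub>E B. restrict (f \<circ> e) A = f'} = card B ^ card (A' - e ` A)"
    by simp
qed (use assms in \<open>auto intro: finite_PiE simp: card_gt_0_iff\<close>)

section \<open>Polynomials and their coefficients\<close>

abbreviation mmap :: "(nat \<Rightarrow> nat) \<Rightarrow> label multiset \<Rightarrow> label multiset" where
  "mmap f \<equiv> image_mset (lmap f)"

definition mons :: "construction \<Rightarrow> nat \<Rightarrow> nat \<Rightarrow> label multiset set" where
  "mons F n d = {M. set_mset M \<subseteq> labels F n \<and> size M \<le> d}"

text \<open>The scaling of monomials for which substitution acts on coefficients as \<open>coef_map\<close>: by
  push-forward along \<open>lmap f\<close> if \<open>U\<close> is \<open>Duplication\<close>, by pull-back otherwise.\<close>

fun mono_scale :: "base_seq \<Rightarrow> label multiset \<Rightarrow> real" where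
  "mono_scale Duplication M = (\<Prod>a\<in>#M. wt a)"
| "mono_scale ZeroPadding M = (\<Prod>a\<in>#M. dwt a) / mfact M"

definition poly_of ::
  "base_seq \<Rightarrow> construction \<Rightarrow> nat \<Rightarrow> nat \<Rightarrow> (label multiset \<Rightarrow> real) \<Rightarrow> polyfun" where
  "poly_of U F n d c = (\<lambda>x. \<Sum>M\<in>mons F n d. c M * (mono_scale U M * (\<Prod>a\<in>#M. x a)))"

fun coef_map :: "base_seq \<Rightarrow> construction \<Rightarrow> nat \<Rightarrow> nat \<Rightarrow> (nat \<Rightarrow> nat) \<Rightarrow>
    (label multiset \<Rightarrow> real) \<Rightarrow> label multiset \<Rightarrow> real" where
  "coef_map Duplication F k d f c = (\<lambda>N. \<Sum>M\<in>{M \<in> mons F k d. mmap f M = N}. c M)"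
| "coef_map ZeroPadding F k d f c = (\<lambda>N. c (mmap f N))"

text \<open>\<open>poly_of\<close> reads \<open>c\<close> on \<open>mons F n d\<close> only; there
  the choice is unique by \<open>coef_rep\<close>, elsewhere the value is arbitrary.\<close>

definition coef ::
  "base_seq \<Rightarrow> construction \<Rightarrow> nat \<Rightarrow> nat \<Rightarrow> polyfun \<Rightarrow> label multiset \<Rightarrow> real" where
  "coef U F n d q = (SOME c. q = poly_of U F n d c)"

lemma finite_mons: "finite (mons F n d)"
proof -
  have "mons F n d = (\<Union>k\<le>d. {M. set_mset M \<subseteq> labels F n \<and> size M = k})"
    by (auto simp: mons_def)
  then show ?thesis by (auto intro: finite_multisets_subset finite_labels)
qed

lemma empty_in_mons: "{#} \<in> mons F n d"
  by (simp add: mons_def)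

lemma mono_scale_pos: "0 < mono_scale U M"
  by (cases U) (auto intro!: prod_mset_pos divide_pos_pos)

lemma mmap_mmap: "mmap f (mmap g M) = mmap (f \<circ> g) M"
  by (simp add: multiset.map_comp o_def lmap_lmap)

lemma mmap_cong:
  "(\<And>i a. a \<in># M \<Longrightarrow> i \<in> lsupp a \<Longrightarrow> f i = g i) \<Longrightarrow> mmap f M = mmap g M"
  by (intro image_mset_cong lmap_cong)

lemma mmap_idI:
  assumes "\<And>i a. a \<in># M \<Longrightarrow> i \<in> lsupp a \<Longrightarrow> f i = i"
  shows "mmap f M = M"
proof -
  have "mmap f M = image_mset (\<lambda>a. a) M"
    using assms by (intro image_mset_cong lmap_idI)
  then show ?thesis by simp
qed

lemma mmap_mons: "M \<in> mons F m d \<Longrightarrow> f ` {1..m} \<subseteq> {1..n} \<Longrightarrow> mmap f M \<in> mons F n d"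
  unfolding mons_def using lmap_labels_image[of f m n _ F] by auto

lemma mons_lsupp: "M \<in> mons F n d \<Longrightarrow> a \<in># M \<Longrightarrow> lsupp a \<subseteq> {1..n}"
  unfolding mons_def by (auto intro: lsupp_labels[THEN subsetD])

lemma mono_scale_mmap_inj: "inj f \<Longrightarrow> mono_scale U (mmap f M) = mono_scale U M"
proof -
  assume f: "inj f"
  have "mfact (mmap f M) = mfact M"
    using inj_lmap[OF f] by (intro mfact_image_inj) (rule inj_on_subset[OF _ subset_UNIV])
  with f show ?thesis
    by (cases U) (auto simp: multiset.map_comp o_def wt_lmap_inj dwt_lmap_inj)
qed

lemma polys_eq_rep: "polys F n d = range (poly_of U F n d)"
proof (intro equalityI subsetI)
  fix q assume "q \<in> polys F n d"
  then obtain c where q: "q = (\<lambda>x. \<Sum>M\<in>mons F n d. c M * (\<Prod>a\<in>#M. x a))"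
    by (auto simp: polys_def mons_def)
  have "q = poly_of U F n d (\<lambda>M. c M / mono_scale U M)"
    unfolding q poly_of_def using less_imp_neq[OF mono_scale_pos[of U]] by (auto intro!: sum.cong)
  then show "q \<in> range (poly_of U F n d)" by blast
next
  fix q assume "q \<in> range (poly_of U F n d)"
  then obtain c where "q = poly_of U F n d c" by blast
  then have "q = (\<lambda>x. \<Sum>M\<in>mons F n d. (c M * mono_scale U M) * (\<Prod>a\<in>#M. x a))"
    by (simp add: poly_of_def mult.assoc)
  then show "q \<in> polys F n d" unfolding polys_def mem_Collect_eq mons_def[symmetric]
    by (rule exI[of _ "\<lambda>M. c M * mono_scale U M"])
qed

lemma rep_in_polys: "poly_of U F n d c \<in> polys F n d"
  unfolding polys_eq_rep[of _ _ _ U] by blast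

lemma rep_coef: "q \<in> polys F n d \<Longrightarrow> poly_of U F n d (coef U F n d q) = q"
proof -
  assume "q \<in> polys F n d"
  then obtain c where "q = poly_of U F n d c" by (auto simp: polys_eq_rep[of _ _ _ U])
  then have "q = poly_of U F n d (SOME c. q = poly_of U F n d c)" by (rule someI[of "\<lambda>c. q = poly_of U F n d c"])
  then show ?thesis by (simp add: coef_def)
qed

lemma rep_cong: "(\<And>M. M \<in> mons F n d \<Longrightarrow> c M = c' M) \<Longrightarrow> poly_of U F n d c = poly_of U F n d c'"
  by (simp add: poly_of_def)

lemma rep_inject_on_space:
  assumes eq: "\<And>x. x \<in> space_of F n \<Longrightarrow> poly_of U F n d c x = poly_of U F n d c' x"
    and M: "M \<in> mons F n d"
  shows "c M = c' M"
proof -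
  have "(c M - c' M) * mono_scale U M = 0"
  proof (rule monomials_independent[where A = "labels F n" and S = "mons F n d"
        and c = "\<lambda>M. (c M - c' M) * mono_scale U M"])
    fix x :: vec assume "\<And>a. a \<notin> labels F n \<Longrightarrow> x a = 0"
    then have "poly_of U F n d c x = poly_of U F n d c' x" by (intro eq) (simp add: space_of_def)
    then show "(\<Sum>M\<in>mons F n d. (c M - c' M) * mono_scale U M * (\<Prod>a\<in>#M. x a)) = 0"
      by (simp add: poly_of_def left_diff_distrib sum_subtractf mult.assoc)
  qed (use M in \<open>auto intro: finite_labels finite_mons, auto simp: mons_def\<close>)
  with mono_scale_pos[of U M] show ?thesis by simp
qed

lemma coef_rep: "M \<in> mons F n d \<Longrightarrow> coef U F n d (poly_of U F n d c) M = c M"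
  by (rule rep_inject_on_space[of F n U d]) (simp_all add: rep_coef rep_in_polys)

lemma polys_eqI:
  assumes "p \<in> polys F n d" "q \<in> polys F n d" "\<And>x. x \<in> space_of F n \<Longrightarrow> p x = q x"
  shows "p = q"
proof -
  have "coef Duplication F n d p M = coef Duplication F n d q M" if "M \<in> mons F n d" for M
    using assms that by (intro rep_inject_on_space[of F n Duplication d]) (simp_all add: rep_coef)
  then have "poly_of Duplication F n d (coef Duplication F n d p) =
      poly_of Duplication F n d (coef Duplication F n d q)" by (rule rep_cong)
  then show ?thesis using assms(1,2) by (simp add: rep_coef)
qed

lemma rep_linear:
  "poly_of U F n d (\<lambda>M. s * c M + t * c' M) = (\<lambda>x. s * poly_of U F n d c x + t * poly_of U F n d c' x)"
  by (simp add: poly_of_def fun_eq_iff sum_distrib_left sum.distrib[symmetric] algebra_simps)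

lemma polys_linear:
  "p \<in> polys F n d \<Longrightarrow> q \<in> polys F n d \<Longrightarrow> (\<lambda>x. s * p x + t * q x) \<in> polys F n d"
  using rep_in_polys[of Duplication F n d "\<lambda>M. s * coef Duplication F n d p M + t * coef Duplication F n d q M"]
  by (simp add: rep_linear rep_coef)

lemma coef_linear:
  assumes "p \<in> polys F n d" "q \<in> polys F n d" "M \<in> mons F n d"
  shows "coef U F n d (\<lambda>x. s * p x + t * q x) M = s * coef U F n d p M + t * coef U F n d q M"
proof -
  have "(\<lambda>x. s * p x + t * q x) =
      poly_of U F n d (\<lambda>M. s * coef U F n d p M + t * coef U F n d q M)"
    using assms by (simp add: rep_linear rep_coef)
  then show ?thesis using assms(3) by (simp add: coef_rep)
qed

lemma zero_in_polys: "(\<lambda>x. 0) \<in> polys F n d"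
  using rep_in_polys[of Duplication F n d "\<lambda>_. 0"] by (simp add: poly_of_def)

lemma polys_sum:
  "(\<And>j. j \<in> J \<Longrightarrow> q j \<in> polys F n d) \<Longrightarrow> (\<lambda>x. \<Sum>j\<in>J. q j x) \<in> polys F n d"
proof (induction J rule: infinite_finite_induct)
  case (insert j J)
  then have "(\<lambda>x. 1 * q j x + 1 * (\<Sum>j\<in>J. q j x)) \<in> polys F n d" by (intro polys_linear) auto
  with insert show ?case by simp
qed (auto simp: zero_in_polys)

lemma polys_scale: "q \<in> polys F n d \<Longrightarrow> (\<lambda>x. s * q x) \<in> polys F n d"
  using polys_linear[of q F n d q s 0] by simp

text \<open>Under a pull-back a monomial becomes a single monomial, so coefficients are pushed
  forward. Under a push-forward each variable becomes a sum over a fibre; the division by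
  \<open>mfact\<close> in \<open>mono_scale\<close> absorbs the multinomial factors of
  \<open>prod_mset_sum_fiber\<close>, and coefficients are pulled back.\<close>

lemma rep_dmap:
  assumes "f \<in> homs U k n"
  shows "poly_of U F k d c (dmap U F k n f x) = poly_of U F n d (coef_map U F k d f c) x"
proof (cases U)
  case Duplication
  with assms have f: "f ` {1..k} \<subseteq> {1..n}" by (auto simp: homs_def)
  have "poly_of U F k d c (dmap U F k n f x) =
      (\<Sum>M\<in>mons F k d. c M * (mono_scale U (mmap f M) * (\<Prod>a\<in>#mmap f M. x a)))"
    unfolding poly_of_def
  proof (rule sum.cong[OF refl])
    fix M assume M: "M \<in> mons F k d"
    have "mono_scale U M * (\<Prod>a\<in>#M. dmap U F k n f x a) = (\<Prod>a\<in>#M. wt (lmap f a) * x (lmap f a))"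
      unfolding Duplication dmap.simps mono_scale.simps prod_mset_mult[symmetric]
      using M by (intro prod_mset_cong) (auto simp: vpull_def mons_def)
    then show "c M * (mono_scale U M * (\<Prod>a\<in>#M. dmap U F k n f x a)) =
        c M * (mono_scale U (mmap f M) * (\<Prod>a\<in>#mmap f M. x a))"
      by (simp add: Duplication multiset.map_comp o_def prod_mset_mult)
  qed
  also have "\<dots> = (\<Sum>N\<in>mons F n d. \<Sum>M\<in>{M \<in> mons F k d. mmap f M = N}.
      c M * (mono_scale U (mmap f M) * (\<Prod>a\<in>#mmap f M. x a)))"
    using mmap_mons[OF _ f] by (intro sum.group[symmetric] finite_mons) auto
  also have "\<dots> = poly_of U F n d (coef_map U F k d f c) x"
    unfolding poly_of_def by (intro sum.cong refl) (auto simp: Duplication sum_distrib_right)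
  finally show ?thesis .
next
  case ZeroPadding
  with assms have f: "f ` {1..n} \<subseteq> {1..k}" by (auto simp: homs_def)
  let ?Z = "\<lambda>b. dwt b * x b"
  have "poly_of U F k d c (dmap U F k n f x) =
      (\<Sum>M\<in>mons F k d. \<Sum>N\<in>{N. set_mset N \<subseteq> labels F n \<and> mmap f N = M}.
        c M / mfact M * (mfact M / mfact N * (\<Prod>b\<in>#N. ?Z b)))"
    unfolding poly_of_def
  proof (rule sum.cong[OF refl])
    fix M assume M: "M \<in> mons F k d"
    have "(\<Prod>a\<in>#M. dwt a) * (\<Prod>a\<in>#M. dmap U F k n f x a) =
        (\<Prod>a\<in>#M. \<Sum>b\<in>{b \<in> labels F n. lmap f b = a}. ?Z b)"
      unfolding ZeroPadding dmap.simps prod_mset_mult[symmetric]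
      using M by (intro prod_mset_cong) (auto simp: vpush_def mons_def)
    also have "\<dots> = (\<Sum>N\<in>{N. set_mset N \<subseteq> labels F n \<and> mmap f N = M}.
        mfact M / mfact N * (\<Prod>b\<in>#N. ?Z b))"
      by (rule prod_mset_sum_fiber[OF finite_labels])
    finally have *: "(\<Prod>a\<in>#M. dwt a) * (\<Prod>a\<in>#M. dmap U F k n f x a) =
      (\<Sum>N\<in>{N. set_mset N \<subseteq> labels F n \<and> mmap f N = M}. mfact M / mfact N * (\<Prod>b\<in>#N. ?Z b))" .
    have "c M * (mono_scale U M * (\<Prod>a\<in>#M. dmap U F k n f x a)) =
      c M / mfact M * ((\<Prod>a\<in>#M. dwt a) * (\<Prod>a\<in>#M. dmap U F k n f x a))"
      by (simp add: ZeroPadding)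
    then show "c M * (mono_scale U M * (\<Prod>a\<in>#M. dmap U F k n f x a)) =
      (\<Sum>N\<in>{N. set_mset N \<subseteq> labels F n \<and> mmap f N = M}.
        c M / mfact M * (mfact M / mfact N * (\<Prod>b\<in>#N. ?Z b)))"
      unfolding * by (simp add: sum_distrib_left)
  qed
  also have "\<dots> = (\<Sum>N\<in>mons F n d. c (mmap f N) / mfact (mmap f N) *
        (mfact (mmap f N) / mfact N * (\<Prod>b\<in>#N. ?Z b)))"
    unfolding mons_def using lmap_labels_image[OF f] finite_mons
    by (intro sum_multiset_fibers[where Q = "\<lambda>j. j \<le> d"]) (auto simp: mons_def)
  also have "\<dots> = poly_of U F n d (coef_map U F k d f c) x"
    unfolding poly_of_def by (intro sum.cong refl) (simp add: ZeroPadding prod_mset_mult)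
  finally show ?thesis .
qed

lemma dmap_polys: "q \<in> polys F k d \<Longrightarrow> f \<in> homs U k n \<Longrightarrow> (\<lambda>x. q (dmap U F k n f x)) \<in> polys F n d"
  using rep_dmap[of f U k n F d "coef U F k d q"] rep_in_polys[of U F n d] by (simp add: rep_coef)

lemma coef_dmap:
  "q \<in> polys F k d \<Longrightarrow> f \<in> homs U k n \<Longrightarrow> M \<in> mons F n d \<Longrightarrow>
    coef U F n d (\<lambda>x. q (dmap U F k n f x)) M = coef_map U F k d f (coef U F k d q) M"
  using rep_dmap[of f U k n F d "coef U F k d q"] coef_rep[of M F n d U] by (simp add: rep_coef)

text \<open>Both sides are polynomials in the coordinates from \<open>labels F n\<close>, so they
  agree everywhere once they agree on \<open>space_of F n\<close>. Invariance can then be used at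
  arbitrary arguments.\<close>

lemma polys_act_space:
  "q \<in> polys F n d \<Longrightarrow> \<sigma> permutes {1..n} \<Longrightarrow>
     (\<And>x. x \<in> space_of F n \<Longrightarrow> q (act F n \<sigma> x) = q x) \<Longrightarrow> q (act F n \<sigma> x) = q x"
proof -
  assume a: "q \<in> polys F n d" "\<sigma> permutes {1..n}"
    "\<And>x. x \<in> space_of F n \<Longrightarrow> q (act F n \<sigma> x) = q x"
  have "(\<lambda>x. q (act F n \<sigma> x)) = q"
  proof (rule polys_eqI)
    show "(\<lambda>x. q (act F n \<sigma> x)) \<in> polys F n d"
      unfolding act_eq_dmap[OF a(2), of F Duplication] using a
      by (intro dmap_polys pmap_homs)
  qed (use a in auto)
  then show ?thesis by metis
qed

lemma inv_polys_iff:
  "q \<in> inv_polys F n d \<longleftrightarrow>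
    q \<in> polys F n d \<and> (\<forall>\<sigma>. \<sigma> permutes {1..n} \<longrightarrow> (\<forall>x. q (act F n \<sigma> x) = q x))"
  unfolding inv_polys_def using polys_act_space by blast

lemma inv_polys_polys: "q \<in> inv_polys F n d \<Longrightarrow> q \<in> polys F n d"
  by (simp add: inv_polys_iff)

lemma inv_polys_act: "q \<in> inv_polys F n d \<Longrightarrow> \<sigma> permutes {1..n} \<Longrightarrow> q (act F n \<sigma> x) = q x"
  by (simp add: inv_polys_iff)

lemma inv_polys_linear:
  "p \<in> inv_polys F n d \<Longrightarrow> q \<in> inv_polys F n d \<Longrightarrow> (\<lambda>x. s * p x + t * q x) \<in> inv_polys F n d"
  by (simp add: inv_polys_iff polys_linear)

lemma inv_polys_zero: "(\<lambda>x. 0) \<in> inv_polys F n d"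
  by (simp add: inv_polys_iff zero_in_polys)

lemma bij_betw_mmap_mons:
  assumes s: "\<sigma> permutes {1..n}"
  shows "bij_betw (mmap \<sigma>) (mons F n d) (mons F n d)"
  by (rule bij_betw_byWitness[where f' = "mmap (inv_into UNIV \<sigma>)"])
    (use permutes_image[OF s] permutes_image[OF permutes_inv[OF s]] permutes_inverses[OF s] in
      \<open>auto simp: mmap_mmap mmap_idI intro!: mmap_mons\<close>)

text \<open>Relabelling by a permutation preserves \<open>mono_scale\<close>, so comparing
  coefficients carries invariance over from the polynomial.\<close>

lemma coef_invariant:
  assumes q: "q \<in> inv_polys F n d" and s: "\<sigma> permutes {1..n}" and M: "M \<in> mons F n d"
  shows "coef U F n d q (mmap \<sigma> M) = coef U F n d q M"
proof -
  let ?c = "coef U F n d q" and ?i = "inv_into UNIV \<sigma>"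
  have inv: "\<sigma> (?i j) = j" "?i (\<sigma> j) = j" for j using permutes_inverses[OF s] by auto
  have "?c M = (\<lambda>M. ?c (mmap \<sigma> M)) M"
  proof (rule rep_inject_on_space[of F n U d ?c "\<lambda>M. ?c (mmap \<sigma> M)"])
    fix x :: vec
    have "poly_of U F n d ?c x = poly_of U F n d ?c (act F n \<sigma> x)"
      using q s by (simp add: rep_coef inv_polys_polys inv_polys_act)
    also have "\<dots> = (\<Sum>M\<in>mons F n d. ?c M * (mono_scale U M * (\<Prod>a\<in>#M. x (lmap ?i a))))"
      unfolding poly_of_def
      by (intro sum.cong refl arg_cong2[where f = "(*)"] prod_mset_cong)
        (auto simp: act_apply[OF s] mons_def)
    also have "\<dots> = (\<Sum>M\<in>mons F n d.
        ?c (mmap \<sigma> M) * (mono_scale U (mmap \<sigma> M) * (\<Prod>a\<in>#mmap \<sigma> M. x (lmap ?i a))))"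
      by (rule sum.reindex_bij_betw[OF bij_betw_mmap_mons[OF s], symmetric])
    also have "\<dots> = poly_of U F n d (\<lambda>M. ?c (mmap \<sigma> M)) x"
      unfolding poly_of_def
      by (intro sum.cong refl)
        (simp add: mono_scale_mmap_inj[OF permutes_inj[OF s]] multiset.map_comp o_def lmap_lmap inv lmap_ident)
    finally show "poly_of U F n d ?c x = poly_of U F n d (\<lambda>M. ?c (mmap \<sigma> M)) x" .
  qed (rule M)
  then show ?thesis by simp
qed

section \<open>Norms on coefficients\<close>

fun nrm :: "base_seq \<Rightarrow> construction \<Rightarrow> nat \<Rightarrow> nat \<Rightarrow> polyfun \<Rightarrow> real" where
  "nrm Duplication F n d q = (\<Sum>M\<in>mons F n d. \<bar>coef Duplication F n d q M\<bar>)"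
| "nrm ZeroPadding F n d q = Max ((\<lambda>M. \<bar>coef ZeroPadding F n d q M\<bar>) ` mons F n d)"

lemma nrm_ZeroPadding_le_iff:
  "nrm ZeroPadding F n d q \<le> B \<longleftrightarrow> (\<forall>M\<in>mons F n d. \<bar>coef ZeroPadding F n d q M\<bar> \<le> B)"
  using empty_in_mons by (subst nrm.simps, subst Max_le_iff) (auto simp: finite_mons)

lemma coef_le_nrm: "M \<in> mons F n d \<Longrightarrow> \<bar>coef U F n d q M\<bar> \<le> nrm U F n d q"
proof (cases U)
  case Duplication
  assume "M \<in> mons F n d"
  then show ?thesis
    unfolding Duplication nrm.simps
    by (intro member_le_sum[where f = "\<lambda>M. \<bar>coef Duplication F n d q M\<bar>"] finite_mons) auto
next
  case ZeroPadding
  assume "M \<in> mons F n d"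
  then show ?thesis unfolding ZeroPadding using nrm_ZeroPadding_le_iff by blast
qed

lemma nrm_nonneg: "0 \<le> nrm U F n d q"
  using coef_le_nrm[OF empty_in_mons, of U F n d q] by linarith

lemma nrm_eq_0D:
  assumes "q \<in> polys F n d" "nrm U F n d q = 0"
  shows "q = (\<lambda>x. 0)"
proof -
  have "coef U F n d q M = 0" if "M \<in> mons F n d" for M
    using coef_le_nrm[OF that, of U q] assms(2) by simp
  then have "poly_of U F n d (coef U F n d q) = (\<lambda>x. 0)" by (simp add: poly_of_def)
  then show ?thesis using assms(1) by (simp add: rep_coef)
qed

lemma nrm_linear:
  assumes "p \<in> polys F n d" "q \<in> polys F n d"
  shows "nrm U F n d (\<lambda>x. s * p x + t * q x) \<le> \<bar>s\<bar> * nrm U F n d p + \<bar>t\<bar> * nrm U F n d q"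
proof -
  let ?c = "coef U F n d"
  have le: "\<bar>?c (\<lambda>x. s * p x + t * q x) M\<bar> \<le> \<bar>s\<bar> * \<bar>?c p M\<bar> + \<bar>t\<bar> * \<bar>?c q M\<bar>"
    if "M \<in> mons F n d" for M
    using assms that abs_triangle_ineq[of "s * ?c p M" "t * ?c q M"]
    by (simp add: coef_linear abs_mult)
  show ?thesis
  proof (cases U)
    case Duplication
    then show ?thesis
      using sum_mono[OF le] by (simp add: sum.distrib sum_distrib_left)
  next
    case ZeroPadding
    have "\<bar>?c (\<lambda>x. s * p x + t * q x) M\<bar> \<le> \<bar>s\<bar> * nrm U F n d p + \<bar>t\<bar> * nrm U F n d q"
      if "M \<in> mons F n d" for M
      using le[OF that] coef_le_nrm[OF that, of U]
      by (meson abs_ge_zero add_mono mult_left_mono order_trans)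
    then show ?thesis unfolding ZeroPadding nrm_ZeroPadding_le_iff by blast
  qed
qed

lemma nrm_scale: "q \<in> polys F n d \<Longrightarrow> nrm U F n d (\<lambda>x. s * q x) \<le> \<bar>s\<bar> * nrm U F n d q"
  using nrm_linear[of q F n d q U s 0] by simp

lemma nrm_zero: "nrm U F n d (\<lambda>x. 0) = 0"
  using nrm_scale[OF zero_in_polys, of U F n d 0] nrm_nonneg[of U F n d "\<lambda>x. 0"] by simp

lemma nrm_sum:
  "(\<And>j. j \<in> J \<Longrightarrow> q j \<in> polys F n d) \<Longrightarrow>
    nrm U F n d (\<lambda>x. \<Sum>j\<in>J. q j x) \<le> (\<Sum>j\<in>J. nrm U F n d (q j))"
proof (induction J rule: infinite_finite_induct)
  case (insert j J)
  have "nrm U F n d (\<lambda>x. 1 * q j x + 1 * (\<Sum>j\<in>J. q j x)) \<le>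
      \<bar>1\<bar> * nrm U F n d (q j) + \<bar>1\<bar> * nrm U F n d (\<lambda>x. \<Sum>j\<in>J. q j x)"
    using insert by (intro nrm_linear polys_sum) auto
  with insert show ?case by simp
qed (auto simp: nrm_zero)

lemma nrm_dmap:
  assumes q: "q \<in> polys F k d" and f: "f \<in> homs U k n"
  shows "nrm U F n d (\<lambda>x. q (dmap U F k n f x)) \<le> nrm U F k d q"
proof (cases U)
  case Duplication
  with f have f': "f ` {1..k} \<subseteq> {1..n}" by (auto simp: homs_def)
  have "nrm U F n d (\<lambda>x. q (dmap U F k n f x)) =
      (\<Sum>N\<in>mons F n d. \<bar>\<Sum>M\<in>{M \<in> mons F k d. mmap f M = N}. coef U F k d q M\<bar>)"
    using coef_dmap[OF q f] by (simp add: Duplication)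
  also have "\<dots> \<le> (\<Sum>N\<in>mons F n d. \<Sum>M\<in>{M \<in> mons F k d. mmap f M = N}. \<bar>coef U F k d q M\<bar>)"
    by (intro sum_mono sum_abs)
  also have "\<dots> = nrm U F k d q"
    unfolding Duplication nrm.simps using mmap_mons[OF _ f'] by (intro sum.group finite_mons) auto
  finally show ?thesis .
next
  case ZeroPadding
  with f have f': "f ` {1..n} \<subseteq> {1..k}" by (auto simp: homs_def)
  have "\<bar>coef U F n d (\<lambda>x. q (dmap U F k n f x)) M\<bar> \<le> nrm U F k d q" if "M \<in> mons F n d" for M
    using coef_dmap[OF q f that] coef_le_nrm[OF mmap_mons[OF that f'], of U q]
    by (simp add: ZeroPadding del: nrm.simps)
  then show ?thesis unfolding ZeroPadding nrm_ZeroPadding_le_iff by blast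
qed

section \<open>Averaging over random maps\<close>

lemma index_le_pos: "index_le U n N \<Longrightarrow> 1 \<le> n \<and> 1 \<le> N"
  by (cases U) auto

lemma permutes_fiber:
  assumes "s permutes A" "j \<in> A"
  shows "{i \<in> A. s i = j} = {inv_into UNIV s j}"
  using assms permutes_inverses[OF assms(1)] permutes_in_image[OF permutes_inv[OF assms(1)], of j]
  by auto

text \<open>A random map followed by the block map, or restricted to the smaller set, is again
  uniformly random. This makes de Finetti sequences consistent with the embeddings.\<close>

lemma average_emap:
  assumes "index_le U n N" "1 \<le> k"
  shows "(\<Sum>f\<in>ehoms U k N. Q (restrict (hcomp U f (emap U N n)) {1..src U k n})) / card (ehoms U k N) =
    (\<Sum>f\<in>ehoms U k n. Q f) / card (ehoms U k n)"
proof (cases U)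
  case Duplication
  with assms have n: "1 \<le> n" "1 \<le> N" "n dvd N" by auto
  then have "0 < N div n" by (auto simp: div_greater_zero_iff dvd_imp_le)
  then show ?thesis
    unfolding Duplication ehoms_def hcomp.simps emap.simps src.simps tgt.simps
    using block_range[OF n] card_block_fiber[OF n] by (intro average_postcompose) auto
next
  case ZeroPadding
  with assms show ?thesis
    unfolding ZeroPadding ehoms_def hcomp.simps emap.simps src.simps tgt.simps
    by (intro average_precompose) auto
qed

lemma average_permutation:
  assumes "s permutes {1..n}" "1 \<le> k"
  shows "(\<Sum>f\<in>ehoms U k n. Q (restrict (hcomp U f s) {1..src U k n})) / card (ehoms U k n) =
    (\<Sum>f\<in>ehoms U k n. Q f) / card (ehoms U k n)"
proof (cases U)
  case Duplication
  show ?thesis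
    unfolding Duplication ehoms_def hcomp.simps src.simps tgt.simps
    by (rule average_postcompose[where t = 1])
      (use permutes_image[OF assms(1)] permutes_fiber[OF assms(1)] in auto)
next
  case ZeroPadding
  with assms show ?thesis
    unfolding ZeroPadding ehoms_def hcomp.simps src.simps tgt.simps
    by (intro average_precompose) (auto simp: permutes_image permutes_inj_on)
qed

text \<open>The mirror image of \<open>average_emap\<close> for the second sequence, where inclusion
  and block map have changed places; the permutation does not affect the law.\<close>

lemma average_emap_other:
  assumes "index_le (other U) k N" "1 \<le> n" and s: "s permutes {1..N}"
  shows "(\<Sum>f\<in>ehoms U N n. Q (restrict (hcomp U (hcomp U (emap (other U) N k) s) f) {1..src U k n})) /
      card (ehoms U N n) =
    (\<Sum>f\<in>ehoms U k n. Q f) / card (ehoms U k n)"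
proof (cases U)
  case Duplication
  with assms have k: "k \<le> N" by auto
  have "s ` {1..k} \<subseteq> s ` {1..N}" using k by (intro image_mono) auto
  then show ?thesis
    unfolding Duplication ehoms_def hcomp.simps emap.simps src.simps tgt.simps other.simps
    using assms(2) permutes_image[OF s]
    by (intro average_precompose) (auto simp: permutes_inj_on[OF s] o_def)
next
  case ZeroPadding
  with assms have k: "1 \<le> k" "1 \<le> N" "k dvd N" by auto
  then have pos: "0 < N div k" by (auto simp: div_greater_zero_iff dvd_imp_le)
  \<comment> \<open>\<open>s\<close> maps this fibre bijectively onto a fibre of the block
    map.\<close>
  have fib: "card {i \<in> {1..N}. (block N k \<circ> s) i = j} = N div k" if "j \<in> {1..k}" for j
  proof -
    have "s ` {i \<in> {1..N}. (block N k \<circ> s) i = j} = {i \<in> {1..N}. block N k i = j}"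
    proof (intro equalityI subsetI)
      fix i assume i: "i \<in> {i \<in> {1..N}. block N k i = j}"
      then obtain i' where "i' \<in> {1..N}" "i = s i'" using permutes_image[OF s] by blast
      with i show "i \<in> s ` {i \<in> {1..N}. (block N k \<circ> s) i = j}" by auto
    qed (use permutes_in_image[OF s] in auto)
    then have "card {i \<in> {1..N}. (block N k \<circ> s) i = j} = card {i \<in> {1..N}. block N k i = j}"
      using card_image[OF permutes_inj_on[OF s], of "{i \<in> {1..N}. (block N k \<circ> s) i = j}"] by simp
    with card_block_fiber[OF k that] show ?thesis by simp
  qed
  have "(block N k \<circ> s) ` {1..N} \<subseteq> {1..k}"
    unfolding image_comp[symmetric] permutes_image[OF s] by (rule block_range[OF k])
  then show ?thesis
    unfolding ZeroPadding ehoms_def hcomp.simps emap.simps src.simps tgt.simps other.simps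
    using pos fib by (intro average_postcompose) auto
qed

lemma de_finetti_embed:
  assumes "index_le U n N" "1 \<le> k"
  shows "de_finetti_seq U F k q N (embed U F N n x) = de_finetti_seq U F k q n x"
proof -
  have n: "1 \<le> n" "1 \<le> N" using index_le_pos[OF assms(1)] by auto
  have "q (dmap U F k N f (dmap U F N n (emap U N n) x)) =
      q (dmap U F k n (restrict (hcomp U f (emap U N n)) {1..src U k n}) x)"
    if "f \<in> ehoms U k N" for f
    using dmap_dmap[OF ehoms_subset_homs[OF that] emap_homs[OF assms(1)], of F x]
    by (simp add: dmap_restrict)
  then show ?thesis
    using average_emap[OF assms, of "\<lambda>f. q (dmap U F k n f x)"] assms(2) n
    by (simp add: de_finetti_seq_eq embed_eq_dmap[OF assms(1)])
qed

lemma de_finetti_linear: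
  assumes "1 \<le> k" "1 \<le> n"
  shows "de_finetti_seq U F k (\<lambda>x. s * p x + t * q x) n =
    (\<lambda>x. s * de_finetti_seq U F k p n x + t * de_finetti_seq U F k q n x)"
  using assms
  by (simp add: fun_eq_iff de_finetti_seq_eq sum.distrib sum_distrib_left add_divide_distrib)

lemma de_finetti_polys:
  assumes "1 \<le> k" "1 \<le> n" "q \<in> polys F k d"
  shows "de_finetti_seq U F k q n \<in> polys F n d"
proof -
  have eq: "de_finetti_seq U F k q n =
      (\<lambda>x. (1 / card (ehoms U k n)) * (\<Sum>f\<in>ehoms U k n. q (dmap U F k n f x)))"
    using assms by (simp add: fun_eq_iff de_finetti_seq_eq)
  show ?thesis
    unfolding eq using assms by (intro polys_scale polys_sum dmap_polys ehoms_subset_homs)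
qed

text \<open>The averaging itself symmetrises: composing a uniformly random map with a permutation
  does not change its law.\<close>

lemma de_finetti_inv_polys:
  assumes "1 \<le> k" "1 \<le> n" "q \<in> polys F k d"
  shows "de_finetti_seq U F k q n \<in> inv_polys F n d"
  unfolding inv_polys_iff
proof (intro conjI allI impI)
  fix \<sigma> x assume s: "\<sigma> permutes {1..n}"
  have "q (dmap U F k n f (dmap U F n n (pmap U \<sigma>) x)) =
      q (dmap U F k n (restrict (hcomp U f (pmap U \<sigma>)) {1..src U k n}) x)"
    if "f \<in> ehoms U k n" for f
    using dmap_dmap[OF ehoms_subset_homs[OF that] pmap_homs[OF s], of F x]
    by (simp add: dmap_restrict)
  then show "de_finetti_seq U F k q n (act F n \<sigma> x) = de_finetti_seq U F k q n x"
    using average_permutation[OF pmap_permutes[OF s] assms(1), where U = U and Q = "\<lambda>f. q (dmap U F k n f x)"] assms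
    by (simp add: de_finetti_seq_eq act_eq_dmap[OF s, of F U])
qed (use assms de_finetti_polys in blast)

lemma sym_map_eq:
  assumes "index_le (other U) k N"
  shows "sym_map (other U) F N k q x = (1 / fact N) *
    (\<Sum>\<sigma>\<in>{\<sigma>. \<sigma> permutes {1..N}}. q (dmap U F k N (hcomp U (emap (other U) N k) (pmap U \<sigma>)) x))"
  unfolding sym_map_def
proof (intro arg_cong2[where f = "(*)"] sum.cong refl)
  fix \<sigma> assume "\<sigma> \<in> {\<sigma>. \<sigma> permutes {1..N}}"
  then show "q (embed_adj (other U) F N k (act F N \<sigma> x)) =
      q (dmap U F k N (hcomp U (emap (other U) N k) (pmap U \<sigma>)) x)"
    using dmap_dmap[OF emap_other_homs[OF assms] pmap_homs[of \<sigma>], of F x]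
    by (simp add: embed_adj_eq_dmap[OF assms] act_eq_dmap[of \<sigma> N F U])
qed

lemma sym_map_inv_polys:
  assumes "index_le (other U) k N" "q \<in> polys F k d"
  shows "sym_map (other U) F N k q \<in> inv_polys F N d"
  unfolding inv_polys_iff
proof (intro conjI allI impI)
  have eq: "sym_map (other U) F N k q = (\<lambda>x. (1 / fact N) *
    (\<Sum>\<sigma>\<in>{\<sigma>. \<sigma> permutes {1..N}}. q (dmap U F k N (hcomp U (emap (other U) N k) (pmap U \<sigma>)) x)))"
    using sym_map_eq[OF assms(1)] by (simp add: fun_eq_iff)
  show "sym_map (other U) F N k q \<in> polys F N d"
    unfolding eq using assms
    by (intro polys_scale polys_sum dmap_polys hcomp_homs[OF emap_other_homs] pmap_homs) auto
  fix \<tau> x assume t: "\<tau> permutes {1..N}"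
  have "(\<Sum>\<sigma>\<in>{\<sigma>. \<sigma> permutes {1..N}}. q (embed_adj (other U) F N k (act F N \<sigma> (act F N \<tau> x)))) =
      (\<Sum>\<sigma>\<in>{\<sigma>. \<sigma> permutes {1..N}}. q (embed_adj (other U) F N k (act F N (\<sigma> \<circ> \<tau>) x)))"
    using t by (simp add: act_act)
  also have "\<dots> = (\<Sum>\<sigma>\<in>{\<sigma>. \<sigma> permutes {1..N}}. q (embed_adj (other U) F N k (act F N \<sigma> x)))"
    by (rule sum_permutations_compose_right[OF t, symmetric])
  finally show "sym_map (other U) F N k q (act F N \<tau> x) = sym_map (other U) F N k q x"
    by (simp add: sym_map_def)
qed

lemma card_permutations_interval: "card {\<sigma>. \<sigma> permutes {1..N}} = fact N"
  using card_permutations[of "{1..N}" N] by simp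

text \<open>For each permutation, the random map to level N followed by the permutation and the
  adjoint embedding has the law of the random map to level k. Hence the de Finetti sequence depends
  only on the class in the direct limit.\<close>

lemma de_finetti_sym_map:
  assumes "index_le (other U) k N" "1 \<le> n"
  shows "de_finetti_seq U F N (sym_map (other U) F N k q) n = de_finetti_seq U F k q n"
proof
  fix x
  let ?P = "{\<sigma>. \<sigma> permutes {1..N}}" and ?b = "emap (other U) N k"
  have k: "1 \<le> k" "1 \<le> N" using index_le_pos[OF assms(1)] by auto
  have "de_finetti_seq U F N (sym_map (other U) F N k q) n x =
      (\<Sum>f\<in>ehoms U N n. (1 / fact N) *
        (\<Sum>\<sigma>\<in>?P. q (dmap U F k N (hcomp U ?b (pmap U \<sigma>)) (dmap U F N n f x)))) / card (ehoms U N n)"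
    using k assms(2) by (simp add: de_finetti_seq_eq sym_map_eq[OF assms(1)])
  also have "\<dots> = (1 / fact N) * (\<Sum>\<sigma>\<in>?P. (\<Sum>f\<in>ehoms U N n.
        q (dmap U F k N (hcomp U ?b (pmap U \<sigma>)) (dmap U F N n f x))) / card (ehoms U N n))"
    by (simp add: sum_divide_distrib sum_distrib_left) (rule sum.swap)
  also have "\<dots> = (1 / fact N) * (\<Sum>\<sigma>\<in>?P. de_finetti_seq U F k q n x)"
  proof (intro arg_cong2[where f = "(*)"] sum.cong refl)
    fix \<sigma> assume "\<sigma> \<in> ?P"
    then have s: "\<sigma> permutes {1..N}" by simp
    have "q (dmap U F k N (hcomp U ?b (pmap U \<sigma>)) (dmap U F N n f x)) =
        q (dmap U F k n (restrict (hcomp U (hcomp U ?b (pmap U \<sigma>)) f) {1..src U k n}) x)"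
      if "f \<in> ehoms U N n" for f
      using dmap_dmap[OF hcomp_homs[OF emap_other_homs[OF assms(1)] pmap_homs[OF s]]
          ehoms_subset_homs[OF that], of F x]
      by (simp add: dmap_restrict)
    then show "(\<Sum>f\<in>ehoms U N n. q (dmap U F k N (hcomp U ?b (pmap U \<sigma>)) (dmap U F N n f x))) /
        card (ehoms U N n) = de_finetti_seq U F k q n x"
      using average_emap_other[OF assms pmap_permutes[OF s], of "\<lambda>f. q (dmap U F k n f x)"] k assms(2)
      by (simp add: de_finetti_seq_eq)
  qed
  finally show "de_finetti_seq U F N (sym_map (other U) F N k q) n x = de_finetti_seq U F k q n x"
    using card_permutations_interval[of N] by simp
qed

lemma nrm_de_finetti:
  assumes "1 \<le> k" "1 \<le> n" "q \<in> polys F k d"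
  shows "nrm U F n d (de_finetti_seq U F k q n) \<le> nrm U F k d q"
proof -
  let ?E = "ehoms U k n"
  have eq: "de_finetti_seq U F k q n = (\<lambda>x. (1 / card ?E) * (\<Sum>f\<in>?E. q (dmap U F k n f x)))"
    using assms by (simp add: fun_eq_iff de_finetti_seq_eq)
  have pol: "(\<lambda>x. q (dmap U F k n f x)) \<in> polys F n d" if "f \<in> ?E" for f
    using assms that by (intro dmap_polys ehoms_subset_homs)
  have "nrm U F n d (de_finetti_seq U F k q n) \<le>
      \<bar>1 / card ?E\<bar> * nrm U F n d (\<lambda>x. \<Sum>f\<in>?E. q (dmap U F k n f x))"
    unfolding eq using pol by (intro nrm_scale polys_sum)
  also have "\<dots> \<le> \<bar>1 / card ?E\<bar> * (\<Sum>f\<in>?E. nrm U F n d (\<lambda>x. q (dmap U F k n f x)))"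
    using pol by (intro mult_left_mono nrm_sum) auto
  also have "\<dots> \<le> \<bar>1 / card ?E\<bar> * (\<Sum>f\<in>?E. nrm U F k d q)"
    using assms by (intro mult_left_mono sum_mono nrm_dmap ehoms_subset_homs) auto
  also have "\<dots> = nrm U F k d q"
    using card_ehoms_pos[OF assms(1,2), of U] by simp
  finally show ?thesis .
qed

lemma nrm_embed:
  assumes "index_le U n N" "q \<in> polys F N d"
  shows "nrm U F n d (\<lambda>x. q (embed U F N n x)) \<le> nrm U F N d q"
  unfolding embed_eq_dmap[OF assms(1)] using assms by (intro nrm_dmap emap_homs)

lemma embed_polys:
  assumes "index_le U n N" "q \<in> polys F N d"
  shows "(\<lambda>x. q (embed U F N n x)) \<in> polys F n d"
  unfolding embed_eq_dmap[OF assms(1)] using assms by (intro dmap_polys emap_homs)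

section \<open>Collision probabilities of random self-maps\<close>

lemma extend_inj_to_permutation:
  assumes "finite A" "S \<subseteq> A" "inj_on h S" "h ` S \<subseteq> A"
  obtains \<sigma> where "\<sigma> permutes A" "\<And>i. i \<in> S \<Longrightarrow> \<sigma> i = h i"
proof -
  have "card (A - S) = card (A - h ` S)"
    using assms by (simp add: card_Diff_subset finite_subset card_image)
  then obtain g where g: "bij_betw g (A - S) (A - h ` S)"
    using assms(1) finite_same_card_bij[of "A - S" "A - h ` S"] by auto
  define \<sigma> where "\<sigma> i = (if i \<in> S then h i else if i \<in> A then g i else i)" for i
  have "bij_betw \<sigma> S (h ` S) \<longleftrightarrow> bij_betw h S (h ` S)"
    "bij_betw \<sigma> (A - S) (A - h ` S) \<longleftrightarrow> bij_betw g (A - S) (A - h ` S)"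
    by (intro bij_betw_cong; simp add: \<sigma>_def)+
  then have "bij_betw \<sigma> S (h ` S)" "bij_betw \<sigma> (A - S) (A - h ` S)"
    using bij_betw_imageI[OF assms(3)] g by auto
  then have "bij_betw \<sigma> (S \<union> (A - S)) (h ` S \<union> (A - h ` S))"
    by (rule bij_betw_combine) auto
  then have "bij_betw \<sigma> A A" using assms(2,4) by (simp add: Un_absorb1)
  then have "\<sigma> permutes A" using assms(2) by (intro bij_imp_permutes) (auto simp: \<sigma>_def)
  then show ?thesis using that by (auto simp: \<sigma>_def)
qed

definition msupp :: "label multiset \<Rightarrow> nat set" where
  "msupp M = (\<Union>a\<in>set_mset M. lsupp a)"

lemma msupp_mons:
  assumes "M \<in> mons F n d"
  shows "msupp M \<subseteq> {1..n}" "card (msupp M) \<le> d * cdeg F"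
proof -
  show "msupp M \<subseteq> {1..n}" using mons_lsupp[OF assms] by (auto simp: msupp_def)
  have "card (msupp M) \<le> size M * cdeg F"
    unfolding msupp_def using assms
    by (intro card_UN_mset_le) (auto simp: mons_def finite_lsupp intro: card_lsupp_le)
  also have "\<dots> \<le> d * cdeg F" using assms by (intro mult_le_mono1) (simp add: mons_def)
  finally show "card (msupp M) \<le> d * cdeg F" .
qed

text \<open>An invariant function does not notice a map that is injective on the support, and a
  random map is injective there unless one of the few pairs of points collides.\<close>

lemma average_collision_bound:
  fixes u :: "label multiset \<Rightarrow> real" and \<epsilon> :: real
  assumes M: "M \<in> mons F k d"
    and inv: "\<And>\<sigma>. \<sigma> permutes {1..k} \<Longrightarrow> u (mmap \<sigma> M) = u M"
    and bound: "\<And>N. N \<in> mons F k d \<Longrightarrow> \<bar>u N\<bar> \<le> B"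
    and J: "finite J" and h: "\<And>j. j \<in> J \<Longrightarrow> h j ` {1..k} \<subseteq> {1..k}"
    and coll: "\<And>i l. i \<in> {1..k} \<Longrightarrow> l \<in> {1..k} \<Longrightarrow> i \<noteq> l \<Longrightarrow>
      card {j \<in> J. h j i = h j l} \<le> \<epsilon> * card J"
    and eps: "0 \<le> \<epsilon>"
  shows "\<bar>\<Sum>j\<in>J. u (mmap (h j) M) - u M\<bar> \<le> 2 * B * ((d * cdeg F)\<^sup>2 * \<epsilon> * card J)"
proof -
  let ?S = "msupp M"
  define bad where "bad = {j \<in> J. \<not> inj_on (h j) ?S}"
  define P where "P = {p \<in> ?S \<times> ?S. fst p \<noteq> snd p}"
  have S: "?S \<subseteq> {1..k}" "finite ?S" "card ?S \<le> d * cdeg F"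
    using msupp_mons[OF M] finite_subset by auto
  have zero: "u (mmap (h j) M) = u M" if "j \<in> J - bad" for j
  proof -
    have "inj_on (h j) ?S" "h j ` ?S \<subseteq> {1..k}" using that h S by (auto simp: bad_def)
    then obtain \<sigma> where \<sigma>: "\<sigma> permutes {1..k}" "\<And>i. i \<in> ?S \<Longrightarrow> \<sigma> i = h j i"
      using S(1) by (elim extend_inj_to_permutation[OF finite_atLeastAtMost, rotated]) auto
    have "mmap \<sigma> M = mmap (h j) M"
      by (intro mmap_cong \<sigma>(2)) (auto simp: msupp_def)
    then show ?thesis using inv[OF \<sigma>(1)] by simp
  qed
  have B: "\<bar>u (mmap (h j) M) - u M\<bar> \<le> 2 * B" if "j \<in> J" for j
    using bound[OF M] bound[OF mmap_mons[OF M h[OF that]]] by linarith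
  have B0: "0 \<le> B" using bound[OF M] by linarith
  have "real (card P) \<le> real ((d * cdeg F)\<^sup>2)"
  proof -
    have "card P \<le> card (?S \<times> ?S)" unfolding P_def using S by (intro card_mono) auto
    also have "\<dots> \<le> (d * cdeg F)\<^sup>2"
      using S by (simp add: card_cartesian_product power2_eq_square mult_le_mono)
    finally show ?thesis by linarith
  qed
  \<comment> \<open>Union bound over the ordered pairs of distinct points of the support.\<close>
  have "bad \<subseteq> (\<Union>p\<in>P. {j \<in> J. h j (fst p) = h j (snd p)})"
    by (auto simp: bad_def P_def inj_on_def)
  then have "card bad \<le> card (\<Union>p\<in>P. {j \<in> J. h j (fst p) = h j (snd p)})"
    using J S by (intro card_mono) (auto simp: P_def)
  also have "\<dots> \<le> (\<Sum>p\<in>P. card {j \<in> J. h j (fst p) = h j (snd p)})"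
    using S by (intro card_UN_le) (auto simp: P_def)
  finally have "real (card bad) \<le> (\<Sum>p\<in>P. real (card {j \<in> J. h j (fst p) = h j (snd p)}))"
    unfolding of_nat_sum[symmetric] of_nat_le_iff .
  also have "\<dots> \<le> (\<Sum>p\<in>P. \<epsilon> * card J)"
    using S(1) by (intro sum_mono coll) (auto simp: P_def)
  also have "\<dots> = card P * (\<epsilon> * card J)" by simp
  also have "\<dots> \<le> (d * cdeg F)\<^sup>2 * (\<epsilon> * card J)"
    using \<open>real (card P) \<le> _\<close> eps by (intro mult_right_mono) auto
  finally have card_bad: "card bad \<le> (d * cdeg F)\<^sup>2 * \<epsilon> * card J" by (simp add: mult.assoc)
  have "\<bar>\<Sum>j\<in>J. u (mmap (h j) M) - u M\<bar> = \<bar>\<Sum>j\<in>bad. u (mmap (h j) M) - u M\<bar>"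
    using J zero by (intro arg_cong[where f = abs] sum.mono_neutral_right) (auto simp: bad_def)
  also have "\<dots> \<le> (\<Sum>j\<in>bad. \<bar>u (mmap (h j) M) - u M\<bar>)" by (rule sum_abs)
  also have "\<dots> \<le> (\<Sum>j\<in>bad. 2 * B)" using B by (intro sum_mono) (auto simp: bad_def)
  also have "\<dots> = 2 * B * card bad" by simp
  also have "\<dots> \<le> 2 * B * ((d * cdeg F)\<^sup>2 * \<epsilon> * card J)"
    using card_bad B0 by (intro mult_left_mono) auto
  finally show ?thesis .
qed

text \<open>If \<open>f i = f l\<close>, the value at \<open>i\<close> is forced, so such maps
  correspond to maps on \<open>A - {i}\<close>. The product form avoids a division by
  \<open>card B\<close>.\<close>

lemma card_PiE_coincide:
  assumes "finite A" "finite B" "i \<in> A" "l \<in> A" "i \<noteq> l"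
  shows "card {f \<in> A \<rightarrow>\<^sub>E B. f i = f l} * card B = card (A \<rightarrow>\<^sub>E B)"
proof -
  have "bij_betw (\<lambda>f. restrict f (A - {i})) {f \<in> A \<rightarrow>\<^sub>E B. f i = f l} ((A - {i}) \<rightarrow>\<^sub>E B)"
  proof (rule bij_betw_byWitness[where f' = "\<lambda>g. g(i := g l)"])
    show "\<forall>f\<in>{f \<in> A \<rightarrow>\<^sub>E B. f i = f l}. (restrict f (A - {i}))(i := restrict f (A - {i}) l) = f"
      using assms by (auto simp: fun_eq_iff PiE_iff extensional_def)
    show "\<forall>g\<in>(A - {i}) \<rightarrow>\<^sub>E B. restrict (g(i := g l)) (A - {i}) = g"
      using assms by (auto simp: fun_eq_iff PiE_iff extensional_def)
    show "(\<lambda>f. restrict f (A - {i})) ` {f \<in> A \<rightarrow>\<^sub>E B. f i = f l} \<subseteq> (A - {i}) \<rightarrow>\<^sub>E B"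
      by (intro image_subsetI) (simp add: PiE_iff)
    show "(\<lambda>g. g(i := g l)) ` ((A - {i}) \<rightarrow>\<^sub>E B) \<subseteq> {f \<in> A \<rightarrow>\<^sub>E B. f i = f l}"
    proof (rule image_subsetI)
      fix g assume "g \<in> (A - {i}) \<rightarrow>\<^sub>E B"
      then have g: "j \<in> A \<Longrightarrow> j \<noteq> i \<Longrightarrow> g j \<in> B" "j \<notin> A \<Longrightarrow> g j = undefined" for j
        by (auto simp: PiE_iff extensional_def)
      have "g(i := g l) \<in> A \<rightarrow>\<^sub>E B"
        using g assms(3-5) by (intro PiE_I) auto
      then show "g(i := g l) \<in> {f \<in> A \<rightarrow>\<^sub>E B. f i = f l}" using assms(5) by simp
    qed
  qed
  then have "card {f \<in> A \<rightarrow>\<^sub>E B. f i = f l} = card B ^ card (A - {i})"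
    using assms by (simp add: bij_betw_same_card card_PiE)
  moreover have "card (A \<rightarrow>\<^sub>E B) = card B ^ Suc (card (A - {i}))"
    unfolding card.remove[OF assms(1,3), symmetric] using assms(1) by (simp add: card_PiE)
  ultimately show ?thesis by (simp only: power_Suc2)
qed

text \<open>Double counting. Swapping \<open>l\<close> with another point shows that the count does
  not depend on \<open>l\<close>; summed over all points other than \<open>i\<close> it counts, for
  each permutation, the \<open>k div n - 1\<close> other points landing in the block of
  \<open>\<sigma> i\<close>. So the probability is (k/n - 1)/(k - 1), at most 1/n.\<close>

lemma card_permutes_same_block:
  assumes "1 \<le> n" "1 \<le> k" "n dvd k" and i: "i \<in> {1..k}" "l \<in> {1..k}" "i \<noteq> l"
  shows "card {\<sigma>. \<sigma> permutes {1..k} \<and> block k n (\<sigma> i) = block k n (\<sigma> l)} * n \<le> fact k"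
proof -
  let ?g = "block k n" and ?P = "{\<sigma>. \<sigma> permutes {1..k}}"
  let ?N = "\<lambda>l. card {\<sigma> \<in> ?P. ?g (\<sigma> l) = ?g (\<sigma> i)}"
  have finP: "finite ?P" by (simp add: finite_permutations)
  have N: "?N l' = ?N l" if l': "l' \<in> {1..k} - {i}" for l'
  proof -
    let ?t = "Transposition.transpose l l'"
    have t: "?t permutes {1..k}" "?t i = i" "?t \<circ> ?t = id"
      using l' i by (auto simp: permutes_swap_id Transposition.transpose_def)
    have "bij_betw (\<lambda>\<sigma>. \<sigma> \<circ> ?t) {\<sigma> \<in> ?P. ?g (\<sigma> l') = ?g (\<sigma> i)} {\<sigma> \<in> ?P. ?g (\<sigma> l) = ?g (\<sigma> i)}"
      by (rule bij_betw_byWitness[where f' = "\<lambda>\<sigma>. \<sigma> \<circ> ?t"])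
        (use t in \<open>auto simp: comp_assoc intro!: permutes_compose\<close>)
    then show ?thesis by (rule bij_betw_same_card)
  qed
  have row: "card {l' \<in> {1..k} - {i}. ?g (\<sigma> l') = ?g (\<sigma> i)} = k div n - 1" if s: "\<sigma> \<in> ?P" for \<sigma>
  proof -
    have s: "\<sigma> permutes {1..k}" using s by simp
    have "?g (\<sigma> i) \<in> {1..n}"
      using block_range[OF assms(1-3)] permutes_in_image[OF s, of i] i by blast
    then have "card {j \<in> {1..k}. ?g j = ?g (\<sigma> i)} = k div n"
      by (rule card_block_fiber[OF assms(1-3)])
    moreover have "\<sigma> ` {l' \<in> {1..k}. ?g (\<sigma> l') = ?g (\<sigma> i)} = {j \<in> {1..k}. ?g j = ?g (\<sigma> i)}"
    proof (intro equalityI subsetI)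
      fix j assume j: "j \<in> {j \<in> {1..k}. ?g j = ?g (\<sigma> i)}"
      then obtain i' where "i' \<in> {1..k}" "j = \<sigma> i'" using permutes_image[OF s] by blast
      with j show "j \<in> \<sigma> ` {l' \<in> {1..k}. ?g (\<sigma> l') = ?g (\<sigma> i)}" by auto
    qed (use permutes_in_image[OF s] in auto)
    ultimately have "card {l' \<in> {1..k}. ?g (\<sigma> l') = ?g (\<sigma> i)} = k div n"
      using card_image[OF permutes_inj_on[OF s], of "{l' \<in> {1..k}. ?g (\<sigma> l') = ?g (\<sigma> i)}"] by simp
    moreover have "{l' \<in> {1..k} - {i}. ?g (\<sigma> l') = ?g (\<sigma> i)} =
        {l' \<in> {1..k}. ?g (\<sigma> l') = ?g (\<sigma> i)} - {i}" by auto
    ultimately show ?thesis using i by (simp add: card_Diff_singleton)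
  qed
  have "(\<Sum>l'\<in>{1..k} - {i}. ?N l') = (\<Sum>l'\<in>{1..k} - {i}. ?N l)"
    by (rule sum.cong[OF refl N])
  then have "(k - 1) * ?N l = (\<Sum>l'\<in>{1..k} - {i}. ?N l')"
    using i(1) by simp
  also have "\<dots> = (\<Sum>l'\<in>{1..k} - {i}. \<Sum>\<sigma>\<in>?P. if ?g (\<sigma> l') = ?g (\<sigma> i) then 1 else 0)"
    using finP by (simp add: sum.If_cases Int_def)
  also have "\<dots> = (\<Sum>\<sigma>\<in>?P. \<Sum>l'\<in>{1..k} - {i}. if ?g (\<sigma> l') = ?g (\<sigma> i) then 1 else 0)"
    by (rule sum.swap)
  also have "\<dots> = (\<Sum>\<sigma>\<in>?P. card {l' \<in> {1..k} - {i}. ?g (\<sigma> l') = ?g (\<sigma> i)})"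
    by (intro sum.cong refl) (simp add: sum.If_cases Int_def)
  also have "\<dots> = fact k * (k div n - 1)"
    using row card_permutations_interval[of k] by simp
  finally have "(k - 1) * ?N l = fact k * (k div n - 1)" .
  then have "(k - 1) * (?N l * n) = fact k * ((k div n - 1) * n)"
    by (simp only: mult.assoc[symmetric])
  also have "\<dots> = fact k * (k - n)"
    using assms(3) by (simp add: diff_mult_distrib)
  also have "\<dots> \<le> (k - 1) * fact k" using assms(1) by simp
  \<comment> \<open>\<open>i\<close> and \<open>l\<close> are distinct, so k is at least 2 and the
    factor \<open>k - 1\<close> cancels.\<close>
  finally have "?N l * n \<le> fact k" using i by (cases "k = 1") auto
  moreover have "{\<sigma>. \<sigma> permutes {1..k} \<and> ?g (\<sigma> i) = ?g (\<sigma> l)} = {\<sigma> \<in> ?P. ?g (\<sigma> l) = ?g (\<sigma> i)}"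
    by auto
  ultimately show ?thesis by simp
qed

lemma rep_sum: "poly_of U F n d (\<lambda>M. \<Sum>j\<in>J. c j M) x = (\<Sum>j\<in>J. poly_of U F n d (c j) x)"
  unfolding poly_of_def sum_distrib_right by (rule sum.swap)

text \<open>Either both points are sent into one block, with probability at most 1/n, or
  \<open>f\<close> merges two different blocks, with probability 1/k, which is at most 1/n.\<close>

lemma card_collisions_block:
  assumes "1 \<le> n" "1 \<le> k" "n dvd k" and i: "i \<in> {1..k}" "l \<in> {1..k}" "i \<noteq> l"
  shows "card {p \<in> ({1..n} \<rightarrow>\<^sub>E {1..k}) \<times> {\<sigma>. \<sigma> permutes {1..k}}.
        fst p (block k n (snd p i)) = fst p (block k n (snd p l))}
    \<le> 2 / real n * card (({1..n} \<rightarrow>\<^sub>E {1..k}) \<times> {\<sigma>. \<sigma> permutes {1..k}})"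
proof -
  let ?E = "{1..n} \<rightarrow>\<^sub>E {1..k}" and ?P = "{\<sigma>. \<sigma> permutes {1..k}}" and ?g = "block k n"
  let ?same = "{\<sigma> \<in> ?P. ?g (\<sigma> i) = ?g (\<sigma> l)}"
  have fin: "finite ?E" "finite ?P" by (auto intro: finite_PiE finite_permutations)
  have kn: "n \<le> k" using assms by (simp add: dvd_imp_le)
  have row: "real (card {f \<in> ?E. f (?g (\<sigma> i)) = f (?g (\<sigma> l))}) \<le>
      (if ?g (\<sigma> i) = ?g (\<sigma> l) then real (card ?E) else 0) + card ?E / n" if "\<sigma> \<in> ?P" for \<sigma>
  proof (cases "?g (\<sigma> i) = ?g (\<sigma> l)")
    case False
    have s: "\<sigma> permutes {1..k}" using that by simp
    have "?g (\<sigma> j) \<in> {1..n}" if "j \<in> {1..k}" for j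
      using block_range[OF assms(1-3)] permutes_in_image[OF s, of j] that by blast
    then have "card {f \<in> ?E. f (?g (\<sigma> i)) = f (?g (\<sigma> l))} * card {1..k} = card ?E"
      using False i by (intro card_PiE_coincide) auto
    then have "card {f \<in> ?E. f (?g (\<sigma> i)) = f (?g (\<sigma> l))} * k = card ?E" by simp
    then have "real (card {f \<in> ?E. f (?g (\<sigma> i)) = f (?g (\<sigma> l))}) * k = card ?E"
      unfolding of_nat_mult[symmetric] by (rule arg_cong)
    then have "real (card {f \<in> ?E. f (?g (\<sigma> i)) = f (?g (\<sigma> l))}) = card ?E / k"
      using assms(2) by (simp add: field_simps)
    also have "\<dots> \<le> card ?E / n" using kn assms by (intro divide_left_mono) auto
    finally show ?thesis using False by simp
  qed simp
  have "real (card {p \<in> ?E \<times> ?P. fst p (?g (snd p i)) = fst p (?g (snd p l))}) =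
      (\<Sum>p\<in>?E \<times> ?P. if fst p (?g (snd p i)) = fst p (?g (snd p l)) then 1 else 0)"
    using fin by (subst sum.inter_filter[symmetric]) auto
  also have "\<dots> = (\<Sum>\<sigma>\<in>?P. \<Sum>f\<in>?E. if f (?g (\<sigma> i)) = f (?g (\<sigma> l)) then 1 else 0)"
    by (subst sum.cartesian_product', subst sum.swap) simp
  also have "\<dots> = (\<Sum>\<sigma>\<in>?P. real (card {f \<in> ?E. f (?g (\<sigma> i)) = f (?g (\<sigma> l))}))"
    using fin by (intro sum.cong refl) (simp add: sum.inter_filter[symmetric])
  also have "\<dots> \<le> (\<Sum>\<sigma>\<in>?P. (if ?g (\<sigma> i) = ?g (\<sigma> l) then real (card ?E) else 0) + card ?E / n)"
    by (rule sum_mono[OF row])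
  also have "\<dots> = card ?same * card ?E + card ?P * (card ?E / n)"
    using fin by (simp add: sum.distrib sum.inter_filter[symmetric])
  also have "\<dots> \<le> (card ?P / n) * card ?E + card ?P * (card ?E / n)"
  proof -
    have "card ?same * n \<le> card ?P"
      using card_permutes_same_block[OF assms] card_permutations_interval[of k] by simp
    then have "real (card ?same) * n \<le> card ?P" unfolding of_nat_mult[symmetric] of_nat_le_iff .
    then have "real (card ?same) \<le> card ?P / n" using assms(1) by (simp add: field_simps)
    then have "real (card ?same) * card ?E \<le> card ?P / n * card ?E"
      by (rule mult_right_mono) simp
    then show ?thesis unfolding of_nat_mult by (rule add_right_mono)
  qed
  also have "\<dots> = 2 / n * card (?E \<times> ?P)" by (simp add: card_cartesian_product)
  finally show ?thesis .
qed

text \<open>A monomial involves at most \<open>d * cdeg F\<close> points, hence at most the square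
  of this many ordered pairs. Each pair collides with probability at most 2/n, and a collision costs
  at most twice the bound on the values; this makes the factor 4.\<close>

definition drift :: "construction \<Rightarrow> nat \<Rightarrow> real" where
  "drift F d = 4 * (d * cdeg F)\<^sup>2"

text \<open>Passing from \<open>k\<close> down to \<open>n\<close> and back up by sampling with replacement replaces an
  invariant polynomial by its average over random self-maps of \<open>{1..k}\<close> with collision
  probabilities \<open>O(1/n)\<close>, hence moves it by \<open>O(1/n)\<close>, uniformly in \<open>k\<close>.\<close>

lemma nrm_de_finetti_embed:
  assumes idx: "index_le U n k" and p: "p \<in> inv_polys F k d"
  shows "nrm U F k d (\<lambda>x. de_finetti_seq U F n (\<lambda>x. p (embed U F k n x)) k x - p x)
    \<le> drift F d / n * nrm U F k d p"
proof -
  have nk: "1 \<le> n" "1 \<le> k" using index_le_pos[OF idx] by auto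
  let ?E = "ehoms U n k" and ?e = "emap U k n" and ?c = "coef U F k d p"
  let ?r = "\<lambda>x. de_finetti_seq U F n (\<lambda>x. p (embed U F k n x)) k x - p x"
  \<comment> \<open>The round trip as a self-map of {1..k}: \<open>f\<close> itself for zero
    padding, \<open>f \<circ> block k n\<close> for duplication.\<close>
  define h where "h f = hcomp U ?e f" for f
  have pp: "p \<in> polys F k d" using p by (rule inv_polys_polys)
  have hh: "h f \<in> homs U k k" if "f \<in> ?E" for f
    unfolding h_def using that by (intro hcomp_homs[OF emap_homs[OF idx]] ehoms_subset_homs)
  have E: "0 < card ?E" "finite ?E" using card_ehoms_pos nk finite_ehoms by auto
  have rinv: "?r \<in> inv_polys F k d"
    using inv_polys_linear[OF de_finetti_inv_polys[OF nk embed_polys[OF idx pp]] p, where s = 1 and t = "-1"]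
    by simp
  have "?r = poly_of U F k d (\<lambda>M. (1 / card ?E) * (\<Sum>f\<in>?E. coef_map U F k d (h f) ?c M) + (-1) * ?c M)"
  proof
    fix x
    have "p (embed U F k n (dmap U F n k f x)) = poly_of U F k d (coef_map U F k d (h f) ?c) x"
      if "f \<in> ?E" for f
    proof -
      have "p (embed U F k n (dmap U F n k f x)) = p (dmap U F k k (h f) x)"
        unfolding embed_eq_dmap[OF idx] h_def
        using dmap_dmap[OF emap_homs[OF idx] ehoms_subset_homs[OF that]] by simp
      then show ?thesis using rep_dmap[OF hh[OF that], of F d ?c x] pp by (simp add: rep_coef)
    qed
    then show "?r x = poly_of U F k d (\<lambda>M. (1 / card ?E) * (\<Sum>f\<in>?E. coef_map U F k d (h f) ?c M) + (-1) * ?c M) x"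
      using nk pp by (simp only: rep_linear rep_sum rep_coef) (simp add: de_finetti_seq_eq)
  qed
  then have w: "coef U F k d ?r M = (\<Sum>f\<in>?E. coef_map U F k d (h f) ?c M) / card ?E - ?c M"
    if "M \<in> mons F k d" for M
    using coef_rep[OF that] by simp
  show ?thesis
  proof (cases U)
    case ZeroPadding
    have "\<bar>coef U F k d ?r M\<bar> \<le> drift F d / n * nrm U F k d p" if M: "M \<in> mons F k d" for M
    proof -
      have "card ?E * coef U F k d ?r M = (\<Sum>f\<in>?E. ?c (mmap (h f) M) - ?c M)"
        unfolding w[OF M]
        using E by (simp add: ZeroPadding sum_subtractf right_diff_distrib)
      then have "card ?E * \<bar>coef U F k d ?r M\<bar> = \<bar>\<Sum>f\<in>?E. ?c (mmap (h f) M) - ?c M\<bar>"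
        by (simp only: abs_mult abs_of_nat flip: \<open>_ = (\<Sum>f\<in>?E. ?c (mmap (h f) M) - ?c M)\<close>)
      also have "\<dots> \<le> 2 * nrm U F k d p * ((d * cdeg F)\<^sup>2 * (1 / n) * card ?E)"
      proof (rule average_collision_bound[OF M])
        fix i l assume il: "i \<in> {1..k}" "l \<in> {1..k}" "i \<noteq> l"
        have "card {f \<in> ?E. h f i = h f l} * card {1..n} = card ?E"
          unfolding ZeroPadding ehoms_def h_def using card_PiE_coincide[of "{1..k}" "{1..n}" i l] il
          by simp
        then have "card {f \<in> ?E. h f i = h f l} * n = card ?E" by simp
        then have "real (card {f \<in> ?E. h f i = h f l}) * n = card ?E"
          unfolding of_nat_mult[symmetric] by (rule arg_cong)
        then show "card {f \<in> ?E. h f i = h f l} \<le> 1 / n * card ?E"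
          using nk by (simp add: field_simps)
      next
        fix f assume "f \<in> ?E"
        from hh[OF this] show "h f ` {1..k} \<subseteq> {1..k}" by (auto simp: homs_def ZeroPadding)
      qed (use coef_invariant[OF p] M E coef_le_nrm in auto)
      \<comment> \<open>Collisions have probability only 1/n here; the constant is raised to the one
        that duplication requires.\<close>
      also have "\<dots> \<le> 4 * nrm U F k d p * ((d * cdeg F)\<^sup>2 * (1 / n) * card ?E)"
        using nrm_nonneg[of U F k d p] by (intro mult_right_mono) auto
      also have "\<dots> = card ?E * (drift F d / n * nrm U F k d p)"
        by (simp add: drift_def)
      finally show ?thesis by (rule mult_left_le_imp_le) (use E in simp)
    qed
    then show ?thesis unfolding ZeroPadding nrm_ZeroPadding_le_iff by blast
  next
    case Duplication
    let ?M = "mons F k d" and ?P = "{\<sigma>. \<sigma> permutes {1..k}}" and ?w = "coef U F k d ?r"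
    \<comment> \<open>Pairing with signs computes the sum norm of the error; \<open>u\<close> is
      bounded by 1 and inherits the invariance of \<open>?r\<close>.\<close>
    define u where "u M = sgn (?w M)" for M
    have n: "1 \<le> n" "1 \<le> k" "n dvd k" using idx by (auto simp: Duplication)
    have hmon: "mmap (h f) M \<in> ?M" if "f \<in> ?E" "M \<in> ?M" for f M
      using mmap_mons[OF that(2), of "h f" k] hh[OF that(1)] by (auto simp: homs_def Duplication)
    \<comment> \<open>Pushing coefficients forward is dual to composing the test function with
      \<open>mmap (h f)\<close>; this moves the comparison with the identity onto
      \<open>u\<close>.\<close>
    have push: "(\<Sum>M\<in>?M. coef_map U F k d (h f) ?c M * u M) = (\<Sum>N\<in>?M. ?c N * u (mmap (h f) N))"
      if "f \<in> ?E" for f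
    proof -
      have "(\<Sum>M\<in>?M. coef_map U F k d (h f) ?c M * u M) =
          (\<Sum>M\<in>?M. \<Sum>N\<in>{N \<in> ?M. mmap (h f) N = M}. ?c N * u (mmap (h f) N))"
        by (auto simp: Duplication sum_distrib_right intro!: sum.cong)
      also have "\<dots> = (\<Sum>N\<in>?M. ?c N * u (mmap (h f) N))"
        using hmon[OF that] by (intro sum.group finite_mons) auto
      finally show ?thesis .
    qed
    have "card ?E * nrm U F k d ?r = (\<Sum>M\<in>?M. card ?E * ?w M * u M)"
      by (simp add: Duplication u_def sum_distrib_left abs_sgn mult.assoc)
    also have "\<dots> = (\<Sum>M\<in>?M. (\<Sum>f\<in>?E. coef_map U F k d (h f) ?c M * u M) - card ?E * ?c M * u M)"
      using E by (intro sum.cong refl) (simp add: w left_diff_distrib right_diff_distrib flip: sum_distrib_right)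
    also have "\<dots> = (\<Sum>f\<in>?E. \<Sum>M\<in>?M. coef_map U F k d (h f) ?c M * u M) - (\<Sum>M\<in>?M. card ?E * ?c M * u M)"
      unfolding sum_subtractf by (subst sum.swap) simp
    also have "\<dots> = (\<Sum>f\<in>?E. \<Sum>N\<in>?M. ?c N * u (mmap (h f) N)) - (\<Sum>M\<in>?M. card ?E * ?c M * u M)"
      using push by simp
    also have "\<dots> = (\<Sum>N\<in>?M. ?c N * (\<Sum>f\<in>?E. u (mmap (h f) N) - u N))"
      by (subst sum.swap)
        (simp add: sum_subtractf sum_distrib_left right_diff_distrib mult_ac)
    finally have S: "card ?E * nrm U F k d ?r = (\<Sum>N\<in>?M. ?c N * (\<Sum>f\<in>?E. u (mmap (h f) N) - u N))" .
    have uinv: "u (mmap \<sigma> N) = u N" if "\<sigma> \<in> ?P" "N \<in> ?M" for \<sigma> N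
      unfolding u_def using coef_invariant[OF rinv] that by simp
    \<comment> \<open>\<open>h f\<close> is constant on blocks, so points of one block always
      collide. As \<open>?c\<close> and \<open>u\<close> are invariant, any permutation may be put
      in front, and averaging over it makes collisions rare.\<close>
    have shuffle: "(\<Sum>N\<in>?M. ?c N * (\<Sum>f\<in>?E. u (mmap (h f) N) - u N)) =
        (\<Sum>N\<in>?M. ?c N * (\<Sum>f\<in>?E. u (mmap (h f \<circ> \<sigma>) N) - u N))" if s: "\<sigma> \<in> ?P" for \<sigma>
    proof -
      have s': "\<sigma> permutes {1..k}" using s by simp
      have "(\<Sum>N\<in>?M. ?c N * (\<Sum>f\<in>?E. u (mmap (h f) N) - u N)) =
          (\<Sum>N\<in>?M. ?c (mmap \<sigma> N) * (\<Sum>f\<in>?E. u (mmap (h f) (mmap \<sigma> N)) - u (mmap \<sigma> N)))"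
        by (rule sum.reindex_bij_betw[OF bij_betw_mmap_mons[OF s'], symmetric])
      also have "\<dots> = (\<Sum>N\<in>?M. ?c N * (\<Sum>f\<in>?E. u (mmap (h f \<circ> \<sigma>) N) - u N))"
        using coef_invariant[OF p s'] uinv[OF s] by (simp only: mmap_mmap cong: sum.cong)
      finally show ?thesis .
    qed
    let ?EP = "?E \<times> ?P"
    have cEP: "real (card ?EP) = card ?P * card ?E" by (simp add: card_cartesian_product)
    have "card ?P * (card ?E * nrm U F k d ?r) =
        (\<Sum>\<sigma>\<in>?P. \<Sum>N\<in>?M. ?c N * (\<Sum>f\<in>?E. u (mmap (h f) N) - u N))"
      unfolding S by simp
    also have "\<dots> = (\<Sum>\<sigma>\<in>?P. \<Sum>N\<in>?M. ?c N * (\<Sum>f\<in>?E. u (mmap (h f \<circ> \<sigma>) N) - u N))"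
      by (rule sum.cong[OF refl shuffle])
    also have "\<dots> = (\<Sum>N\<in>?M. ?c N * (\<Sum>p\<in>?EP. u (mmap (h (fst p) \<circ> snd p) N) - u N))"
      unfolding sum.cartesian_product' fst_conv snd_conv sum_distrib_left
      by (subst sum.swap, rule sum.cong[OF refl], rule sum.swap)
    also have "\<dots> \<le> (\<Sum>N\<in>?M. \<bar>?c N\<bar> * (2 * 1 * ((d * cdeg F)\<^sup>2 * (2 / n) * card ?EP)))"
    proof (rule sum_mono)
      fix N assume N: "N \<in> ?M"
      have "\<bar>\<Sum>p\<in>?EP. u (mmap (h (fst p) \<circ> snd p) N) - u N\<bar> \<le>
          2 * 1 * ((d * cdeg F)\<^sup>2 * (2 / n) * card ?EP)"
      proof (rule average_collision_bound[OF N])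
        fix i l assume il: "i \<in> {1..k}" "l \<in> {1..k}" "i \<noteq> l"
        show "card {p \<in> ?EP. (h (fst p) \<circ> snd p) i = (h (fst p) \<circ> snd p) l} \<le> 2 / n * card ?EP"
          using card_collisions_block[OF n il] by (simp add: Duplication ehoms_def h_def)
      next
        fix p assume "p \<in> ?EP"
        then have "fst p \<in> ?E" "snd p permutes {1..k}" by auto
        then have "h (fst p) ` {1..k} \<subseteq> {1..k}" "snd p ` {1..k} = {1..k}"
          using hh[of "fst p"] permutes_image[of "snd p"]
          by (simp_all add: homs_def Duplication funcset_image)
        then show "(h (fst p) \<circ> snd p) ` {1..k} \<subseteq> {1..k}" by (simp only: image_comp[symmetric])
      qed (use uinv N E in \<open>auto simp: u_def sgn_real_def finite_permutations\<close>)
      then have "\<bar>?c N * (\<Sum>p\<in>?EP. u (mmap (h (fst p) \<circ> snd p) N) - u N)\<bar> \<le>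
          \<bar>?c N\<bar> * (2 * 1 * ((d * cdeg F)\<^sup>2 * (2 / n) * card ?EP))"
        unfolding abs_mult by (intro mult_left_mono) auto
      then show "?c N * (\<Sum>p\<in>?EP. u (mmap (h (fst p) \<circ> snd p) N) - u N) \<le>
          \<bar>?c N\<bar> * (2 * 1 * ((d * cdeg F)\<^sup>2 * (2 / n) * card ?EP))"
        by linarith
    qed
    also have "\<dots> = nrm U F k d p * (2 * 1 * ((d * cdeg F)\<^sup>2 * (2 / n) * card ?EP))"
      unfolding Duplication nrm.simps sum_distrib_right ..
    also have "\<dots> = card ?P * (card ?E * (drift F d / n * nrm U F k d p))"
      unfolding cEP drift_def by simp
    finally have "card ?E * nrm U F k d ?r \<le> card ?E * (drift F d / n * nrm U F k d p)"
      by (rule mult_left_le_imp_le) (simp add: card_permutations_interval)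
    then show ?thesis by (rule mult_left_le_imp_le) (use E in simp)
  qed
qed

section \<open>The de Finetti map is an isomorphism\<close>

lemma index_le_refl: "1 \<le> n \<Longrightarrow> index_le U n n"
  by (cases U) auto

lemma one_le_mult: "1 \<le> n \<Longrightarrow> 1 \<le> m \<Longrightarrow> 1 \<le> n * m" for n m :: nat
  using mult_le_mono[of 1 n 1 m] by simp

text \<open>Products are upper bounds in both index orders at once, which spares a distinction
  between the two sequences.\<close>

lemma index_le_mult: "1 \<le> n \<Longrightarrow> 1 \<le> m \<Longrightarrow> index_le U n (n * m)"
  using one_le_mult[of n m] by (cases U) auto

lemma index_le_mult': "1 \<le> n \<Longrightarrow> 1 \<le> m \<Longrightarrow> index_le U m (n * m)"
  using index_le_mult[of m n U] by (simp add: mult.commute)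

text \<open>Not the identity on the type \<open>vec\<close>, since coordinates outside
  \<open>labels F n\<close> become zero; \<open>act F n id\<close> is a form that invariant
  polynomials absorb.\<close>

lemma dmap_emap_self:
  assumes "1 \<le> n"
  shows "dmap U F n n (emap U' n n) = act F n id"
proof -
  have "emap U' n n i = pmap U id i" if "i \<in> {1..src U n n}" for i
    using that assms by (cases U; cases U') (auto simp: block_def)
  then have "dmap U F n n (emap U' n n) = dmap U F n n (pmap U id)" by (rule dmap_cong)
  then show ?thesis by (simp add: act_eq_dmap[of id n F U] permutes_id)
qed

lemma embed_self: "1 \<le> n \<Longrightarrow> p \<in> inv_polys F n d \<Longrightarrow> p (embed U F n n x) = p x"
  by (simp add: embed_eq_dmap index_le_refl dmap_emap_self inv_polys_act permutes_id
      del: embed.simps dmap.simps)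

lemma embed_adj_self: "1 \<le> n \<Longrightarrow> p \<in> inv_polys F n d \<Longrightarrow> p (embed_adj (other U) F n n x) = p x"
  by (simp add: embed_adj_eq_dmap index_le_refl dmap_emap_self inv_polys_act permutes_id
      del: dmap.simps)

lemma inv_polys_sum:
  "(\<And>j. j \<in> J \<Longrightarrow> q j \<in> inv_polys F n d) \<Longrightarrow> (\<lambda>x. \<Sum>j\<in>J. q j x) \<in> inv_polys F n d"
  by (simp add: inv_polys_iff polys_sum)

lemma inv_polys_scale: "q \<in> inv_polys F n d \<Longrightarrow> (\<lambda>x. s * q x) \<in> inv_polys F n d"
  by (simp add: inv_polys_iff polys_scale)

lemma inv_polys_diff:
  "p \<in> inv_polys F n d \<Longrightarrow> q \<in> inv_polys F n d \<Longrightarrow> (\<lambda>x. p x - q x) \<in> inv_polys F n d"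
  using inv_polys_linear[of p F n d q 1 "-1"] by simp

lemma nrm_diff:
  assumes "p \<in> polys F n d" "q \<in> polys F n d"
  shows "nrm U F n d p \<le> nrm U F n d q + nrm U F n d (\<lambda>x. q x - p x)"
proof -
  have "(\<lambda>x. q x - p x) \<in> polys F n d" using polys_linear[of q F n d p 1 "-1"] assms by simp
  from nrm_linear[OF assms(2) this, of U 1 "-1"] show ?thesis by simp
qed

lemma nrm_minus_commute:
  assumes "p \<in> polys F n d" "q \<in> polys F n d"
  shows "nrm U F n d (\<lambda>x. p x - q x) \<le> nrm U F n d (\<lambda>x. q x - p x)"
proof -
  have "(\<lambda>x. q x - p x) \<in> polys F n d" using polys_linear[of q F n d p 1 "-1"] assms by simp
  from nrm_scale[OF this, of U "-1"] show ?thesis by simp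
qed

lemma drift_nonneg: "0 \<le> drift F d"
  by (simp add: drift_def)

text \<open>Beyond this threshold \<open>drift F d / n\<close> is at most 1/2, so the round trip
  differs from the identity by a map of norm at most 1/2.\<close>

definition large :: "construction \<Rightarrow> nat \<Rightarrow> nat \<Rightarrow> bool" where
  "large F d n \<longleftrightarrow> 1 \<le> n \<and> 2 * drift F d \<le> n"

lemma large_pos: "large F d n \<Longrightarrow> 1 \<le> n"
  by (simp add: large_def)

lemma large_mult: "large F d n \<Longrightarrow> 1 \<le> m \<Longrightarrow> large F d (n * m)"
proof -
  assume a: "large F d n" "1 \<le> m"
  then have "n * 1 \<le> n * m" by (intro mult_le_mono2)
  then have "real n \<le> real (n * m)" unfolding of_nat_le_iff by simp
  with a one_le_mult[of n m] show ?thesis unfolding large_def by linarith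
qed

lemma ex_large: "\<exists>n. large F d n"
proof -
  obtain n where "2 * drift F d \<le> real n" using real_arch_simple by blast
  then have "large F d (Suc n)" by (simp add: large_def)
  then show ?thesis ..
qed

lemma large_drift: "large F d n \<Longrightarrow> drift F d / n \<le> 1 / 2"
  by (simp add: large_def field_simps)

lemma nrm_de_finetti_self:
  assumes "1 \<le> n" "p \<in> inv_polys F n d"
  shows "nrm U F n d (\<lambda>x. de_finetti_seq U F n p n x - p x) \<le> drift F d / n * nrm U F n d p"
  using nrm_de_finetti_embed[OF index_le_refl[OF assms(1)] assms(2), of U] assms
  by (simp add: embed_self del: embed.simps)

section \<open>Control of the inverse limit by one large level\<close>

lemma inverse_limitD:
  assumes "p \<in> inverse_limit U F d"
  shows "p 0 = (\<lambda>x. 0)" "1 \<le> n \<Longrightarrow> p n \<in> inv_polys F n d" "1 \<le> n \<Longrightarrow> p n \<in> polys F n d"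
  using assms by (auto simp: inverse_limit_def intro: inv_polys_polys)

lemma inverse_limit_embed:
  assumes "p \<in> inverse_limit U F d" "index_le U n N"
  shows "p N (embed U F N n x) = p n x"
proof -
  have n: "1 \<le> n" "1 \<le> N" using index_le_pos[OF assms(2)] by auto
  have "(\<lambda>x. p N (embed U F N n x)) = p n"
    by (rule polys_eqI[OF embed_polys[OF assms(2)]])
      (use assms n in \<open>auto simp: inverse_limit_def intro: inv_polys_polys\<close>)
  then show ?thesis by metis
qed

lemma inverse_limit_linear:
  assumes "p \<in> inverse_limit U F d" "q \<in> inverse_limit U F d"
  shows "(\<lambda>n x. s * p n x + t * q n x) \<in> inverse_limit U F d"
  using assms unfolding inverse_limit_def by (auto simp: inv_polys_linear)

lemma de_finetti_in_inverse_limit: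
  assumes "1 \<le> k" "q \<in> polys F k d"
  shows "de_finetti_seq U F k q \<in> inverse_limit U F d"
  unfolding inverse_limit_def using assms index_le_pos
  by (auto simp: de_finetti_embed de_finetti_inv_polys) (simp add: de_finetti_seq_def)

text \<open>The component at level k is close to the de Finetti image of \<open>p n\<close>, whose
  norm is at most that of \<open>p n\<close>.\<close>

lemma nrm_inverse_limit_le:
  assumes p: "p \<in> inverse_limit U F d" and idx: "index_le U n k"
  shows "nrm U F k d (p k) \<le> nrm U F n d (p n) + drift F d / n * nrm U F k d (p k)"
proof -
  have n: "1 \<le> n" "1 \<le> k" using index_le_pos[OF idx] by auto
  have "(\<lambda>x. p k (embed U F k n x)) = p n" using inverse_limit_embed[OF p idx] by (simp add: fun_eq_iff)
  with nrm_de_finetti_embed[OF idx inverse_limitD(2)[OF p n(2)]]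
  have "nrm U F k d (\<lambda>x. de_finetti_seq U F n (p n) k x - p k x) \<le> drift F d / n * nrm U F k d (p k)"
    by (simp del: embed.simps)
  moreover have "nrm U F k d (de_finetti_seq U F n (p n) k) \<le> nrm U F n d (p n)"
    using n inverse_limitD(3)[OF p] by (intro nrm_de_finetti)
  moreover have "nrm U F k d (p k) \<le> nrm U F k d (de_finetti_seq U F n (p n) k) +
      nrm U F k d (\<lambda>x. de_finetti_seq U F n (p n) k x - p k x)"
    using n inverse_limitD(3)[OF p] by (intro nrm_diff de_finetti_polys)
  ultimately show ?thesis by linarith
qed

lemma nrm_inverse_limit_double:
  assumes "p \<in> inverse_limit U F d" "index_le U n k" "large F d n"
  shows "nrm U F k d (p k) \<le> 2 * nrm U F n d (p n)"
proof -
  have "drift F d / n * nrm U F k d (p k) \<le> 1 / 2 * nrm U F k d (p k)"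
    using large_drift[OF assms(3)] by (intro mult_right_mono nrm_nonneg)
  with nrm_inverse_limit_le[OF assms(1,2)] show ?thesis by linarith
qed

text \<open>Levels n and m may be incomparable, so the vanishing is first carried up to level
  \<open>n * m\<close> and then restricted to level m.\<close>

lemma inverse_limit_eq_0:
  assumes p: "p \<in> inverse_limit U F d" and n: "large F d n" and "p n = (\<lambda>x. 0)"
  shows "p = (\<lambda>n x. 0)"
proof
  fix m
  show "p m = (\<lambda>x. 0)"
  proof (cases "m = 0")
    case True
    then show ?thesis using inverse_limitD(1)[OF p] by simp
  next
    case False
    then have m: "1 \<le> n" "1 \<le> m" using large_pos[OF n] by auto
    have "nrm U F (n * m) d (p (n * m)) \<le> 0"
      using nrm_inverse_limit_double[OF p index_le_mult[OF m] n] assms(3) by (simp add: nrm_zero)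
    then have "p (n * m) = (\<lambda>x. 0)"
      using nrm_nonneg[of U F "n * m" d "p (n * m)"] inverse_limitD(3)[OF p one_le_mult[OF m]]
      by (intro nrm_eq_0D) auto
    then have "p m x = 0" for x
      using inverse_limit_embed[OF p index_le_mult'[OF m], of x] by (simp del: embed.simps)
    then show ?thesis by blast
  qed
qed

lemma nrm_le_de_finetti:
  assumes n: "large F d n" and q: "q \<in> inv_polys F n d"
  shows "nrm U F n d q \<le> 2 * nrm U F n d (de_finetti_seq U F n q n)"
proof -
  have pos: "1 \<le> n" using large_pos[OF n] .
  have "nrm U F n d (\<lambda>x. de_finetti_seq U F n q n x - q x) \<le> drift F d / n * nrm U F n d q"
    by (rule nrm_de_finetti_self[OF pos q])
  also have "\<dots> \<le> 1 / 2 * nrm U F n d q"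
    using large_drift[OF n] by (intro mult_right_mono nrm_nonneg)
  finally show ?thesis
    using nrm_diff[of q F n d "de_finetti_seq U F n q n" U] pos q de_finetti_polys[of n n q F d U]
    by (simp add: inv_polys_polys)
qed

lemma de_finetti_eq_0:
  assumes "large F d n" "q \<in> inv_polys F n d" "de_finetti_seq U F n q n = (\<lambda>x. 0)"
  shows "q = (\<lambda>x. 0)"
  using nrm_le_de_finetti[OF assms(1,2), of U] nrm_nonneg[of U F n d q] assms
  by (intro nrm_eq_0D[of q F n d U]) (auto simp: nrm_zero inv_polys_polys)

text \<open>Symmetrised scaled monomials. They are a finite spanning family of the invariant
  polynomials rather than a basis, which is enough for coefficientwise limits and for
  charts.\<close>

definition sym_monom :: "base_seq \<Rightarrow> construction \<Rightarrow> nat \<Rightarrow> nat \<Rightarrow> label multiset \<Rightarrow> polyfun" where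
  "sym_monom U F n d M = sym_map (other U) F n n (poly_of U F n d (\<lambda>N. if N = M then 1 else 0))"

lemma sym_monom_inv_polys: "1 \<le> n \<Longrightarrow> sym_monom U F n d M \<in> inv_polys F n d"
  unfolding sym_monom_def by (intro sym_map_inv_polys index_le_refl rep_in_polys)

text \<open>Expand in monomials and average over the group; the invariant polynomial itself is fixed
  by the averaging.\<close>

lemma inv_polys_expansion:
  assumes n: "1 \<le> n" and q: "q \<in> inv_polys F n d"
  shows "q x = (\<Sum>M\<in>mons F n d. coef U F n d q M * sym_monom U F n d M x)"
proof -
  let ?P = "{\<sigma>. \<sigma> permutes {1..n}}"
  let ?y = "\<lambda>\<sigma>. embed_adj (other U) F n n (act F n \<sigma> x)"
  let ?m = "\<lambda>M. poly_of U F n d (\<lambda>N. if N = M then 1 else 0)"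
  have m: "?m M y = mono_scale U M * (\<Prod>a\<in>#M. y a)" if "M \<in> mons F n d" for M y
    using that by (simp add: poly_of_def finite_mons if_distrib[where f = "\<lambda>t. t * _"] cong: if_cong)
  have qm: "(\<Sum>M\<in>mons F n d. coef U F n d q M * ?m M y) = q y" for y
  proof -
    have "(\<Sum>M\<in>mons F n d. coef U F n d q M * ?m M y) = poly_of U F n d (coef U F n d q) y"
      unfolding poly_of_def[of U F n d "coef U F n d q"] by (intro sum.cong refl) (simp add: m)
    then show ?thesis using q by (simp add: rep_coef inv_polys_polys)
  qed
  have "(\<Sum>M\<in>mons F n d. coef U F n d q M * sym_monom U F n d M x) =
      (1 / fact n) * (\<Sum>\<sigma>\<in>?P. \<Sum>M\<in>mons F n d. coef U F n d q M * ?m M (?y \<sigma>))"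
    unfolding sym_monom_def sym_map_def
    by (subst sum.swap) (simp add: sum_distrib_left mult_ac)
  also have "\<dots> = (1 / fact n) * (\<Sum>\<sigma>\<in>?P. q x)"
    unfolding qm using n q by (simp add: embed_adj_self inv_polys_act)
  finally show ?thesis using card_permutations_interval[of n] by simp
qed

text \<open>Surjectivity by the Neumann series of the near-identity map.\<close>

lemma de_finetti_surj:
  assumes n: "large F d n" and r: "r \<in> inv_polys F n d"
  obtains q where "q \<in> inv_polys F n d" "de_finetti_seq U F n q n = r"
proof -
  have pos: "1 \<le> n" using large_pos[OF n] .
  let ?g = "\<lambda>q. de_finetti_seq U F n q n"
  \<comment> \<open>The residuals (1 - g)^j r, whose sum is the Neumann series for the inverse of g
    applied to r.\<close>
  define e where "e j = ((\<lambda>q x. q x - ?g q x) ^^ j) r" for j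
  have e_Suc: "e (Suc j) = (\<lambda>x. e j x - ?g (e j) x)" for j by (simp add: e_def)
  have e: "e j \<in> inv_polys F n d" for j
  proof (induction j)
    case 0
    then show ?case using r by (simp add: e_def)
  next
    case (Suc j)
    then show ?case unfolding e_Suc using pos
      by (intro inv_polys_diff de_finetti_inv_polys inv_polys_polys)
  qed
  have nrm_e: "nrm U F n d (e j) \<le> (1 / 2) ^ j * nrm U F n d r" for j
  proof (induction j)
    case 0
    then show ?case by (simp add: e_def)
  next
    case (Suc j)
    have "nrm U F n d (e (Suc j)) \<le> nrm U F n d (\<lambda>x. ?g (e j) x - e j x)"
      unfolding e_Suc using e pos by (intro nrm_minus_commute de_finetti_polys inv_polys_polys)
    also have "\<dots> \<le> drift F d / n * nrm U F n d (e j)"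
      by (rule nrm_de_finetti_self[OF pos e])
    also have "\<dots> \<le> 1 / 2 * nrm U F n d (e j)"
      using large_drift[OF n] by (intro mult_right_mono nrm_nonneg)
    also have "\<dots> \<le> 1 / 2 * ((1 / 2) ^ j * nrm U F n d r)"
      using Suc by (intro mult_left_mono) auto
    finally show ?case by simp
  qed
  have summ: "summable (\<lambda>j. coef U F n d (e j) M)" if M: "M \<in> mons F n d" for M
  proof (rule summable_comparison_test')
    show "summable (\<lambda>j. (1 / 2) ^ j * nrm U F n d r)"
      by (intro summable_mult2 summable_geometric) simp
    show "norm (coef U F n d (e j) M) \<le> (1 / 2) ^ j * nrm U F n d r" for j
      using coef_le_nrm[OF M, of U "e j"] nrm_e[of j] by simp
  qed
  \<comment> \<open>The series is summed coefficientwise and reassembled from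
    \<open>sym_monom\<close>, so that the limit is an invariant polynomial by construction.\<close>
  define c where "c M = (\<Sum>j. coef U F n d (e j) M)" for M
  define q where "q x = (\<Sum>M\<in>mons F n d. c M * sym_monom U F n d M x)" for x
  have q_inv: "q \<in> inv_polys F n d"
    unfolding q_def using pos by (intro inv_polys_sum inv_polys_scale sym_monom_inv_polys)
  have e_sums: "(\<lambda>j. e j x) sums q x" for x
  proof -
    have "(\<lambda>j. \<Sum>M\<in>mons F n d. coef U F n d (e j) M * sym_monom U F n d M x) sums q x"
      unfolding q_def c_def by (intro sums_sum sums_mult2 summable_sums summ)
    then show ?thesis using inv_polys_expansion[OF pos e, where U = U] by simp
  qed
  have "?g q = r"
  proof
    fix x
    have "(\<lambda>j. (\<Sum>f\<in>ehoms U n n. e j (dmap U F n n f x)) / card (ehoms U n n)) sums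
        ((\<Sum>f\<in>ehoms U n n. q (dmap U F n n f x)) / card (ehoms U n n))"
      by (intro sums_divide sums_sum e_sums)
    then have "(\<lambda>j. ?g (e j) x) sums ?g q x" using pos by (simp add: de_finetti_seq_eq)
    moreover have "(\<lambda>j. ?g (e j) x) = (\<lambda>j. e j x - e (Suc j) x)" by (simp add: e_Suc)
    \<comment> \<open>Applying g to the series telescopes, since g maps each residual to its
      difference from the next one.\<close>
    moreover have "(\<lambda>j. e j x - e (Suc j) x) sums (e 0 x - 0)"
      using e_sums[of x] by (intro telescope_sums' summable_LIMSEQ_zero sums_summable)
    ultimately have "?g q x = e 0 x - 0" by (simp add: sums_unique2)
    then show "?g q x = r x" by (simp add: e_def)
  qed
  with q_inv that show ?thesis by blast
qed

lemma de_finetti_diff: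
  assumes "1 \<le> k" "1 \<le> n"
  shows "de_finetti_seq U F k (\<lambda>x. p x - q x) n =
    (\<lambda>x. de_finetti_seq U F k p n x - de_finetti_seq U F k q n x)"
  using de_finetti_linear[OF assms, of U F 1 p "-1" q] by simp

lemma inverse_limit_eqI:
  assumes "p \<in> inverse_limit U F d" "q \<in> inverse_limit U F d" "large F d n" "p n = q n"
  shows "p = q"
proof -
  have "(\<lambda>m x. 1 * p m x + (-1) * q m x) = (\<lambda>m x. 0)"
    using assms(4)
    by (intro inverse_limit_eq_0[OF inverse_limit_linear[OF assms(1,2), of 1 "-1"] assms(3)]) simp
  then have "1 * p m x + (-1) * q m x = 0" for m x by meson
  then show ?thesis by (simp add: fun_eq_iff)
qed

lemma bij_betw_de_finetti:
  assumes n: "large F d n"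
  shows "bij_betw (de_finetti_seq U F n) (inv_polys F n d) (inverse_limit U F d)"
proof (rule bij_betw_imageI)
  have pos: "1 \<le> n" using large_pos[OF n] .
  show "inj_on (de_finetti_seq U F n) (inv_polys F n d)"
  proof (rule inj_onI)
    fix p q assume pq: "p \<in> inv_polys F n d" "q \<in> inv_polys F n d"
      "de_finetti_seq U F n p = de_finetti_seq U F n q"
    have "de_finetti_seq U F n (\<lambda>x. p x - q x) n = (\<lambda>x. 0)"
      unfolding de_finetti_diff[OF pos pos] pq(3) by simp
    then have "(\<lambda>x. p x - q x) = (\<lambda>x. 0)"
      by (rule de_finetti_eq_0[OF n inv_polys_diff[OF pq(1,2)]])
    then have "p x - q x = 0" for x by (rule fun_cong)
    then show "p = q" by auto
  qed
  show "de_finetti_seq U F n ` inv_polys F n d = inverse_limit U F d"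
  proof (intro equalityI subsetI)
    fix w assume "w \<in> de_finetti_seq U F n ` inv_polys F n d"
    then show "w \<in> inverse_limit U F d"
      using pos by (auto intro: de_finetti_in_inverse_limit inv_polys_polys)
  next
    fix w assume w: "w \<in> inverse_limit U F d"
    obtain q where q: "q \<in> inv_polys F n d" "de_finetti_seq U F n q n = w n"
      using de_finetti_surj[OF n inverse_limitD(2)[OF w pos]] by blast
    have "de_finetti_seq U F n q = w"
      using pos q by (intro inverse_limit_eqI[OF _ w n] de_finetti_in_inverse_limit inv_polys_polys)
    with q(1) show "w \<in> de_finetti_seq U F n ` inv_polys F n d" by blast
  qed
qed

text \<open>A point \<open>w\<close> of the inverse limit is approximated by the de Finetti images
  of its own components at the levels \<open>n * Suc j\<close>. Convergence is expressed through
  preimages at the fixed level n, whose coefficients serve as coordinates on the limit.\<close>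

lemma de_finetti_approximation:
  assumes n: "large F d n" and w: "w \<in> inverse_limit U F d"
    and q: "\<And>j. q j \<in> inv_polys F n d"
      "\<And>j. de_finetti_seq U F n (q j) = de_finetti_seq U F (n * Suc j) (w (n * Suc j))"
    and q': "q' \<in> inv_polys F n d" "de_finetti_seq U F n q' = w"
    and M: "M \<in> mons F n d"
  shows "(\<lambda>j. coef U F n d (q j) M) \<longlonglongrightarrow> coef U F n d q' M"
proof (rule LIM_zero_cancel, rule tendsto_rabs_zero_cancel,
    rule tendsto_sandwich[where f = "\<lambda>_. 0"
      and h = "\<lambda>j. 4 * drift F d * nrm U F n d (w n) * inverse (real (Suc j))"])
  have pos: "1 \<le> n" using large_pos[OF n] .
  \<comment> \<open>One factor 2 comes from undoing the de Finetti map at level n, the other from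
    bounding \<open>w\<close> at the higher levels by \<open>w n\<close>.\<close>
  let ?B = "4 * drift F d * nrm U F n d (w n)"
  show "\<forall>\<^sub>F j in sequentially. \<bar>coef U F n d (q j) M - coef U F n d q' M\<bar> \<le> ?B * inverse (real (Suc j))"
  proof (rule always_eventually, rule allI)
    fix j
    let ?k = "n * Suc j"
    let ?\<delta> = "\<lambda>x. de_finetti_seq U F ?k (w ?k) ?k x - w ?k x"
    have k: "1 \<le> ?k" "index_le U n ?k" using pos index_le_mult[OF pos, of "Suc j"] by auto
    have wk: "w ?k \<in> inv_polys F ?k d" "w ?k \<in> polys F ?k d" using inverse_limitD[OF w] k by auto
    have \<delta>: "?\<delta> \<in> polys F ?k d"
      using wk k by (intro inv_polys_polys inv_polys_diff de_finetti_inv_polys)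
    \<comment> \<open>The error at level \<open>?k\<close>, restricted to level n, is the difference
      of the two limit elements there.\<close>
    have "de_finetti_seq U F n (\<lambda>x. q j x - q' x) n = (\<lambda>x. ?\<delta> (embed U F ?k n x))"
      using de_finetti_embed[OF k(2) k(1)] inverse_limit_embed[OF w k(2)] pos
      by (simp add: de_finetti_diff q(2) q'(2) del: embed.simps)
    then have "nrm U F n d (\<lambda>x. q j x - q' x) \<le> 2 * nrm U F n d (\<lambda>x. ?\<delta> (embed U F ?k n x))"
      using nrm_le_de_finetti[OF n inv_polys_diff[OF q(1)[of j] q'(1)], of U] by simp
    also have "\<dots> \<le> 2 * nrm U F ?k d ?\<delta>"
      using nrm_embed[OF k(2) \<delta>] by simp
    also have "\<dots> \<le> 2 * (drift F d / ?k * nrm U F ?k d (w ?k))"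
      using nrm_de_finetti_self[OF k(1) wk(1), of U] by simp
    also have "\<dots> \<le> 2 * (drift F d / ?k * (2 * nrm U F n d (w n)))"
      using nrm_inverse_limit_double[OF w k(2) n] drift_nonneg
      by (intro mult_left_mono) auto
    also have "\<dots> = ?B * inverse (real ?k)"
      by (simp add: divide_inverse)
    also have "\<dots> \<le> ?B * inverse (real (Suc j))"
    proof (intro mult_left_mono le_imp_inverse_le)
      have "Suc j \<le> ?k" using pos by (cases n) auto
      then show "real (Suc j) \<le> real ?k" unfolding of_nat_le_iff .
    qed (use drift_nonneg[of F d] nrm_nonneg[of U F n d "w n"] in auto)
    finally have "nrm U F n d (\<lambda>x. q j x - q' x) \<le> ?B * inverse (real (Suc j))" .
    moreover have "coef U F n d (\<lambda>x. q j x - q' x) M = coef U F n d (q j) M - coef U F n d q' M"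
      using coef_linear[OF inv_polys_polys[OF q(1)[of j]] inv_polys_polys[OF q'(1)] M, of U 1 "-1"]
      by simp
    ultimately show "\<bar>coef U F n d (q j) M - coef U F n d q' M\<bar> \<le> ?B * inverse (real (Suc j))"
      using coef_le_nrm[OF M, of U "\<lambda>x. q j x - q' x"] by simp
  qed
  show "(\<lambda>j. ?B * inverse (real (Suc j))) \<longlonglongrightarrow> 0"
    using tendsto_mult_right_zero[OF LIMSEQ_inverse_real_of_nat] by simp
qed auto

section \<open>Limits as real vector spaces\<close>

definition real_vspace :: "'b real_space \<Rightarrow> bool" where
  "real_vspace M \<longleftrightarrow> abelian_group M \<and> (\<forall>t. \<forall>x\<in>carrier M. t \<odot>\<^bsub>M\<^esub> x \<in> carrier M)"

lemma finsum_lessThan_Suc: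
  assumes "real_vspace M" "f \<in> {..<Suc r} \<rightarrow> carrier M"
  shows "finsum M f {..<Suc r} = f r \<oplus>\<^bsub>M\<^esub> finsum M f {..<r}"
proof -
  interpret abelian_group M using assms(1) by (simp add: real_vspace_def)
  show ?thesis unfolding lessThan_Suc using assms(2) by (intro finsum_insert) auto
qed

lemma combination_closed:
  assumes "real_vspace M" "v \<in> {..<r::nat} \<rightarrow> carrier M"
  shows "finsum M (\<lambda>i. c i \<odot>\<^bsub>M\<^esub> v i) {..<r} \<in> carrier M"
proof -
  interpret abelian_group M using assms(1) by (simp add: real_vspace_def)
  show ?thesis using assms by (intro finsum_closed) (auto simp: real_vspace_def)
qed

lemma linear_iso_zero:
  assumes "linear_iso M N \<Phi>" "real_vspace M" "real_vspace N"
  shows "\<Phi> \<zero>\<^bsub>M\<^esub> = \<zero>\<^bsub>N\<^esub>"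
proof -
  interpret M: abelian_group M using assms(2) by (simp add: real_vspace_def)
  interpret N: abelian_group N using assms(3) by (simp add: real_vspace_def)
  have c: "\<Phi> \<zero>\<^bsub>M\<^esub> \<in> carrier N" using assms(1) by (auto simp: linear_iso_def bij_betw_def)
  have "\<Phi> (\<zero>\<^bsub>M\<^esub> \<oplus>\<^bsub>M\<^esub> \<zero>\<^bsub>M\<^esub>) = \<Phi> \<zero>\<^bsub>M\<^esub> \<oplus>\<^bsub>N\<^esub> \<Phi> \<zero>\<^bsub>M\<^esub>"
    using assms(1) M.zero_closed unfolding linear_iso_def by blast
  then have "\<Phi> \<zero>\<^bsub>M\<^esub> \<oplus>\<^bsub>N\<^esub> \<Phi> \<zero>\<^bsub>M\<^esub> = \<Phi> \<zero>\<^bsub>M\<^esub>" by simp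
  with c show ?thesis by (simp add: N.add.r_cancel_one)
qed

lemma linear_iso_combination:
  assumes iso: "linear_iso M N \<Phi>" and M: "real_vspace M" and N: "real_vspace N"
    and v: "v \<in> {..<r::nat} \<rightarrow> carrier M"
  shows "\<Phi> (finsum M (\<lambda>i. c i \<odot>\<^bsub>M\<^esub> v i) {..<r}) = finsum N (\<lambda>i. c i \<odot>\<^bsub>N\<^esub> \<Phi> (v i)) {..<r}"
  using v
proof (induction r)
  case 0
  interpret M: abelian_group M using M by (simp add: real_vspace_def)
  interpret N: abelian_group N using N by (simp add: real_vspace_def)
  show ?case using linear_iso_zero[OF iso M N] by simp
next
  case (Suc r)
  have v: "v \<in> {..<r} \<rightarrow> carrier M" "v r \<in> carrier M" using Suc.prems by auto
  have \<Phi>v: "\<Phi> (v i) \<in> carrier N" if "i < Suc r" for i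
    using iso Suc.prems that by (auto simp: linear_iso_def bij_betw_def)
  have "\<Phi> (finsum M (\<lambda>i. c i \<odot>\<^bsub>M\<^esub> v i) {..<Suc r}) =
      \<Phi> ((c r \<odot>\<^bsub>M\<^esub> v r) \<oplus>\<^bsub>M\<^esub> finsum M (\<lambda>i. c i \<odot>\<^bsub>M\<^esub> v i) {..<r})"
    using Suc.prems M by (subst finsum_lessThan_Suc) (auto simp: real_vspace_def)
  also have "\<dots> = (c r \<odot>\<^bsub>N\<^esub> \<Phi> (v r)) \<oplus>\<^bsub>N\<^esub> \<Phi> (finsum M (\<lambda>i. c i \<odot>\<^bsub>M\<^esub> v i) {..<r})"
    using iso M v combination_closed[OF M v(1)] by (simp add: linear_iso_def real_vspace_def)
  also have "\<dots> = finsum N (\<lambda>i. c i \<odot>\<^bsub>N\<^esub> \<Phi> (v i)) {..<Suc r}"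
    unfolding Suc.IH[OF v(1)]
    using \<Phi>v N by (subst finsum_lessThan_Suc) (auto simp: real_vspace_def)
  finally show ?case .
qed

text \<open>Combinations of vectors of N are images of combinations of their preimages, so each
  chart of N tests the image of \<open>S\<close> exactly as a chart of M tests
  \<open>S\<close>.\<close>

lemma openin_linear_iso:
  assumes iso: "linear_iso M N \<Phi>" and M: "real_vspace M" and N: "real_vspace N"
    and S: "openin (usual_topology M) S"
  shows "openin (usual_topology N) (\<Phi> ` S)"
  unfolding openin_usual_topology
proof (intro conjI allI impI)
  have bij: "bij_betw \<Phi> (carrier M) (carrier N)" using iso by (simp add: linear_iso_def)
  have SM: "S \<subseteq> carrier M" using S by (simp add: openin_usual_topology)
  then show "\<Phi> ` S \<subseteq> carrier N" using bij by (auto simp: bij_betw_def)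
  fix r :: nat and v assume v: "v \<in> {..<r} \<rightarrow> carrier N"
  define w where "w i = inv_into (carrier M) \<Phi> (v i)" for i
  have w: "w \<in> {..<r} \<rightarrow> carrier M" "\<And>i. i < r \<Longrightarrow> \<Phi> (w i) = v i"
    unfolding w_def using v bij_betw_imp_surj_on[OF bij]
    by (auto simp: Pi_iff inv_into_into f_inv_into_f)
  have "finsum N (\<lambda>i. c i \<odot>\<^bsub>N\<^esub> v i) {..<r} \<in> \<Phi> ` S \<longleftrightarrow>
      finsum M (\<lambda>i. c i \<odot>\<^bsub>M\<^esub> w i) {..<r} \<in> S" for c
  proof -
    interpret N: abelian_group N using N by (simp add: real_vspace_def)
    have "finsum N (\<lambda>i. c i \<odot>\<^bsub>N\<^esub> v i) {..<r} = finsum N (\<lambda>i. c i \<odot>\<^bsub>N\<^esub> \<Phi> (w i)) {..<r}"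
      using w(2) v N by (intro N.finsum_cong') (auto simp: real_vspace_def Pi_iff)
    then have "finsum N (\<lambda>i. c i \<odot>\<^bsub>N\<^esub> v i) {..<r} = \<Phi> (finsum M (\<lambda>i. c i \<odot>\<^bsub>M\<^esub> w i) {..<r})"
      using linear_iso_combination[OF iso M N w(1), of c] by simp
    then show ?thesis
      using inj_on_image_mem_iff[OF bij_betw_imp_inj_on[OF bij] combination_closed[OF M w(1), of c] SM]
      by simp
  qed
  then show "open {c. finsum N (\<lambda>i. c i \<odot>\<^bsub>N\<^esub> v i) {..<r} \<in> \<Phi> ` S}"
    using S w(1) by (simp add: openin_usual_topology)
qed

lemma has_interior_linear_iso:
  assumes "linear_iso M N \<Phi>" "real_vspace M" "real_vspace N" "has_interior_in M K" "\<Phi> ` K \<subseteq> K'"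
  shows "has_interior_in N K'"
proof -
  let ?T = "usual_topology M interior_of K"
  have "openin (usual_topology N) (\<Phi> ` ?T)"
    by (rule openin_linear_iso[OF assms(1-3) openin_interior_of])
  moreover have "\<Phi> ` ?T \<subseteq> K'"
    using image_mono[OF interior_of_subset[of "usual_topology M" K], of \<Phi>] assms(5) by (rule subset_trans)
  ultimately have "\<Phi> ` ?T \<subseteq> usual_topology N interior_of K'" by (rule interior_of_maximal[rotated])
  then show ?thesis using assms(4) by (auto simp: has_interior_in_def)
qed

lemma linear_iso_inv_into:
  assumes iso: "linear_iso M N \<Phi>" and M: "real_vspace M"
  shows "linear_iso N M (inv_into (carrier M) \<Phi>)"
proof -
  interpret M: abelian_group M using M by (simp add: real_vspace_def)
  let ?i = "inv_into (carrier M) \<Phi>"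
  have bij: "bij_betw \<Phi> (carrier M) (carrier N)" using iso by (simp add: linear_iso_def)
  have i: "?i y \<in> carrier M" "\<Phi> (?i y) = y" if "y \<in> carrier N" for y
    using that bij by (auto simp: bij_betw_def inv_into_into f_inv_into_f)
  have iI: "?i y = x" if "x \<in> carrier M" "\<Phi> x = y" for x y
    using that bij by (auto simp: bij_betw_def)
  show ?thesis
    unfolding linear_iso_def
  proof (intro conjI ballI allI)
    fix x y assume xy: "x \<in> carrier N" "y \<in> carrier N"
    show "?i (x \<oplus>\<^bsub>N\<^esub> y) = ?i x \<oplus>\<^bsub>M\<^esub> ?i y"
      using iso i[OF xy(1)] i[OF xy(2)] by (intro iI) (auto simp: linear_iso_def)
    show "?i (t \<odot>\<^bsub>N\<^esub> x) = t \<odot>\<^bsub>M\<^esub> ?i x" for t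
      using iso M i[OF xy(1)] by (intro iI) (auto simp: linear_iso_def real_vspace_def)
  qed (rule bij_betw_inv_into[OF bij])
qed

lemma topspace_usual_topology:
  assumes "real_vspace M"
  shows "topspace (usual_topology M) = carrier M"
proof (rule antisym)
  have "openin (usual_topology M) (carrier M)"
    using combination_closed[OF assms] by (simp add: openin_usual_topology)
  then show "carrier M \<subseteq> topspace (usual_topology M)" by (rule openin_subset)
  show "topspace (usual_topology M) \<subseteq> carrier M"
    using openin_topspace[of "usual_topology M"] unfolding openin_usual_topology by blast
qed

section \<open>Vector space structure of the levels and of the inverse limit\<close>

lemma inv_poly_space_simps [simp]:
  "carrier (inv_poly_space F n d) = inv_polys F n d"
  "\<zero>\<^bsub>inv_poly_space F n d\<^esub> = (\<lambda>x. 0)"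
  "p \<oplus>\<^bsub>inv_poly_space F n d\<^esub> q = (\<lambda>x. p x + q x)"
  "t \<odot>\<^bsub>inv_poly_space F n d\<^esub> p = (\<lambda>x. t * p x)"
  by (simp_all add: inv_poly_space_def real_space_def)

lemma inverse_limit_space_simps [simp]:
  "carrier (inverse_limit_space U F d) = inverse_limit U F d"
  "\<zero>\<^bsub>inverse_limit_space U F d\<^esub> = (\<lambda>n x. 0)"
  "v \<oplus>\<^bsub>inverse_limit_space U F d\<^esub> w = (\<lambda>n x. v n x + w n x)"
  "t \<odot>\<^bsub>inverse_limit_space U F d\<^esub> w = (\<lambda>n x. t * w n x)"
  by (simp_all add: inverse_limit_space_def real_space_def)

lemma inverse_limit_add:
  "v \<in> inverse_limit U F d \<Longrightarrow> w \<in> inverse_limit U F d \<Longrightarrow> (\<lambda>n x. v n x + w n x) \<in> inverse_limit U F d"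
  using inverse_limit_linear[of v U F d w 1 1] by simp

lemma inverse_limit_scale:
  "w \<in> inverse_limit U F d \<Longrightarrow> (\<lambda>n x. t * w n x) \<in> inverse_limit U F d"
  using inverse_limit_linear[of w U F d w t 0] by simp

lemma inverse_limit_zero: "(\<lambda>n x. 0) \<in> inverse_limit U F d"
  by (auto simp: inverse_limit_def inv_polys_zero)

lemma inverse_limit_minus: "w \<in> inverse_limit U F d \<Longrightarrow> (\<lambda>n x. - w n x) \<in> inverse_limit U F d"
  using inverse_limit_scale[of w U F d "-1"] by simp

lemma inv_polys_add:
  "p \<in> inv_polys F n d \<Longrightarrow> q \<in> inv_polys F n d \<Longrightarrow> (\<lambda>x. p x + q x) \<in> inv_polys F n d"
  using inv_polys_linear[of p F n d q 1 1] by simp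

lemma inv_polys_minus: "p \<in> inv_polys F n d \<Longrightarrow> (\<lambda>x. - p x) \<in> inv_polys F n d"
  using inv_polys_scale[of p F n d "-1"] by simp

lemma abelian_group_inv_poly_space: "abelian_group (inv_poly_space F n d)"
proof (rule abelian_groupI; simp add: inv_polys_add inv_polys_zero)
  fix p assume "p \<in> inv_polys F n d"
  then show "\<exists>q\<in>inv_polys F n d. (\<lambda>x. q x + p x) = (\<lambda>x. 0)"
    by (intro bexI[of _ "\<lambda>x. - p x"] inv_polys_minus) auto
qed (auto simp: fun_eq_iff)

lemma abelian_group_inverse_limit_space: "abelian_group (inverse_limit_space U F d)"
proof (rule abelian_groupI; simp add: inverse_limit_add inverse_limit_zero)
  fix p assume "p \<in> inverse_limit U F d"
  then show "\<exists>q\<in>inverse_limit U F d. (\<lambda>n x. q n x + p n x) = (\<lambda>n x. 0)"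
    by (intro bexI[of _ "\<lambda>n x. - p n x"] inverse_limit_minus) auto
qed (auto simp: fun_eq_iff)

lemma real_vspace_inv_poly_space: "real_vspace (inv_poly_space F n d)"
  by (simp add: real_vspace_def abelian_group_inv_poly_space inv_polys_scale)

lemma real_vspace_inverse_limit_space: "real_vspace (inverse_limit_space U F d)"
  by (simp add: real_vspace_def abelian_group_inverse_limit_space inverse_limit_scale)

lemma finsum_inverse_limit_space:
  "v \<in> {..<r::nat} \<rightarrow> inverse_limit U F d \<Longrightarrow>
    finsum (inverse_limit_space U F d) (\<lambda>i. c i \<odot>\<^bsub>inverse_limit_space U F d\<^esub> v i) {..<r} =
      (\<lambda>n x. \<Sum>i<r. c i * v i n x)"
proof (induction r)
  case 0
  interpret abelian_group "inverse_limit_space U F d" by (rule abelian_group_inverse_limit_space)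
  show ?case using finsum_empty by simp
next
  case (Suc r)
  then have "v \<in> {..<r} \<rightarrow> inverse_limit U F d" by auto
  note IH = Suc.IH[OF this]
  have "finsum (inverse_limit_space U F d) (\<lambda>i. c i \<odot>\<^bsub>inverse_limit_space U F d\<^esub> v i) {..<Suc r} =
      (c r \<odot>\<^bsub>inverse_limit_space U F d\<^esub> v r) \<oplus>\<^bsub>inverse_limit_space U F d\<^esub>
      finsum (inverse_limit_space U F d) (\<lambda>i. c i \<odot>\<^bsub>inverse_limit_space U F d\<^esub> v i) {..<r}"
    using Suc.prems inverse_limit_scale
    by (intro finsum_lessThan_Suc real_vspace_inverse_limit_space) (auto simp: Pi_iff)
  then show ?case unfolding IH by (simp add: add.commute)
qed

lemma a_inv_inv_poly_space: "p \<in> inv_polys F n d \<Longrightarrow> \<ominus>\<^bsub>inv_poly_space F n d\<^esub> p = (\<lambda>x. - p x)"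
proof -
  assume p: "p \<in> inv_polys F n d"
  interpret abelian_group "inv_poly_space F n d" by (rule abelian_group_inv_poly_space)
  show ?thesis by (rule minus_equality) (use p inv_polys_minus in auto)
qed

lemma a_inv_inverse_limit_space:
  "p \<in> inverse_limit U F d \<Longrightarrow> \<ominus>\<^bsub>inverse_limit_space U F d\<^esub> p = (\<lambda>n x. - p n x)"
proof -
  assume p: "p \<in> inverse_limit U F d"
  interpret abelian_group "inverse_limit_space U F d" by (rule abelian_group_inverse_limit_space)
  show ?thesis by (rule minus_equality) (use p inverse_limit_minus in auto)
qed

lemma de_finetti_seq_0: "de_finetti_seq U F k q 0 = (\<lambda>x. 0)"
  by (simp add: de_finetti_seq_def)

lemma de_finetti_seq_linear:
  assumes "1 \<le> k"
  shows "de_finetti_seq U F k (\<lambda>x. s * p x + t * q x) =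
    (\<lambda>n x. s * de_finetti_seq U F k p n x + t * de_finetti_seq U F k q n x)"
proof
  fix n
  show "de_finetti_seq U F k (\<lambda>x. s * p x + t * q x) n =
    (\<lambda>x. s * de_finetti_seq U F k p n x + t * de_finetti_seq U F k q n x)"
    using de_finetti_linear[OF assms, of n U F s p t q] by (cases "1 \<le> n") (auto simp: de_finetti_seq_0 not_le)
qed

lemma de_finetti_seq_add:
  "1 \<le> k \<Longrightarrow> de_finetti_seq U F k (\<lambda>x. p x + q x) =
    (\<lambda>n x. de_finetti_seq U F k p n x + de_finetti_seq U F k q n x)"
  using de_finetti_seq_linear[of k U F 1 p 1 q] by simp

lemma de_finetti_seq_scale:
  "1 \<le> k \<Longrightarrow> de_finetti_seq U F k (\<lambda>x. s * p x) = (\<lambda>n x. s * de_finetti_seq U F k p n x)"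
  using de_finetti_seq_linear[of k U F s p 0 p] by simp

lemma de_finetti_seq_zero: "1 \<le> k \<Longrightarrow> de_finetti_seq U F k (\<lambda>x. 0) = (\<lambda>n x. 0)"
  using de_finetti_seq_scale[of k U F 0 "\<lambda>x. 0"] by simp

lemma de_finetti_seq_sum:
  assumes "1 \<le> k"
  shows "de_finetti_seq U F k (\<lambda>x. \<Sum>j\<in>J. q j x) = (\<lambda>n x. \<Sum>j\<in>J. de_finetti_seq U F k (q j) n x)"
  by (induction J rule: infinite_finite_induct)
    (simp_all add: de_finetti_seq_zero[OF assms] de_finetti_seq_add[OF assms])

lemma linear_iso_de_finetti:
  assumes "large F d n"
  shows "linear_iso (inv_poly_space F n d) (inverse_limit_space U F d) (de_finetti_seq U F n)"
  unfolding linear_iso_def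
  by (simp add: bij_betw_de_finetti[OF assms] de_finetti_seq_add[OF large_pos[OF assms]]
      de_finetti_seq_scale[OF large_pos[OF assms]])

section \<open>The direct limit as the set of fibres of the de Finetti map\<close>

lemma de_finetti_seq_sym_map:
  assumes "index_le (other U) k N"
  shows "de_finetti_seq U F N (sym_map (other U) F N k q) = de_finetti_seq U F k q"
proof
  fix n
  show "de_finetti_seq U F N (sym_map (other U) F N k q) n = de_finetti_seq U F k q n"
    using de_finetti_sym_map[OF assms, of n F q] by (cases "1 \<le> n") (auto simp: de_finetti_seq_0 not_le)
qed

text \<open>The fibre over \<open>w\<close> of the de Finetti maps of all levels together. These
  fibres are the elements of the direct limit, and \<open>dclass U F d\<close> is the inverse of the
  isomorphism.\<close>

definition dclass ::
  "base_seq \<Rightarrow> construction \<Rightarrow> nat \<Rightarrow> (nat \<Rightarrow> polyfun) \<Rightarrow> (nat \<times> polyfun) set" where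
  "dclass U F d w = {(m, r). 1 \<le> m \<and> r \<in> inv_polys F m d \<and> de_finetti_seq U F m r = w}"

lemma common_large_index:
  assumes "1 \<le> n" "1 \<le> m"
  obtains N where "index_le U n N" "index_le U m N" "large F d N"
proof -
  obtain l where l: "large F d l" using ex_large by blast
  have "large F d (l * (n * m))" by (rule large_mult[OF l one_le_mult[OF assms]])
  moreover have "index_le U n (n * (l * m))" "index_le U m (m * (l * n))"
    using assms large_pos[OF l] by (auto intro!: index_le_mult one_le_mult)
  ultimately show ?thesis using that by (simp add: mult_ac)
qed

text \<open>The de Finetti map is injective at every large index, so \<open>dlim_rel\<close> is its kernel relation;
  in particular it is an equivalence.\<close>

lemma dlim_rel_iff:
  "((n, q), (m, r)) \<in> dlim_rel (other U) F d \<longleftrightarrow> 1 \<le> n \<and> 1 \<le> m \<and> q \<in> inv_polys F n d \<and>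
     r \<in> inv_polys F m d \<and> de_finetti_seq U F n q = de_finetti_seq U F m r"
  (is "?L \<longleftrightarrow> ?R")
proof
  assume ?L
  then obtain N where N: "index_le (other U) n N" "index_le (other U) m N"
    "sym_map (other U) F N n q = sym_map (other U) F N m r" "q \<in> inv_polys F n d" "r \<in> inv_polys F m d"
    by (auto simp: dlim_rel_def)
  have "de_finetti_seq U F n q = de_finetti_seq U F m r"
    using de_finetti_seq_sym_map[OF N(1), of F q] de_finetti_seq_sym_map[OF N(2), of F r]
    by (simp only: N(3))
  with N(4,5) index_le_pos[OF N(1)] index_le_pos[OF N(2)] show ?R by simp
next
  assume R: ?R
  then obtain N where N: "index_le (other U) n N" "index_le (other U) m N" "large F d N"
    using common_large_index by blast
  have "sym_map (other U) F N n q = sym_map (other U) F N m r"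
  proof (rule inj_onD[OF bij_betw_imp_inj_on[OF bij_betw_de_finetti[OF N(3), where U = U]]])
    show "de_finetti_seq U F N (sym_map (other U) F N n q) = de_finetti_seq U F N (sym_map (other U) F N m r)"
      using R by (simp add: de_finetti_seq_sym_map[OF N(1)] de_finetti_seq_sym_map[OF N(2)])
  qed (use R N in \<open>auto intro: sym_map_inv_polys inv_polys_polys\<close>)
  then show ?L using R N by (auto simp: dlim_rel_def)
qed

lemma dlim_inj_eq:
  "1 \<le> k \<Longrightarrow> q \<in> inv_polys F k d \<Longrightarrow> dlim_inj (other U) F d k q = dclass U F d (de_finetti_seq U F k q)"
  by (auto simp: dlim_inj_def dclass_def dlim_rel_iff)

lemma dclass_rep:
  assumes "w \<in> inverse_limit U F d"
  obtains n q where "large F d n" "1 \<le> n" "q \<in> inv_polys F n d" "de_finetti_seq U F n q = w"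
proof -
  obtain n where n: "large F d n" using ex_large by blast
  obtain q where "q \<in> inv_polys F n d" "de_finetti_seq U F n q = w"
    using assms unfolding bij_betw_imp_surj_on[OF bij_betw_de_finetti[OF n], symmetric] by auto
  then show ?thesis using that[OF n large_pos[OF n]] by blast
qed

lemma inj_on_dclass: "inj_on (dclass U F d) (inverse_limit U F d)"
proof (rule inj_onI)
  fix v w assume vw: "v \<in> inverse_limit U F d" "dclass U F d v = dclass U F d w"
  obtain n q where "1 \<le> n" "q \<in> inv_polys F n d" "de_finetti_seq U F n q = v"
    by (rule dclass_rep[OF vw(1)])
  then have "(n, q) \<in> dclass U F d w" unfolding vw(2)[symmetric] by (simp add: dclass_def)
  then show "v = w" using \<open>de_finetti_seq U F n q = v\<close> by (simp add: dclass_def)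
qed

lemma direct_limit_eq: "direct_limit (other U) F d = dclass U F d ` inverse_limit U F d"
proof (intro equalityI subsetI)
  fix X assume "X \<in> direct_limit (other U) F d"
  then obtain n q where n: "1 \<le> n" "q \<in> inv_polys F n d" "X = dlim_inj (other U) F d n q"
    by (auto simp: direct_limit_def quotient_def dlim_inj_def)
  then show "X \<in> dclass U F d ` inverse_limit U F d"
    using dlim_inj_eq[OF n(1,2), of U] de_finetti_in_inverse_limit[OF n(1) inv_polys_polys[OF n(2)], of U]
    by blast
next
  fix X assume "X \<in> dclass U F d ` inverse_limit U F d"
  then obtain w where w: "w \<in> inverse_limit U F d" "X = dclass U F d w" by blast
  obtain n q where n: "1 \<le> n" "q \<in> inv_polys F n d" "de_finetti_seq U F n q = w"
    by (rule dclass_rep[OF w(1)])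
  then have "X = dlim_rel (other U) F d `` {(n, q)}"
    using w(2) dlim_inj_eq[OF n(1,2), of U] by (simp add: dlim_inj_def)
  then show "X \<in> direct_limit (other U) F d"
    unfolding direct_limit_def using n by (auto intro!: quotientI)
qed

lemma mem_dlim_add:
  "z \<in> dlim_add L F d X Y \<longleftrightarrow> (\<exists>n q m r N. (n, q) \<in> X \<and> (m, r) \<in> Y \<and> index_le L n N \<and>
    index_le L m N \<and> z \<in> dlim_inj L F d N (\<lambda>x. sym_map L F N n q x + sym_map L F N m r x))"
  unfolding dlim_add_def UN_iff Bex_def split_paired_Ex case_prod_conv mem_Collect_eq by simp

lemma mem_dlim_scale:
  "z \<in> dlim_scale L F d t X \<longleftrightarrow> (\<exists>n q. (n, q) \<in> X \<and> z \<in> dlim_inj L F d n (\<lambda>x. t * q x))"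
  unfolding dlim_scale_def UN_iff Bex_def split_paired_Ex case_prod_conv by simp

text \<open>\<open>dlim_add\<close> is a union over all representatives and all common indices.
  Every choice gives the same class and some choice exists, so the union is that class.\<close>

lemma dlim_add_dclass:
  assumes v: "v \<in> inverse_limit U F d" and w: "w \<in> inverse_limit U F d"
  shows "dlim_add (other U) F d (dclass U F d v) (dclass U F d w) = dclass U F d (\<lambda>n x. v n x + w n x)"
proof -
  let ?S = "\<lambda>n q m r N. dlim_inj (other U) F d N
    (\<lambda>x. sym_map (other U) F N n q x + sym_map (other U) F N m r x)"
  have S: "?S n q m r N = dclass U F d (\<lambda>n x. v n x + w n x)"
    if "(n, q) \<in> dclass U F d v" "(m, r) \<in> dclass U F d w" "index_le (other U) n N" "index_le (other U) m N"
    for n q m r N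
  proof -
    have N: "1 \<le> N" using index_le_pos[OF that(3)] by simp
    have sym: "sym_map (other U) F N n q \<in> inv_polys F N d" "sym_map (other U) F N m r \<in> inv_polys F N d"
      using that by (auto simp: dclass_def intro: sym_map_inv_polys inv_polys_polys)
    show ?thesis
      using that(1,2) unfolding dlim_inj_eq[OF N inv_polys_add[OF sym]] de_finetti_seq_add[OF N]
        de_finetti_seq_sym_map[OF that(3)] de_finetti_seq_sym_map[OF that(4)]
      by (simp add: dclass_def)
  qed
  obtain n q where n: "1 \<le> n" "q \<in> inv_polys F n d" "de_finetti_seq U F n q = v"
    by (rule dclass_rep[OF v])
  obtain m r where m: "1 \<le> m" "r \<in> inv_polys F m d" "de_finetti_seq U F m r = w"
    by (rule dclass_rep[OF w])
  obtain N where N: "index_le (other U) n N" "index_le (other U) m N"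
    using common_large_index[OF n(1) m(1)] by metis
  have nm: "(n, q) \<in> dclass U F d v" "(m, r) \<in> dclass U F d w" using n m by (auto simp: dclass_def)
  show ?thesis
  proof
    show "dlim_add (other U) F d (dclass U F d v) (dclass U F d w) \<subseteq> dclass U F d (\<lambda>n x. v n x + w n x)"
    proof
      fix z assume "z \<in> dlim_add (other U) F d (dclass U F d v) (dclass U F d w)"
      then obtain n q m r N where "(n, q) \<in> dclass U F d v" "(m, r) \<in> dclass U F d w"
        "index_le (other U) n N" "index_le (other U) m N" "z \<in> ?S n q m r N"
        unfolding mem_dlim_add by blast
      then show "z \<in> dclass U F d (\<lambda>n x. v n x + w n x)" by (simp only: S)
    qed
    show "dclass U F d (\<lambda>n x. v n x + w n x) \<subseteq> dlim_add (other U) F d (dclass U F d v) (dclass U F d w)"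
    proof
      fix z assume "z \<in> dclass U F d (\<lambda>n x. v n x + w n x)"
      then have "z \<in> ?S n q m r N" by (simp only: S[OF nm N])
      then show "z \<in> dlim_add (other U) F d (dclass U F d v) (dclass U F d w)"
        unfolding mem_dlim_add using nm N by blast
    qed
  qed
qed

lemma dlim_scale_dclass:
  assumes w: "w \<in> inverse_limit U F d"
  shows "dlim_scale (other U) F d t (dclass U F d w) = dclass U F d (\<lambda>n x. t * w n x)"
proof -
  have S: "dlim_inj (other U) F d n (\<lambda>x. t * q x) = dclass U F d (\<lambda>n x. t * w n x)"
    if "(n, q) \<in> dclass U F d w" for n q
    using that by (auto simp: dclass_def dlim_inj_eq inv_polys_scale de_finetti_seq_scale)
  obtain n q where "1 \<le> n" "q \<in> inv_polys F n d" "de_finetti_seq U F n q = w"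
    by (rule dclass_rep[OF w])
  then have nq: "(n, q) \<in> dclass U F d w" by (auto simp: dclass_def)
  show ?thesis
  proof
    show "dlim_scale (other U) F d t (dclass U F d w) \<subseteq> dclass U F d (\<lambda>n x. t * w n x)"
    proof
      fix z assume "z \<in> dlim_scale (other U) F d t (dclass U F d w)"
      then obtain n q where "(n, q) \<in> dclass U F d w" "z \<in> dlim_inj (other U) F d n (\<lambda>x. t * q x)"
        unfolding mem_dlim_scale by blast
      then show "z \<in> dclass U F d (\<lambda>n x. t * w n x)" by (simp only: S)
    qed
    show "dclass U F d (\<lambda>n x. t * w n x) \<subseteq> dlim_scale (other U) F d t (dclass U F d w)"
    proof
      fix z assume "z \<in> dclass U F d (\<lambda>n x. t * w n x)"
      then have "z \<in> dlim_inj (other U) F d n (\<lambda>x. t * q x)" by (simp only: S[OF nq])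
      then show "z \<in> dlim_scale (other U) F d t (dclass U F d w)"
        unfolding mem_dlim_scale using nq by blast
    qed
  qed
qed

lemma direct_limit_space_simps [simp]:
  "carrier (direct_limit_space (other U) F d) = dclass U F d ` inverse_limit U F d"
  "\<zero>\<^bsub>direct_limit_space (other U) F d\<^esub> = dclass U F d (\<lambda>n x. 0)"
  "v \<in> inverse_limit U F d \<Longrightarrow> w \<in> inverse_limit U F d \<Longrightarrow>
    dclass U F d v \<oplus>\<^bsub>direct_limit_space (other U) F d\<^esub> dclass U F d w =
      dclass U F d (\<lambda>n x. v n x + w n x)"
  "w \<in> inverse_limit U F d \<Longrightarrow>
    t \<odot>\<^bsub>direct_limit_space (other U) F d\<^esub> dclass U F d w = dclass U F d (\<lambda>n x. t * w n x)"
  by (simp_all add: direct_limit_space_def real_space_def direct_limit_eq dlim_add_dclass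
      dlim_scale_dclass dlim_inj_eq inv_polys_zero de_finetti_seq_zero)

text \<open>\<open>dclass\<close> carries the operations of the inverse limit to those of the direct
  limit, so the laws are inherited.\<close>

lemma abelian_group_direct_limit_space: "abelian_group (direct_limit_space (other U) F d)"
proof (rule abelian_groupI)
  let ?D = "direct_limit_space (other U) F d"
  fix x y z assume "x \<in> carrier ?D" "y \<in> carrier ?D" "z \<in> carrier ?D"
  then obtain u v w where "x = dclass U F d u" "y = dclass U F d v" "z = dclass U F d w"
    "u \<in> inverse_limit U F d" "v \<in> inverse_limit U F d" "w \<in> inverse_limit U F d" by auto
  then show "x \<oplus>\<^bsub>?D\<^esub> y \<oplus>\<^bsub>?D\<^esub> z = x \<oplus>\<^bsub>?D\<^esub> (y \<oplus>\<^bsub>?D\<^esub> z)"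
    by (simp add: inverse_limit_add add.assoc)
next
  let ?D = "direct_limit_space (other U) F d"
  fix x y assume "x \<in> carrier ?D" "y \<in> carrier ?D"
  then obtain u v where "x = dclass U F d u" "y = dclass U F d v"
    "u \<in> inverse_limit U F d" "v \<in> inverse_limit U F d" by auto
  then show "x \<oplus>\<^bsub>?D\<^esub> y \<in> carrier ?D" "x \<oplus>\<^bsub>?D\<^esub> y = y \<oplus>\<^bsub>?D\<^esub> x"
    by (auto simp: inverse_limit_add add.commute)
next
  let ?D = "direct_limit_space (other U) F d"
  fix x assume "x \<in> carrier ?D"
  then obtain u where u: "x = dclass U F d u" "u \<in> inverse_limit U F d" by auto
  then show "\<zero>\<^bsub>?D\<^esub> \<oplus>\<^bsub>?D\<^esub> x = x" by (simp add: inverse_limit_zero)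
  show "\<exists>y\<in>carrier ?D. y \<oplus>\<^bsub>?D\<^esub> x = \<zero>\<^bsub>?D\<^esub>"
    using u inverse_limit_minus[OF u(2)]
    by (intro bexI[of _ "dclass U F d (\<lambda>n x. - u n x)"]) auto
qed (simp add: inverse_limit_zero)

lemma real_vspace_direct_limit_space: "real_vspace (direct_limit_space (other U) F d)"
  by (auto simp: real_vspace_def abelian_group_direct_limit_space inverse_limit_scale)

lemma a_inv_direct_limit_space:
  assumes "w \<in> inverse_limit U F d"
  shows "\<ominus>\<^bsub>direct_limit_space (other U) F d\<^esub> (dclass U F d w) = dclass U F d (\<lambda>n x. - w n x)"
proof -
  interpret abelian_group "direct_limit_space (other U) F d" by (rule abelian_group_direct_limit_space)
  show ?thesis by (rule minus_equality) (use assms inverse_limit_minus in auto)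
qed

lemma linear_iso_direct_limit:
  "linear_iso (direct_limit_space (other U) F d) (inverse_limit_space U F d)
    (inv_into (inverse_limit U F d) (dclass U F d))"
proof -
  have bij: "bij_betw (dclass U F d) (inverse_limit U F d) (dclass U F d ` inverse_limit U F d)"
    using inj_on_dclass by (rule inj_on_imp_bij_betw)
  show ?thesis
    unfolding linear_iso_def using bij_betw_inv_into[OF bij]
    by (auto simp: inv_into_f_f[OF inj_on_dclass] inverse_limit_add inverse_limit_scale)
qed

section \<open>Cones\<close>

lemma compatible_embed:
  "finset_compatible F U L \<Omega> \<Longrightarrow> index_le U n N \<Longrightarrow> x \<in> \<Omega> n \<Longrightarrow> embed U F N n x \<in> \<Omega> N"
  unfolding finset_compatible_def by blast

lemma compatible_embed_adj:
  "finset_compatible F U L \<Omega> \<Longrightarrow> index_le L n N \<Longrightarrow> x \<in> \<Omega> N \<Longrightarrow> embed_adj L F N n x \<in> \<Omega> n"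
  unfolding finset_compatible_def by blast

lemma compatible_act:
  "finset_compatible F U L \<Omega> \<Longrightarrow> 1 \<le> n \<Longrightarrow> \<sigma> permutes {1..n} \<Longrightarrow> x \<in> \<Omega> n \<Longrightarrow> act F n \<sigma> x \<in> \<Omega> n"
  unfolding finset_compatible_def by blast

text \<open>The permutation sends the \<open>i\<close>-th point to the \<open>i\<close>-th element of the block of its image.\<close>

lemma factor_through_block:
  assumes "1 \<le> a" "1 \<le> b" and f: "f ` {1..a} \<subseteq> {1..b}"
  obtains \<tau> where "\<tau> permutes {1..a * b}" "\<And>i. i \<in> {1..a} \<Longrightarrow> block (a * b) b (\<tau> i) = f i"
proof -
  let ?h = "\<lambda>i. (f i - 1) * a + i"
  have div: "a * b div b = a" using assms by simp
  have block: "block (a * b) b (?h i) = f i" if i: "i \<in> {1..a}" for i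
  proof -
    have "f i \<in> {1..b}" using f i by blast
    then have "1 \<le> f i" by simp
    have "(?h i - 1) = (i - 1) + (f i - 1) * a" using i by simp
    also have "\<dots> div a = f i - 1" using i assms(1) by (subst div_mult_self1) auto
    finally show ?thesis using \<open>1 \<le> f i\<close> by (simp add: block_def div)
  qed
  have inj: "inj_on ?h {1..a}"
  proof (rule inj_onI)
    fix i j assume ij: "i \<in> {1..a}" "j \<in> {1..a}" "?h i = ?h j"
    then have "f i = f j" using block[OF ij(1)] block[OF ij(2)] by simp
    with ij(3) show "i = j" by simp
  qed
  have range: "?h ` {1..a} \<subseteq> {1..a * b}"
  proof (rule image_subsetI)
    fix i assume i: "i \<in> {1..a}"
    then have "f i \<in> {1..b}" using f by blast
    then have "(f i - 1) * a \<le> (b - 1) * a" by (intro mult_le_mono1) auto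
    also have "(b - 1) * a = a * b - a" by (simp only: diff_mult_distrib mult.commute[of b a] mult_1)
    finally have "(f i - 1) * a + i \<le> a * b - a + a" using i by (intro add_mono) auto
    moreover have "a \<le> a * b" using assms by simp
    ultimately show "?h i \<in> {1..a * b}" using i by auto
  qed
  have "{1..a} \<subseteq> {1..a * b}" using mult_le_mono2[OF assms(2), of a] by auto
  then show ?thesis
    using that block
    by (elim extend_inj_to_permutation[OF finite_atLeastAtMost _ inj range]) metis
qed

text \<open>Through level \<open>k * n\<close> the map factors as an embedding of the first
  sequence, a permutation, and the adjoint of an embedding of the second, and compatibility covers
  each of the three. The permutation comes from \<open>factor_through_block\<close>.\<close>

lemma compatible_dmap:
  assumes comp: "finset_compatible F U (other U) \<Omega>" and k: "1 \<le> k" "1 \<le> n"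
    and f: "f \<in> ehoms U k n" and x: "x \<in> \<Omega> n"
  shows "dmap U F k n f x \<in> \<Omega> k"
proof -
  let ?N = "k * n" and ?e = "emap U (k * n) n" and ?b = "emap (other U) (k * n) k"
  have idx: "index_le U n ?N" "index_le (other U) k ?N"
    using k index_le_mult' index_le_mult by auto
  have pos: "1 \<le> ?N" using index_le_pos[OF idx(1)] by simp
  obtain \<sigma> where \<sigma>: "\<sigma> permutes {1..?N}"
    "\<And>i. i \<in> {1..src U k n} \<Longrightarrow> hcomp U (hcomp U ?b (pmap U \<sigma>)) ?e i = f i"
  proof (cases U)
    case Duplication
    then have "f ` {1..k} \<subseteq> {1..n}" using f by (auto simp: ehoms_def)
    then obtain \<tau> where \<tau>: "\<tau> permutes {1..?N}" "\<And>i. i \<in> {1..k} \<Longrightarrow> block ?N n (\<tau> i) = f i"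
      using factor_through_block[OF k] by blast
    \<comment> \<open>\<open>pmap Duplication\<close> inverts its argument, so the witness is the
      inverse of \<open>\<tau>\<close>.\<close>
    show ?thesis
      by (rule that[of "inv_into UNIV \<tau>"])
        (use \<tau> permutes_inv[OF \<tau>(1)] in \<open>auto simp: Duplication permutes_inv_inv\<close>)
  next
    case ZeroPadding
    then have "f ` {1..n} \<subseteq> {1..k}" using f by (auto simp: ehoms_def)
    then obtain \<tau> where \<tau>: "\<tau> permutes {1..?N}" "\<And>i. i \<in> {1..n} \<Longrightarrow> block ?N k (\<tau> i) = f i"
      using factor_through_block[OF k(2,1)] by (metis mult.commute)
    show ?thesis by (rule that[of \<tau>]) (use \<tau> in \<open>auto simp: ZeroPadding\<close>)
  qed
  have "embed_adj (other U) F ?N k (act F ?N \<sigma> (embed U F ?N n x)) \<in> \<Omega> k"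
    using comp idx pos \<sigma>(1) x by (intro compatible_embed_adj compatible_act compatible_embed)
  also have "embed_adj (other U) F ?N k (act F ?N \<sigma> (embed U F ?N n x)) =
      dmap U F k n (hcomp U (hcomp U ?b (pmap U \<sigma>)) ?e) x"
    unfolding embed_adj_eq_dmap[OF idx(2)] act_eq_dmap[OF \<sigma>(1), of F U] embed_eq_dmap[OF idx(1)]
    by (simp only: dmap_dmap[OF emap_other_homs[OF idx(2)] pmap_homs[OF \<sigma>(1)]]
        dmap_dmap[OF hcomp_homs[OF emap_other_homs[OF idx(2)] pmap_homs[OF \<sigma>(1)]] emap_homs[OF idx(1)]])
  also have "\<dots> = dmap U F k n f x" using dmap_cong[OF \<sigma>(2)] by simp
  finally show ?thesis .
qed

section \<open>Nonnegative polynomials and the two limit cones\<close>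

lemma pos_coneD:
  "q \<in> pos_cone F d \<Omega> n \<Longrightarrow> q \<in> inv_polys F n d"
  "q \<in> pos_cone F d \<Omega> n \<Longrightarrow> x \<in> \<Omega> n \<Longrightarrow> 0 \<le> q x"
  by (auto simp: pos_cone_def)

lemma pos_cone_add:
  "p \<in> pos_cone F d \<Omega> n \<Longrightarrow> q \<in> pos_cone F d \<Omega> n \<Longrightarrow> (\<lambda>x. p x + q x) \<in> pos_cone F d \<Omega> n"
  by (simp add: pos_cone_def inv_polys_add)

lemma pos_cone_scale:
  "q \<in> pos_cone F d \<Omega> n \<Longrightarrow> 0 \<le> t \<Longrightarrow> (\<lambda>x. t * q x) \<in> pos_cone F d \<Omega> n"
  by (simp add: pos_cone_def inv_polys_scale)

lemma pos_cone_zero: "(\<lambda>x. 0) \<in> pos_cone F d \<Omega> n"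
  by (simp add: pos_cone_def inv_polys_zero)

lemma de_finetti_pos_cone:
  assumes comp: "finset_compatible F U (other U) \<Omega>" and k: "1 \<le> k" "1 \<le> n"
    and q: "q \<in> pos_cone F d \<Omega> k"
  shows "de_finetti_seq U F k q n \<in> pos_cone F d \<Omega> n"
  unfolding pos_cone_def
proof (intro CollectI conjI ballI)
  show "de_finetti_seq U F k q n \<in> inv_polys F n d"
    using k pos_coneD(1)[OF q] by (intro de_finetti_inv_polys inv_polys_polys)
  fix x assume "x \<in> \<Omega> n"
  then show "0 \<le> de_finetti_seq U F k q n x"
    unfolding de_finetti_seq_eq[OF k]
    by (intro divide_nonneg_nonneg sum_nonneg pos_coneD(2)[OF q] compatible_dmap[OF comp k]) auto
qed

lemma sym_map_pos_cone:
  assumes comp: "finset_compatible F U (other U) \<Omega>" and idx: "index_le (other U) n N"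
    and q: "q \<in> pos_cone F d \<Omega> n"
  shows "sym_map (other U) F N n q \<in> pos_cone F d \<Omega> N"
  unfolding pos_cone_def
proof (intro CollectI conjI ballI)
  show "sym_map (other U) F N n q \<in> inv_polys F N d"
    using idx pos_coneD(1)[OF q] by (intro sym_map_inv_polys inv_polys_polys)
  fix x assume "x \<in> \<Omega> N"
  then show "0 \<le> sym_map (other U) F N n q x"
    unfolding sym_map_def using index_le_pos[OF idx]
    by (intro mult_nonneg_nonneg sum_nonneg pos_coneD(2)[OF q] compatible_embed_adj[OF comp idx]
        compatible_act[OF comp]) auto
qed

lemma inverse_limit_cone_iff:
  "w \<in> inverse_limit_cone U F d \<Omega> \<longleftrightarrow>
    w \<in> inverse_limit U F d \<and> (\<forall>n\<ge>1. \<forall>x\<in>\<Omega> n. 0 \<le> w n x)"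
  using inverse_limitD(2)[of w U F d]
  by (auto simp: inverse_limit_cone_def outer_cone_def pos_cone_def)

lemma inverse_limit_cone_pos_cone:
  "w \<in> inverse_limit_cone U F d \<Omega> \<Longrightarrow> 1 \<le> n \<Longrightarrow> w n \<in> pos_cone F d \<Omega> n"
  by (auto simp: inverse_limit_cone_def outer_cone_def)

text \<open>The image of the direct limit cone under the isomorphism, described without equivalence
  classes, so that the arguments can take place in the inverse limit.\<close>

definition limit_cone ::
  "base_seq \<Rightarrow> construction \<Rightarrow> nat \<Rightarrow> (nat \<Rightarrow> vec set) \<Rightarrow> (nat \<Rightarrow> polyfun) set" where
  "limit_cone U F d \<Omega> = (\<Union>n\<in>{1..}. de_finetti_seq U F n ` pos_cone F d \<Omega> n)"

lemma limit_coneI: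
  "1 \<le> n \<Longrightarrow> q \<in> pos_cone F d \<Omega> n \<Longrightarrow> de_finetti_seq U F n q \<in> limit_cone U F d \<Omega>"
  by (auto simp: limit_cone_def)

lemma limit_coneE:
  assumes "w \<in> limit_cone U F d \<Omega>"
  obtains n q where "1 \<le> n" "q \<in> pos_cone F d \<Omega> n" "de_finetti_seq U F n q = w"
  using assms by (auto simp: limit_cone_def)

lemma limit_cone_subset: "limit_cone U F d \<Omega> \<subseteq> inverse_limit U F d"
  by (auto simp: limit_cone_def intro!: de_finetti_in_inverse_limit dest!: pos_coneD(1)
      intro: inv_polys_polys)

lemma direct_limit_cone_eq:
  "direct_limit_cone (other U) F d \<Omega> = dclass U F d ` limit_cone U F d \<Omega>"
  unfolding direct_limit_cone_def limit_cone_def inner_cone_def image_UN image_image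
  using dlim_inj_eq[of _ _ F d U] pos_coneD(1) by (intro SUP_cong image_cong) auto

text \<open>Symmetrising up to a common large index preserves nonnegativity and the de Finetti
  sequence. So the union defining the cone is directed, which gives closure under sums.\<close>

lemma limit_cone_common:
  assumes comp: "finset_compatible F U (other U) \<Omega>"
    and "v \<in> limit_cone U F d \<Omega>" "w \<in> limit_cone U F d \<Omega>"
  obtains N p q where "large F d N" "1 \<le> N" "p \<in> pos_cone F d \<Omega> N" "q \<in> pos_cone F d \<Omega> N"
    "de_finetti_seq U F N p = v" "de_finetti_seq U F N q = w"
proof -
  obtain n p where p: "1 \<le> n" "p \<in> pos_cone F d \<Omega> n" "de_finetti_seq U F n p = v"
    using assms(2) by (rule limit_coneE)
  obtain m q where q: "1 \<le> m" "q \<in> pos_cone F d \<Omega> m" "de_finetti_seq U F m q = w"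
    using assms(3) by (rule limit_coneE)
  obtain N where N: "index_le (other U) n N" "index_le (other U) m N" "large F d N"
    using common_large_index[OF p(1) q(1)] by metis
  show ?thesis
    by (rule that[OF N(3) large_pos[OF N(3)] sym_map_pos_cone[OF comp N(1) p(2)]
          sym_map_pos_cone[OF comp N(2) q(2)]])
      (simp_all add: de_finetti_seq_sym_map N p q)
qed

lemma limit_cone_scale:
  "w \<in> limit_cone U F d \<Omega> \<Longrightarrow> 0 \<le> t \<Longrightarrow> (\<lambda>n x. t * w n x) \<in> limit_cone U F d \<Omega>"
  by (elim limit_coneE) (auto simp: de_finetti_seq_scale[symmetric] intro!: limit_coneI pos_cone_scale)

lemma limit_cone_add:
  assumes "finset_compatible F U (other U) \<Omega>"
    and "v \<in> limit_cone U F d \<Omega>" "w \<in> limit_cone U F d \<Omega>"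
  shows "(\<lambda>n x. v n x + w n x) \<in> limit_cone U F d \<Omega>"
proof -
  obtain N p q where "1 \<le> N" "p \<in> pos_cone F d \<Omega> N" "q \<in> pos_cone F d \<Omega> N"
    "de_finetti_seq U F N p = v" "de_finetti_seq U F N q = w"
    by (rule limit_cone_common[OF assms])
  then show ?thesis
    using limit_coneI[OF _ pos_cone_add, of N p F d \<Omega> q U] by (simp add: de_finetti_seq_add)
qed

lemma limit_cone_subset_inverse_limit_cone:
  assumes "finset_compatible F U (other U) \<Omega>"
  shows "limit_cone U F d \<Omega> \<subseteq> inverse_limit_cone U F d \<Omega>"
proof
  fix w assume w: "w \<in> limit_cone U F d \<Omega>"
  then obtain k q where q: "1 \<le> k" "q \<in> pos_cone F d \<Omega> k" "de_finetti_seq U F k q = w"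
    by (rule limit_coneE)
  have "w n \<in> pos_cone F d \<Omega> n" if "1 \<le> n" for n
    using de_finetti_pos_cone[OF assms q(1) that q(2)] by (simp add: q(3))
  then show "w \<in> inverse_limit_cone U F d \<Omega>"
    using subsetD[OF limit_cone_subset w] pos_coneD(2) unfolding inverse_limit_cone_iff by blast
qed

lemma outer_cone_mono:
  assumes comp: "finset_compatible F U (other U) \<Omega>" and idx: "index_le U n N"
  shows "outer_cone U F d \<Omega> N \<subseteq> outer_cone U F d \<Omega> n"
proof
  fix p assume "p \<in> outer_cone U F d \<Omega> N"
  then have p: "p \<in> inverse_limit U F d" "p N \<in> pos_cone F d \<Omega> N" by (auto simp: outer_cone_def)
  have "0 \<le> p n x" if "x \<in> \<Omega> n" for x
    using pos_coneD(2)[OF p(2) compatible_embed[OF comp idx that]] inverse_limit_embed[OF p(1) idx]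
    by simp
  then show "p \<in> outer_cone U F d \<Omega> n"
    using p index_le_pos[OF idx] by (auto simp: outer_cone_def pos_cone_def inverse_limitD)
qed

lemma inner_cone_mono:
  assumes comp: "finset_compatible F U (other U) \<Omega>" and idx: "index_le (other U) n N"
  shows "inner_cone (other U) F d \<Omega> n \<subseteq> inner_cone (other U) F d \<Omega> N"
  unfolding inner_cone_def
proof (rule image_subsetI)
  fix q assume q: "q \<in> pos_cone F d \<Omega> n"
  have s: "sym_map (other U) F N n q \<in> pos_cone F d \<Omega> N" by (rule sym_map_pos_cone[OF comp idx q])
  have "dlim_inj (other U) F d n q = dlim_inj (other U) F d N (sym_map (other U) F N n q)"
    using index_le_pos[OF idx] pos_coneD(1)[OF q] pos_coneD(1)[OF s]
    by (simp add: dlim_inj_eq de_finetti_seq_sym_map[OF idx])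
  with s show "dlim_inj (other U) F d n q \<in> dlim_inj (other U) F d N ` pos_cone F d \<Omega> N" by blast
qed

text \<open>Each condition \<open>0 \<le> w n x\<close> is linear in \<open>w\<close>, so in every
  chart the complement is a union of open half-spaces or empty sets.\<close>

lemma closedin_inverse_limit_cone:
  "closedin (usual_topology (inverse_limit_space U F d)) (inverse_limit_cone U F d \<Omega>)"
proof -
  let ?W = "inverse_limit_space U F d"
  have "open {c. finsum ?W (\<lambda>i. c i \<odot>\<^bsub>?W\<^esub> v i) {..<r} \<in> carrier ?W - inverse_limit_cone U F d \<Omega>}"
    if v: "v \<in> {..<r::nat} \<rightarrow> carrier ?W" for r v
  proof -
    have v': "v \<in> {..<r} \<rightarrow> inverse_limit U F d" using v by simp
    have "finsum ?W (\<lambda>i. c i \<odot>\<^bsub>?W\<^esub> v i) {..<r} \<in> carrier ?W - inverse_limit_cone U F d \<Omega> \<longleftrightarrow>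
        (\<exists>n\<in>{1..}. \<exists>x\<in>\<Omega> n. (\<Sum>i<r. c i * v i n x) < 0)" for c
      using combination_closed[OF real_vspace_inverse_limit_space v, of c]
      unfolding finsum_inverse_limit_space[OF v']
      by (auto simp: inverse_limit_cone_iff not_le)
    then have "{c. finsum ?W (\<lambda>i. c i \<odot>\<^bsub>?W\<^esub> v i) {..<r} \<in> carrier ?W - inverse_limit_cone U F d \<Omega>} =
        (\<Union>n\<in>{1..}. \<Union>x\<in>\<Omega> n. {c. (\<Sum>i<r. c i * v i n x) < 0})"
      by blast
    also have "open \<dots>"
      by (intro open_UN ballI open_Collect_less continuous_intros continuous_on_product_coordinates)
    finally show ?thesis .
  qed
  then have "openin (usual_topology ?W) (carrier ?W - inverse_limit_cone U F d \<Omega>)"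
    unfolding openin_usual_topology by blast
  then show ?thesis
    unfolding closedin_def topspace_usual_topology[OF real_vspace_inverse_limit_space]
    by (auto simp: inverse_limit_cone_iff)
qed

section \<open>Density of the direct limit cone\<close>

lemma tendsto_nat_fun:
  fixes c :: "nat \<Rightarrow> nat \<Rightarrow> real"
  assumes "\<And>i. (\<lambda>j. c j i) \<longlonglongrightarrow> l i"
  shows "c \<longlonglongrightarrow> l"
proof -
  have "limitin (product_topology (\<lambda>i::nat. euclidean :: real topology) UNIV) c l sequentially"
    using assms by (simp add: limitin_componentwise)
  then show ?thesis by (simp add: euclidean_product_topology)
qed

text \<open>The de Finetti images of the components of a point of the cone lie in
  \<open>limit_cone\<close> and converge to this point. The convergence takes place in a chart of
  \<open>usual_topology\<close> built from the \<open>sym_monom\<close> of one large level.\<close>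

lemma inverse_limit_cone_subset_closure:
  "inverse_limit_cone U F d \<Omega> \<subseteq>
    usual_topology (inverse_limit_space U F d) closure_of limit_cone U F d \<Omega>"
proof
  fix w assume w: "w \<in> inverse_limit_cone U F d \<Omega>"
  let ?W = "inverse_limit_space U F d"
  have wW: "w \<in> inverse_limit U F d" using w by (simp add: inverse_limit_cone_iff)
  obtain n where n: "large F d n" using ex_large by blast
  have pos: "1 \<le> n" using large_pos[OF n] .
  note surj = bij_betw_imp_surj_on[OF bij_betw_de_finetti[OF n, where U = U]]
  define y where "y j = de_finetti_seq U F (n * Suc j) (w (n * Suc j))" for j
  have y_cone: "y j \<in> limit_cone U F d \<Omega>" for j
    unfolding y_def using pos by (intro limit_coneI inverse_limit_cone_pos_cone[OF w] one_le_mult) auto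
  have "\<exists>q. q \<in> inv_polys F n d \<and> de_finetti_seq U F n q = y j" for j
    using subsetD[OF limit_cone_subset y_cone[of j]] unfolding surj[symmetric] by auto
  then obtain q where q: "\<And>j. q j \<in> inv_polys F n d" "\<And>j. de_finetti_seq U F n (q j) = y j" by metis
  obtain q' where q': "q' \<in> inv_polys F n d" "de_finetti_seq U F n q' = w"
    using wW unfolding surj[symmetric] by (elim imageE) simp
  \<comment> \<open>Charts are indexed by initial segments of the naturals, so the monomials are
    enumerated.\<close>
  obtain r and en :: "nat \<Rightarrow> label multiset" where en: "bij_betw en {..<r} (mons F n d)"
    using ex_bij_betw_nat_finite[OF finite_mons, of F n d] by (auto simp: atLeast0LessThan)
  define v where "v i = de_finetti_seq U F n (sym_monom U F n d (en i))" for i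
  have v: "v \<in> {..<r} \<rightarrow> inverse_limit U F d"
    unfolding v_def using pos
    by (auto intro!: de_finetti_in_inverse_limit inv_polys_polys[OF sym_monom_inv_polys])
  \<comment> \<open>Zero from \<open>r\<close> on, so that convergence of the first \<open>r\<close>
    coordinates is convergence in the product topology.\<close>
  define c where "c p i = (if i < r then coef U F n d p (en i) else 0)" for p i
  have comb: "finsum ?W (\<lambda>i. c p i \<odot>\<^bsub>?W\<^esub> v i) {..<r} = de_finetti_seq U F n p"
    if p: "p \<in> inv_polys F n d" for p
  proof -
    have "p = (\<lambda>x. \<Sum>M\<in>mons F n d. coef U F n d p M * sym_monom U F n d M x)"
      using inv_polys_expansion[OF pos p, where U = U] by (simp add: fun_eq_iff)
    also have "\<dots> = (\<lambda>x. \<Sum>i<r. coef U F n d p (en i) * sym_monom U F n d (en i) x)"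
      by (intro ext sum.reindex_bij_betw[OF en, symmetric])
    finally have "de_finetti_seq U F n p =
        de_finetti_seq U F n (\<lambda>x. \<Sum>i<r. coef U F n d p (en i) * sym_monom U F n d (en i) x)"
      by (rule arg_cong)
    also have "\<dots> = (\<lambda>m x. \<Sum>i<r. c p i * v i m x)"
      by (simp add: de_finetti_seq_sum[OF pos] de_finetti_seq_scale[OF pos] v_def c_def)
    finally show ?thesis using finsum_inverse_limit_space[OF v] by simp
  qed
  have "(\<lambda>j. c (q j)) \<longlonglongrightarrow> c q'"
  proof (rule tendsto_nat_fun)
    fix i
    show "(\<lambda>j. c (q j) i) \<longlonglongrightarrow> c q' i"
      using de_finetti_approximation[OF n wW q(1) _ q', where M = "en i"] q(2) bij_betwE[OF en]
      by (auto simp: c_def y_def)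
  qed
  show "w \<in> usual_topology ?W closure_of limit_cone U F d \<Omega>"
    unfolding in_closure_of topspace_usual_topology[OF real_vspace_inverse_limit_space]
  proof (intro conjI allI impI)
    show "w \<in> carrier ?W" using wW by simp
    fix T assume T: "w \<in> T \<and> openin (usual_topology ?W) T"
    let ?O = "{c. finsum ?W (\<lambda>i. c i \<odot>\<^bsub>?W\<^esub> v i) {..<r} \<in> T}"
    have "open ?O" using T v by (simp add: openin_usual_topology)
    moreover have "c q' \<in> ?O" using comb[OF q'(1)] q'(2) T by simp
    ultimately have "\<forall>\<^sub>F j in sequentially. c (q j) \<in> ?O"
      using \<open>(\<lambda>j. c (q j)) \<longlonglongrightarrow> c q'\<close> by (rule topological_tendstoD[rotated])
    then obtain j where "c (q j) \<in> ?O" by (auto dest: eventually_happens)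
    then have "y j \<in> T" using comb[OF q(1)[of j]] q(2)[of j] by simp
    with y_cone[of j] show "\<exists>y. y \<in> limit_cone U F d \<Omega> \<and> y \<in> T" by blast
  qed
qed

section \<open>Pointedness and interior\<close>

lemma pointed_inverse_limit_cone:
  assumes "\<forall>n\<ge>1. pointed_in (inv_poly_space F n d) (pos_cone F d \<Omega> n)"
  shows "pointed_in (inverse_limit_space U F d) (inverse_limit_cone U F d \<Omega>)"
  unfolding pointed_in_def
proof (intro equalityI subsetI)
  fix w assume "w \<in> inverse_limit_cone U F d \<Omega> \<inter>
    a_inv (inverse_limit_space U F d) ` inverse_limit_cone U F d \<Omega>"
  then obtain v where v: "w \<in> inverse_limit_cone U F d \<Omega>" "v \<in> inverse_limit_cone U F d \<Omega>"
    "w = (\<lambda>n x. - v n x)"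
    by (auto simp: inverse_limit_cone_iff a_inv_inverse_limit_space)
  have "w n = (\<lambda>x. 0)" for n
  proof (cases "1 \<le> n")
    case True
    have "v n \<in> inv_polys F n d" using inverse_limit_cone_pos_cone[OF v(2) True] by (rule pos_coneD)
    then have "w n = \<ominus>\<^bsub>inv_poly_space F n d\<^esub> (v n)"
      by (simp add: v(3) a_inv_inv_poly_space)
    then have "w n \<in> pos_cone F d \<Omega> n \<inter> a_inv (inv_poly_space F n d) ` pos_cone F d \<Omega> n"
      using inverse_limit_cone_pos_cone[OF v(1) True] inverse_limit_cone_pos_cone[OF v(2) True] by blast
    moreover have "pointed_in (inv_poly_space F n d) (pos_cone F d \<Omega> n)" using assms True by blast
    ultimately show ?thesis unfolding pointed_in_def by simp
  next
    case False
    then show ?thesis using v(1) inverse_limitD(1)[of w U F d] by (simp add: inverse_limit_cone_iff not_le)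
  qed
  then show "w \<in> {\<zero>\<^bsub>inverse_limit_space U F d\<^esub>}" by (simp add: fun_eq_iff)
next
  fix w assume "w \<in> {\<zero>\<^bsub>inverse_limit_space U F d\<^esub>}"
  then have "w = (\<lambda>n x. 0)" by simp
  moreover have "(\<lambda>n x. 0) \<in> inverse_limit_cone U F d \<Omega>"
    by (simp add: inverse_limit_cone_iff inverse_limit_zero)
  moreover have "(\<lambda>n x. 0) = \<ominus>\<^bsub>inverse_limit_space U F d\<^esub> (\<lambda>n x. 0)"
    by (simp add: a_inv_inverse_limit_space inverse_limit_zero)
  ultimately show "w \<in> inverse_limit_cone U F d \<Omega> \<inter>
    a_inv (inverse_limit_space U F d) ` inverse_limit_cone U F d \<Omega>" by blast
qed

text \<open>Two opposite elements have representatives at a common large level, where the de Finetti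
  map is injective. So the representatives are opposite as well, and pointedness of the cone at that
  level applies.\<close>

lemma pointed_direct_limit_cone:
  assumes comp: "finset_compatible F U (other U) \<Omega>"
    and pt: "\<forall>n\<ge>1. pointed_in (inv_poly_space F n d) (pos_cone F d \<Omega> n)"
  shows "pointed_in (direct_limit_space (other U) F d) (direct_limit_cone (other U) F d \<Omega>)"
  unfolding pointed_in_def direct_limit_cone_eq
proof (intro equalityI subsetI)
  let ?D = "direct_limit_space (other U) F d"
  fix X assume "X \<in> dclass U F d ` limit_cone U F d \<Omega> \<inter> a_inv ?D ` dclass U F d ` limit_cone U F d \<Omega>"
  then obtain v w where vw: "w \<in> limit_cone U F d \<Omega>" "v \<in> limit_cone U F d \<Omega>"
    "X = dclass U F d w" "X = \<ominus>\<^bsub>?D\<^esub> (dclass U F d v)" by blast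
  have W: "w \<in> inverse_limit U F d" "v \<in> inverse_limit U F d" using vw limit_cone_subset by blast+
  have eq: "w = (\<lambda>n x. - v n x)"
    by (rule inj_onD[OF inj_on_dclass _ W(1) inverse_limit_minus[OF W(2)]])
      (use vw(3,4) W in \<open>simp add: a_inv_direct_limit_space\<close>)
  obtain N p q where N: "large F d N" "1 \<le> N" "p \<in> pos_cone F d \<Omega> N" "q \<in> pos_cone F d \<Omega> N"
    "de_finetti_seq U F N p = w" "de_finetti_seq U F N q = v"
    by (rule limit_cone_common[OF comp vw(1,2)])
  have "p = (\<lambda>x. - q x)"
  proof (rule inj_onD[OF bij_betw_imp_inj_on[OF bij_betw_de_finetti[OF N(1)]]])
    show "de_finetti_seq U F N p = de_finetti_seq U F N (\<lambda>x. - q x)"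
      using de_finetti_seq_scale[OF N(2), of U F "-1" q] by (simp add: N eq)
  qed (use N pos_coneD(1) inv_polys_minus in auto)
  then have "p = \<ominus>\<^bsub>inv_poly_space F N d\<^esub> q"
    using N by (simp add: a_inv_inv_poly_space pos_coneD(1))
  then have "p \<in> pos_cone F d \<Omega> N \<inter> a_inv (inv_poly_space F N d) ` pos_cone F d \<Omega> N"
    using N by blast
  moreover have "pointed_in (inv_poly_space F N d) (pos_cone F d \<Omega> N)" using pt N by blast
  ultimately have "p = (\<lambda>x. 0)" unfolding pointed_in_def by simp
  then have "w = (\<lambda>n x. 0)" using N by (metis de_finetti_seq_zero)
  then show "X \<in> {\<zero>\<^bsub>?D\<^esub>}" by (simp add: vw)
next
  let ?D = "direct_limit_space (other U) F d"
  fix X assume "X \<in> {\<zero>\<^bsub>?D\<^esub>}"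
  then have "X = dclass U F d (\<lambda>n x. 0)" by simp
  moreover have "(\<lambda>n x. 0) \<in> limit_cone U F d \<Omega>"
    using limit_coneI[OF order_refl pos_cone_zero, of U F d \<Omega>] by (simp add: de_finetti_seq_zero)
  moreover have "dclass U F d (\<lambda>n x. 0) = \<ominus>\<^bsub>?D\<^esub> (dclass U F d (\<lambda>n x. 0))"
    by (simp add: a_inv_direct_limit_space inverse_limit_zero)
  ultimately show "X \<in> dclass U F d ` limit_cone U F d \<Omega> \<inter> a_inv ?D ` dclass U F d ` limit_cone U F d \<Omega>"
    by blast
qed

lemma has_interior_limit_cone:
  assumes "\<forall>n\<ge>1. has_interior_in (inv_poly_space F n d) (pos_cone F d \<Omega> n)"
  shows "has_interior_in (inverse_limit_space U F d) (limit_cone U F d \<Omega>)"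
proof -
  obtain n where n: "large F d n" using ex_large by blast
  have "has_interior_in (inv_poly_space F n d) (pos_cone F d \<Omega> n)" using assms large_pos[OF n] by blast
  moreover have "de_finetti_seq U F n ` pos_cone F d \<Omega> n \<subseteq> limit_cone U F d \<Omega>"
    using limit_coneI[OF large_pos[OF n]] by blast
  ultimately show ?thesis
    by (rule has_interior_linear_iso[OF linear_iso_de_finetti[OF n] real_vspace_inv_poly_space
          real_vspace_inverse_limit_space])
qed

lemma has_interior_direct_limit_cone:
  assumes "has_interior_in (inverse_limit_space U F d) (limit_cone U F d \<Omega>)"
  shows "has_interior_in (direct_limit_space (other U) F d) (direct_limit_cone (other U) F d \<Omega>)"
proof -
  let ?D = "direct_limit_space (other U) F d" and ?i = "inv_into (inverse_limit U F d) (dclass U F d)"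
  have "inv_into (carrier ?D) ?i ` limit_cone U F d \<Omega> \<subseteq> direct_limit_cone (other U) F d \<Omega>"
  proof (rule image_subsetI)
    fix w assume w: "w \<in> limit_cone U F d \<Omega>"
    then have wW: "w \<in> inverse_limit U F d" using limit_cone_subset by blast
    have "inj_on ?i (carrier ?D)"
      using linear_iso_direct_limit by (auto simp: linear_iso_def bij_betw_def)
    then have "inv_into (carrier ?D) ?i (?i (dclass U F d w)) = dclass U F d w"
      using wW by (intro inv_into_f_f) auto
    then have "inv_into (carrier ?D) ?i w = dclass U F d w"
      using wW by (simp add: inv_into_f_f[OF inj_on_dclass])
    then show "inv_into (carrier ?D) ?i w \<in> direct_limit_cone (other U) F d \<Omega>"
      using w by (simp add: direct_limit_cone_eq)
  qed
  with assms show ?thesis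
    by (rule has_interior_linear_iso[OF linear_iso_inv_into[OF linear_iso_direct_limit
            real_vspace_direct_limit_space] real_vspace_inverse_limit_space real_vspace_direct_limit_space])
qed

lemma has_interior_mono: "has_interior_in M K \<Longrightarrow> K \<subseteq> K' \<Longrightarrow> has_interior_in M K'"
  unfolding has_interior_in_def using interior_of_mono by blast

theorem theorem5p7:
  fixes F :: construction and U L :: base_seq and \<Omega> :: "nat \<Rightarrow> vec set" and d :: nat
  assumes "finset_pair U L"
    and "finset_compatible F U L \<Omega>"
  shows
    "(\<exists>\<Phi>. linear_iso (direct_limit_space L F d) (inverse_limit_space U F d) \<Phi> \<and>
       (\<forall>k\<ge>1. \<forall>q\<in>inv_polys F k d. \<Phi> (dlim_inj L F d k q) = de_finetti_seq U F k q) \<and>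
       \<Phi> ` direct_limit_cone L F d \<Omega> \<subseteq> inverse_limit_cone U F d \<Omega> \<and>
       inverse_limit_cone U F d \<Omega> \<subseteq>
         usual_topology (inverse_limit_space U F d) closure_of (\<Phi> ` direct_limit_cone L F d \<Omega>)) \<and>
     (\<forall>n N. index_le U n N \<longrightarrow> outer_cone U F d \<Omega> N \<subseteq> outer_cone U F d \<Omega> n) \<and>
     (\<forall>n N. index_le L n N \<longrightarrow> inner_cone L F d \<Omega> n \<subseteq> inner_cone L F d \<Omega> N) \<and>
     cone_in (inverse_limit_space U F d) (inverse_limit_cone U F d \<Omega>) \<and>
     convex_in (inverse_limit_space U F d) (inverse_limit_cone U F d \<Omega>) \<and>
     cone_in (direct_limit_space L F d) (direct_limit_cone L F d \<Omega>) \<and>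
     convex_in (direct_limit_space L F d) (direct_limit_cone L F d \<Omega>) \<and>
     closedin (usual_topology (inverse_limit_space U F d)) (inverse_limit_cone U F d \<Omega>) \<and>
     ((\<forall>n\<ge>1. pointed_in (inv_poly_space F n d) (pos_cone F d \<Omega> n)) \<longrightarrow>
        pointed_in (inverse_limit_space U F d) (inverse_limit_cone U F d \<Omega>) \<and>
        pointed_in (direct_limit_space L F d) (direct_limit_cone L F d \<Omega>)) \<and>
     ((\<forall>n\<ge>1. has_interior_in (inv_poly_space F n d) (pos_cone F d \<Omega> n)) \<longrightarrow>
        has_interior_in (inverse_limit_space U F d) (inverse_limit_cone U F d \<Omega>) \<and>
        has_interior_in (direct_limit_space L F d) (direct_limit_cone L F d \<Omega>))"
proof -
  have L: "L = other U" using assms(1) by (simp add: finset_pair_iff)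
  have comp: "finset_compatible F U (other U) \<Omega>" using assms(2) by (simp add: L)
  let ?W = "inverse_limit_space U F d" and ?D = "direct_limit_space (other U) F d"
  \<comment> \<open>The inverse of \<open>dclass\<close>: a class goes to the common de Finetti
    sequence of its members.\<close>
  let ?\<Phi> = "inv_into (inverse_limit U F d) (dclass U F d)"
  have \<Phi>: "?\<Phi> (dclass U F d w) = w" if "w \<in> inverse_limit U F d" for w
    using that by (rule inv_into_f_f[OF inj_on_dclass])
  have \<Phi>_cone: "?\<Phi> ` direct_limit_cone (other U) F d \<Omega> = limit_cone U F d \<Omega>"
  proof -
    have "?\<Phi> ` dclass U F d ` limit_cone U F d \<Omega> = (\<lambda>w. w) ` limit_cone U F d \<Omega>"
      unfolding image_image using \<Phi> limit_cone_subset by (intro image_cong) blast+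
    then show ?thesis by (simp add: direct_limit_cone_eq)
  qed
  have \<Phi>_inj: "?\<Phi> (dlim_inj (other U) F d k q) = de_finetti_seq U F k q"
    if "1 \<le> k" "q \<in> inv_polys F k d" for k q
    using that by (simp add: dlim_inj_eq \<Phi> de_finetti_in_inverse_limit inv_polys_polys)
  have iso: "\<exists>\<Phi>. linear_iso ?D ?W \<Phi> \<and>
       (\<forall>k\<ge>1. \<forall>q\<in>inv_polys F k d. \<Phi> (dlim_inj (other U) F d k q) = de_finetti_seq U F k q) \<and>
       \<Phi> ` direct_limit_cone (other U) F d \<Omega> \<subseteq> inverse_limit_cone U F d \<Omega> \<and>
       inverse_limit_cone U F d \<Omega> \<subseteq>
         usual_topology ?W closure_of (\<Phi> ` direct_limit_cone (other U) F d \<Omega>)"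
    by (rule exI[of _ ?\<Phi>])
      (use \<Phi>_inj in \<open>simp add: linear_iso_direct_limit \<Phi>_cone inverse_limit_cone_subset_closure
        limit_cone_subset_inverse_limit_cone[OF comp]\<close>)
  have cone: "cone_in ?W (inverse_limit_cone U F d \<Omega>)" "convex_in ?W (inverse_limit_cone U F d \<Omega>)"
    by (auto simp: cone_in_def convex_in_def inverse_limit_cone_iff inverse_limit_scale inverse_limit_add)
  have Wc: "w \<in> inverse_limit U F d" if "w \<in> limit_cone U F d \<Omega>" for w
    using that limit_cone_subset by blast
  have dcone: "cone_in ?D (direct_limit_cone (other U) F d \<Omega>)"
    "convex_in ?D (direct_limit_cone (other U) F d \<Omega>)"
    unfolding cone_in_def convex_in_def direct_limit_cone_eq
    using limit_cone_subset[of U F d \<Omega>]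
    by (auto simp: Wc inverse_limit_scale intro!: imageI limit_cone_scale limit_cone_add[OF comp])
  have interior: "has_interior_in ?W (inverse_limit_cone U F d \<Omega>) \<and>
      has_interior_in ?D (direct_limit_cone (other U) F d \<Omega>)"
    if "\<forall>n\<ge>1. has_interior_in (inv_poly_space F n d) (pos_cone F d \<Omega> n)"
    using has_interior_limit_cone[OF that, of U] has_interior_mono
      limit_cone_subset_inverse_limit_cone[OF comp] has_interior_direct_limit_cone by blast
  show ?thesis
    unfolding L
    using iso cone dcone interior outer_cone_mono[OF comp] inner_cone_mono[OF comp]
      closedin_inverse_limit_cone pointed_inverse_limit_cone pointed_direct_limit_cone[OF comp]
    by (intro conjI impI allI) auto
qed

end
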